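(* Let $X$ be a compact Riemann surface, $F$ a holomorphic vector bundle of finite rank on $X$ with a Hermitian metric, and $E=\Pi(F\oplus F^\vee\otimes\omega_X)$. Let $\mathcal O_{\mathrm{BV}}=\bigwedge^\bullet\mathbb H^0(X,E)\otimes_{\mathbb C}\mathrm{Sym}\,\mathbb H^1(X,E)$ and $\Delta_{\mathrm{BV}}=\sum_{i,j}I^{ij}\partial_{e^0_i}\partial_{e^1_j}$. Then $(\mathcal O_{\mathrm{BV}},\Delta_{\mathrm{BV}})$ is a Batalin–Vilkovisky superalgebra: $\Delta_{\mathrm{BV}}$ is an odd operator with $\Delta_{\mathrm{BV}}^2=0$, and the bracket $$\{a,b\}_{\mathrm{BV}}:=\Delta_{\mathrm{BV}}(ab)-(\Delta_{\mathrm{BV}}a)b-(-1)^{|a|}a(\Delta_{\mathrm{BV}}b)$$ satisfies, for all homogeneous $a,b$ and all $c$ in $\mathcal O_{\mathrm{BV}}$, the graded Leibniz rule $$\{a,bc\}_{\mathrm{BV}}=\{a,b\}_{\mathrm{BV}}\,c+(-1)^{(|a|+1)|b|}\,b\,\{a,c\}_{\mathrm{BV}}.$$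
   Context: $\omega_X$ is the canonical sheaf. $W=F\oplus F^\vee\otimes\omega_X$ has the symmetric pairing $B((f,\varphi),(f',\varphi'))=\varphi(f')+\varphi'(f)\in\omega_X$; $E=\Pi W$ is its parity shift (purely odd) with symmetric pairing $\langle\Pi w,\Pi w'\rangle=B(w,w')$. $\mathbb H^i(X,W)$, $i=0,1$, is the finite-dimensional space of harmonic elements ($\ker\bar\partial\cap\ker\bar\partial^*$) of $\Omega^{0,i}(X,W)$ for the induced Hermitian metric, and $\mathbb H^i(X,E)=\Pi\mathbb H^i(X,W)$. By Serre duality the pairing $\int_X\langle-,-\rangle:\mathbb H^0(X,E)\otimes\mathbb H^1(X,E)\to\mathbb C$ is perfect; put $n=\dim\mathbb H^0=\dim\mathbb H^1$. Fix bases $\{e^0_i\}_{i=1}^n$ of $\mathbb H^0(X,E)$ and $\{e^1_j\}_{j=1}^n$ of $\mathbb H^1(X,E)$; $M_{ij}=\int_X\langle e^0_i,e^1_j\rangle$, and $I^{ij}$ are the entries of the inverse matrix. In the supercommutative algebra $\mathcal O_{\mathrm{BV}}$ the generators $e^0_i$ are odd and the generators $e^1_j$ are even; $\partial_{e^0_i}$ (odd, Grassmann) and $\partial_{e^1_j}$ (even) are the corresponding derivations. $|a|$ is the parity of $a$. *)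

theory Defs
  imports
    "HOL-Analysis.Analysis"
    "HOL-Algebra.QuotRing"
    "HOL-Algebra.Module"
    "HOL-Library.Poly_Mapping"
    "HOL-Library.Function_Algebras"
begin

section \<open>Compact Riemann surfaces\<close>

primrec C_k_on :: "nat \<Rightarrow> complex set \<Rightarrow> (complex \<Rightarrow> complex) \<Rightarrow> bool" where
  "C_k_on 0 S f \<longleftrightarrow> continuous_on S f"
| "C_k_on (Suc k) S f \<longleftrightarrow>
     (\<forall>w\<in>S. f differentiable (at w)) \<and>
     C_k_on k S (\<lambda>w. frechet_derivative f (at w) 1) \<and>
     C_k_on k S (\<lambda>w. frechet_derivative f (at w) \<i>)"

text \<open>Smoothness in the real sense, on an open set.\<close>

definition smooth_on :: "complex set \<Rightarrow> (complex \<Rightarrow> complex) \<Rightarrow> bool" where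
  "smooth_on S f \<longleftrightarrow> (\<forall>k. C_k_on k S f)"

text \<open>The Wirtinger derivative with respect to the conjugate coordinate.\<close>

definition d_zbar :: "(complex \<Rightarrow> complex) \<Rightarrow> complex \<Rightarrow> complex" where
  "d_zbar f w = (frechet_derivative f (at w) 1 + \<i> * frechet_derivative f (at w) \<i>) / 2"

text \<open>A complex atlas on the space \<^term>\<open>UNIV :: 'x set\<close>, indexed by a set of labels of type \<open>'a\<close>.\<close>

record ('x, 'a) surface =
  chart_idx :: "'a set"
  chart_dom :: "'a \<Rightarrow> 'x set"
  chart_map :: "'a \<Rightarrow> 'x \<Rightarrow> complex"

definition chart_image :: "('x, 'a) surface \<Rightarrow> 'a \<Rightarrow> complex set" where
  "chart_image X \<alpha> = chart_map X \<alpha> ` chart_dom X \<alpha>"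

definition chart_inv :: "('x, 'a) surface \<Rightarrow> 'a \<Rightarrow> complex \<Rightarrow> 'x" where
  "chart_inv X \<alpha> = inv_into (chart_dom X \<alpha>) (chart_map X \<alpha>)"

definition compact_riemann_surface :: "('x::t2_space, 'a) surface \<Rightarrow> bool" where
  "compact_riemann_surface X \<longleftrightarrow>
     compact (UNIV :: 'x set) \<and> connected (UNIV :: 'x set) \<and>
     (\<Union>\<alpha>\<in>chart_idx X. chart_dom X \<alpha>) = UNIV \<and>
     (\<forall>\<alpha>\<in>chart_idx X. open (chart_dom X \<alpha>) \<and> open (chart_image X \<alpha>) \<and>
        homeomorphism (chart_dom X \<alpha>) (chart_image X \<alpha>) (chart_map X \<alpha>) (chart_inv X \<alpha>)) \<and>
     (\<forall>\<alpha>\<in>chart_idx X. \<forall>\<beta>\<in>chart_idx X.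
        (\<lambda>w. chart_map X \<alpha> (chart_inv X \<beta> w)) holomorphic_on
          (chart_map X \<beta> ` (chart_dom X \<alpha> \<inter> chart_dom X \<beta>)))"

text \<open>The derivative $dz_\beta / dz_\alpha$ of the coordinate change, as a function on the overlap.\<close>

definition dcoord :: "('x, 'a) surface \<Rightarrow> 'a \<Rightarrow> 'a \<Rightarrow> 'x \<Rightarrow> complex" where
  "dcoord X \<beta> \<alpha> x = deriv (\<lambda>w. chart_map X \<beta> (chart_inv X \<alpha> w)) (chart_map X \<alpha> x)"

text \<open>A Hermitian metric $\rho_\alpha |dz_\alpha|^2$ on the surface itself; its area form is
  $\rho_\alpha\,dx_\alpha\wedge dy_\alpha$.\<close>

definition surface_metric :: "('x, 'a) surface \<Rightarrow> ('a \<Rightarrow> 'x \<Rightarrow> real) \<Rightarrow> bool" where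
  "surface_metric X \<rho> \<longleftrightarrow>
     (\<forall>\<alpha>\<in>chart_idx X.
        (\<forall>x\<in>chart_dom X \<alpha>. \<rho> \<alpha> x > 0) \<and>
        smooth_on (chart_image X \<alpha>) (\<lambda>w. of_real (\<rho> \<alpha> (chart_inv X \<alpha> w)))) \<and>
     (\<forall>\<alpha>\<in>chart_idx X. \<forall>\<beta>\<in>chart_idx X. \<forall>x\<in>chart_dom X \<alpha> \<inter> chart_dom X \<beta>.
        \<rho> \<alpha> x = \<rho> \<beta> x * (cmod (dcoord X \<beta> \<alpha> x))\<^sup>2)"

definition partition_of_unity ::
    "('x::topological_space, 'a) surface \<Rightarrow> 'a set \<Rightarrow> ('a \<Rightarrow> 'x \<Rightarrow> real) \<Rightarrow> bool" where
  "partition_of_unity X I \<psi> \<longleftrightarrow>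
     finite I \<and> I \<subseteq> chart_idx X \<and>
     (\<forall>\<alpha>\<in>I. (\<forall>x. \<psi> \<alpha> x \<ge> 0) \<and> closure {x. \<psi> \<alpha> x \<noteq> 0} \<subseteq> chart_dom X \<alpha> \<and>
        (\<forall>\<beta>\<in>chart_idx X.
           smooth_on (chart_image X \<beta>) (\<lambda>w. of_real (\<psi> \<alpha> (chart_inv X \<beta> w))))) \<and>
     (\<forall>x. (\<Sum>\<alpha>\<in>I. \<psi> \<alpha> x) = 1)"

text \<open>The integral over \<open>X\<close> of the 2-form given by $\theta_\alpha\,dz_\alpha\wedge d\bar z_\alpha$
  in the charts; $dz\wedge d\bar z = -2i\,dx\wedge dy$. The value does not depend on
  the partition of unity that is chosen.\<close>

definition surface_integral ::
    "('x::topological_space, 'a) surface \<Rightarrow> ('a \<Rightarrow> 'x \<Rightarrow> complex) \<Rightarrow> complex" where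
  "surface_integral X \<theta> =
     (case (SOME (I, \<psi>). partition_of_unity X I \<psi>) of (I, \<psi>) \<Rightarrow>
        \<Sum>\<alpha>\<in>I. set_lebesgue_integral lborel (chart_image X \<alpha>)
          (\<lambda>w. of_real (\<psi> \<alpha> (chart_inv X \<alpha> w)) * \<theta> \<alpha> (chart_inv X \<alpha> w) * (- 2 * \<i>)))"


section \<open>Holomorphic vector bundles and Hermitian metrics\<close>

text \<open>A bundle is given by its transition matrices with respect to holomorphic frames over the
  chart domains of the atlas (every holomorphic bundle is of this form after a
  refinement of the atlas). The finite set \<open>frame_idx\<close>, possibly empty, indexes the frames. The
  components of a section transform by $s_\alpha = g_{\alpha\beta} s_\beta$.\<close>

record ('x, 'a, 'r) vbundle =
  frame_idx :: "'r set"
  transition :: "'a \<Rightarrow> 'a \<Rightarrow> 'x \<Rightarrow> 'r \<Rightarrow> 'r \<Rightarrow> complex"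

definition holomorphic_bundle :: "('x, 'a) surface \<Rightarrow> ('x, 'a, 'r) vbundle \<Rightarrow> bool" where
  "holomorphic_bundle X V \<longleftrightarrow>
     finite (frame_idx V) \<and>
     (\<forall>\<alpha>\<in>chart_idx X. \<forall>\<beta>\<in>chart_idx X. \<forall>k\<in>frame_idx V. \<forall>l\<in>frame_idx V.
        (\<lambda>w. transition V \<alpha> \<beta> (chart_inv X \<alpha> w) k l) holomorphic_on
          (chart_map X \<alpha> ` (chart_dom X \<alpha> \<inter> chart_dom X \<beta>))) \<and>
     (\<forall>\<alpha>\<in>chart_idx X. \<forall>x\<in>chart_dom X \<alpha>. \<forall>k\<in>frame_idx V. \<forall>l\<in>frame_idx V.
        transition V \<alpha> \<alpha> x k l = of_bool (k = l)) \<and>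
     (\<forall>\<alpha>\<in>chart_idx X. \<forall>\<beta>\<in>chart_idx X. \<forall>\<gamma>\<in>chart_idx X.
      \<forall>x\<in>chart_dom X \<alpha> \<inter> chart_dom X \<beta> \<inter> chart_dom X \<gamma>. \<forall>k\<in>frame_idx V. \<forall>m\<in>frame_idx V.
        (\<Sum>l\<in>frame_idx V. transition V \<alpha> \<beta> x k l * transition V \<beta> \<gamma> x l m)
          = transition V \<alpha> \<gamma> x k m)"

text \<open>\<^term>\<open>h \<alpha> x k l\<close> is the inner product of the \<open>k\<close>-th with the \<open>l\<close>-th frame vector, linear in
  the first and conjugate linear in the second argument.\<close>

definition hermitian_metric ::
    "('x, 'a) surface \<Rightarrow> ('x, 'a, 'r) vbundle \<Rightarrow> ('a \<Rightarrow> 'x \<Rightarrow> 'r \<Rightarrow> 'r \<Rightarrow> complex) \<Rightarrow> bool" where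
  "hermitian_metric X V h \<longleftrightarrow>
     (\<forall>\<alpha>\<in>chart_idx X. \<forall>k\<in>frame_idx V. \<forall>l\<in>frame_idx V.
        smooth_on (chart_image X \<alpha>) (\<lambda>w. h \<alpha> (chart_inv X \<alpha> w) k l) \<and>
        (\<forall>x\<in>chart_dom X \<alpha>. h \<alpha> x k l = cnj (h \<alpha> x l k))) \<and>
     (\<forall>\<alpha>\<in>chart_idx X. \<forall>x\<in>chart_dom X \<alpha>. \<forall>v. (\<exists>k\<in>frame_idx V. v k \<noteq> 0) \<longrightarrow>
        0 < Re (\<Sum>k\<in>frame_idx V. \<Sum>l\<in>frame_idx V. v k * cnj (v l) * h \<alpha> x k l)) \<and>
     (\<forall>\<alpha>\<in>chart_idx X. \<forall>\<beta>\<in>chart_idx X. \<forall>x\<in>chart_dom X \<alpha> \<inter> chart_dom X \<beta>.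
      \<forall>k\<in>frame_idx V. \<forall>l\<in>frame_idx V.
        h \<beta> x k l = (\<Sum>p\<in>frame_idx V. \<Sum>q\<in>frame_idx V.
          transition V \<alpha> \<beta> x p k * cnj (transition V \<alpha> \<beta> x q l) * h \<alpha> x p q))"

text \<open>The inverse of an invertible square matrix with rows and columns indexed by \<open>J\<close>; only the
  entries with both indices in \<open>J\<close> are meaningful.\<close>

definition inverse_on :: "'i set \<Rightarrow> ('i \<Rightarrow> 'i \<Rightarrow> complex) \<Rightarrow> 'i \<Rightarrow> 'i \<Rightarrow> complex" where
  "inverse_on J A = (SOME B. \<forall>i\<in>J. \<forall>k\<in>J.
     (\<Sum>j\<in>J. A i j * B j k) = of_bool (i = k) \<and> (\<Sum>j\<in>J. B i j * A j k) = of_bool (i = k))"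

text \<open>The canonical bundle, with frame $dz_\alpha$, so that $|dz_\alpha|^2 = 1/\rho_\alpha$.\<close>

definition canonical_bundle :: "('x, 'a) surface \<Rightarrow> ('x, 'a, unit) vbundle" where
  "canonical_bundle X = \<lparr>frame_idx = {()}, transition = (\<lambda>\<alpha> \<beta> x _ _. dcoord X \<beta> \<alpha> x)\<rparr>"

definition canonical_metric :: "('a \<Rightarrow> 'x \<Rightarrow> real) \<Rightarrow> 'a \<Rightarrow> 'x \<Rightarrow> unit \<Rightarrow> unit \<Rightarrow> complex" where
  "canonical_metric \<rho> \<alpha> x _ _ = of_real (1 / \<rho> \<alpha> x)"

text \<open>Dual frames: the transition matrix is the transpose of
  $g_{\alpha\beta}^{-1} = g_{\beta\alpha}$, the metric is the transpose of $h^{-1}$.\<close>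

definition dual_bundle :: "('x, 'a, 'r) vbundle \<Rightarrow> ('x, 'a, 'r) vbundle" where
  "dual_bundle V = \<lparr>frame_idx = frame_idx V, transition = (\<lambda>\<alpha> \<beta> x k l. transition V \<beta> \<alpha> x l k)\<rparr>"

definition dual_metric ::
    "('x, 'a, 'r) vbundle \<Rightarrow> ('a \<Rightarrow> 'x \<Rightarrow> 'r \<Rightarrow> 'r \<Rightarrow> complex) \<Rightarrow> 'a \<Rightarrow> 'x \<Rightarrow> 'r \<Rightarrow> 'r \<Rightarrow> complex" where
  "dual_metric V h \<alpha> x k l = inverse_on (frame_idx V) (h \<alpha> x) l k"

definition tensor_bundle ::
    "('x, 'a, 'r) vbundle \<Rightarrow> ('x, 'a, 's) vbundle \<Rightarrow> ('x, 'a, 'r \<times> 's) vbundle" where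
  "tensor_bundle V V' = \<lparr>frame_idx = frame_idx V \<times> frame_idx V',
     transition = (\<lambda>\<alpha> \<beta> x (k, k') (l, l'). transition V \<alpha> \<beta> x k l * transition V' \<alpha> \<beta> x k' l')\<rparr>"

definition tensor_metric ::
    "('a \<Rightarrow> 'x \<Rightarrow> 'r \<Rightarrow> 'r \<Rightarrow> complex) \<Rightarrow> ('a \<Rightarrow> 'x \<Rightarrow> 's \<Rightarrow> 's \<Rightarrow> complex) \<Rightarrow>
     'a \<Rightarrow> 'x \<Rightarrow> 'r \<times> 's \<Rightarrow> 'r \<times> 's \<Rightarrow> complex" where
  "tensor_metric h h' \<alpha> x = (\<lambda>(k, k') (l, l'). h \<alpha> x k l * h' \<alpha> x k' l')"

definition block_diag ::
    "('r \<Rightarrow> 'r \<Rightarrow> complex) \<Rightarrow> ('s \<Rightarrow> 's \<Rightarrow> complex) \<Rightarrow> 'r + 's \<Rightarrow> 'r + 's \<Rightarrow> complex" where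
  "block_diag A B i j = (case (i, j) of
     (Inl k, Inl l) \<Rightarrow> A k l | (Inr k, Inr l) \<Rightarrow> B k l | _ \<Rightarrow> 0)"

definition sum_bundle ::
    "('x, 'a, 'r) vbundle \<Rightarrow> ('x, 'a, 's) vbundle \<Rightarrow> ('x, 'a, 'r + 's) vbundle" where
  "sum_bundle V V' = \<lparr>frame_idx = frame_idx V <+> frame_idx V',
     transition = (\<lambda>\<alpha> \<beta> x. block_diag (transition V \<alpha> \<beta> x) (transition V' \<alpha> \<beta> x))\<rparr>"

definition sum_metric ::
    "('a \<Rightarrow> 'x \<Rightarrow> 'r \<Rightarrow> 'r \<Rightarrow> complex) \<Rightarrow> ('a \<Rightarrow> 'x \<Rightarrow> 's \<Rightarrow> 's \<Rightarrow> complex) \<Rightarrow>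
     'a \<Rightarrow> 'x \<Rightarrow> 'r + 's \<Rightarrow> 'r + 's \<Rightarrow> complex" where
  "sum_metric h h' \<alpha> x = block_diag (h \<alpha> x) (h' \<alpha> x)"


section \<open>Bundle-valued forms and harmonic elements\<close>

text \<open>An element of $\Omega^{0,i}(X,V)$, $i \le 1$, is the family of its component functions
  with respect to the frames (times $d\bar z_\alpha$ if $i = 1$), extended by 0 outside the range
  of the indices, so that equality and the linear structure are those of functions.\<close>

type_synonym ('x, 'a, 'r) form = "'a \<Rightarrow> 'x \<Rightarrow> 'r \<Rightarrow> complex"

definition forms :: "('x, 'a) surface \<Rightarrow> ('x, 'a, 'r) vbundle \<Rightarrow> nat \<Rightarrow> ('x, 'a, 'r) form set" where
  "forms X V i = {s.
     (\<forall>\<alpha> x k. \<not> (\<alpha> \<in> chart_idx X \<and> x \<in> chart_dom X \<alpha> \<and> k \<in> frame_idx V) \<longrightarrow> s \<alpha> x k = 0) \<and>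
     (\<forall>\<alpha>\<in>chart_idx X. \<forall>k\<in>frame_idx V.
        smooth_on (chart_image X \<alpha>) (\<lambda>w. s \<alpha> (chart_inv X \<alpha> w) k)) \<and>
     (\<forall>\<alpha>\<in>chart_idx X. \<forall>\<beta>\<in>chart_idx X. \<forall>x\<in>chart_dom X \<alpha> \<inter> chart_dom X \<beta>. \<forall>k\<in>frame_idx V.
        s \<alpha> x k = cnj (dcoord X \<beta> \<alpha> x) ^ i * (\<Sum>l\<in>frame_idx V. transition V \<alpha> \<beta> x k l * s \<beta> x l))}"

definition form_scale :: "complex \<Rightarrow> ('x, 'a, 'r) form \<Rightarrow> ('x, 'a, 'r) form" where
  "form_scale c s = (\<lambda>\<alpha> x k. c * s \<alpha> x k)"

text \<open>The frames being holomorphic, the Dolbeault operator acts on components; on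
  $\Omega^{0,1}$ it is 0 since there are no $(0,2)$-forms.\<close>

definition dbar ::
    "('x, 'a) surface \<Rightarrow> ('x, 'a, 'r) vbundle \<Rightarrow> nat \<Rightarrow> ('x, 'a, 'r) form \<Rightarrow> ('x, 'a, 'r) form" where
  "dbar X V i s = (if i = 0 then (\<lambda>\<alpha> x k.
       if \<alpha> \<in> chart_idx X \<and> x \<in> chart_dom X \<alpha> \<and> k \<in> frame_idx V
       then d_zbar (\<lambda>w. s \<alpha> (chart_inv X \<alpha> w) k) (chart_map X \<alpha> x) else 0) else 0)"

text \<open>The $L^2$ inner product on $\Omega^{0,i}(X,V)$: the integrand is the pointwise inner product
  (with $|d\bar z|^2 = 1/\rho$) times the area form $(i/2)\,\rho\,dz\wedge d\bar z$.\<close>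

definition L2_inner ::
    "('x::topological_space, 'a) surface \<Rightarrow> ('a \<Rightarrow> 'x \<Rightarrow> real) \<Rightarrow> ('x, 'a, 'r) vbundle \<Rightarrow>
     ('a \<Rightarrow> 'x \<Rightarrow> 'r \<Rightarrow> 'r \<Rightarrow> complex) \<Rightarrow> nat \<Rightarrow> ('x, 'a, 'r) form \<Rightarrow> ('x, 'a, 'r) form \<Rightarrow> complex" where
  "L2_inner X \<rho> V h i s t = surface_integral X (\<lambda>\<alpha> x.
     (\<Sum>k\<in>frame_idx V. \<Sum>l\<in>frame_idx V. s \<alpha> x k * cnj (t \<alpha> x l) * h \<alpha> x k l)
       * of_real (1 / \<rho> \<alpha> x) ^ i * (\<i> / 2 * of_real (\<rho> \<alpha> x)))"

text \<open>The adjoint of $\bar\partial\colon \Omega^{0,0} \to \Omega^{0,1}$; on $\Omega^{0,0}$ it is 0.\<close>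

definition dbar_star ::
    "('x::topological_space, 'a) surface \<Rightarrow> ('a \<Rightarrow> 'x \<Rightarrow> real) \<Rightarrow> ('x, 'a, 'r) vbundle \<Rightarrow>
     ('a \<Rightarrow> 'x \<Rightarrow> 'r \<Rightarrow> 'r \<Rightarrow> complex) \<Rightarrow> nat \<Rightarrow> ('x, 'a, 'r) form \<Rightarrow> ('x, 'a, 'r) form" where
  "dbar_star X \<rho> V h i \<eta> = (if i = 1 then
     (THE \<zeta>. \<zeta> \<in> forms X V 0 \<and>
        (\<forall>s\<in>forms X V 0. L2_inner X \<rho> V h 0 s \<zeta> = L2_inner X \<rho> V h 1 (dbar X V 0 s) \<eta>)) else 0)"

definition harmonic ::
    "('x::topological_space, 'a) surface \<Rightarrow> ('a \<Rightarrow> 'x \<Rightarrow> real) \<Rightarrow> ('x, 'a, 'r) vbundle \<Rightarrow>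
     ('a \<Rightarrow> 'x \<Rightarrow> 'r \<Rightarrow> 'r \<Rightarrow> complex) \<Rightarrow> nat \<Rightarrow> ('x, 'a, 'r) form set" where
  "harmonic X \<rho> V h i = {s \<in> forms X V i. dbar X V i s = 0 \<and> dbar_star X \<rho> V h i s = 0}"

global_interpretation form: vector_space "form_scale :: complex \<Rightarrow> ('x, 'a, 'r) form \<Rightarrow> ('x, 'a, 'r) form"
  by unfold_locales (auto simp: form_scale_def fun_eq_iff algebra_simps)

definition is_basis :: "nat \<Rightarrow> ('x, 'a, 'r) form set \<Rightarrow> (nat \<Rightarrow> ('x, 'a, 'r) form) \<Rightarrow> bool" where
  "is_basis n H e \<longleftrightarrow>
     inj_on e {1..n} \<and> form.independent (e ` {1..n}) \<and> form.span (e ` {1..n}) = H"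


section \<open>The bundle W and the Serre pairing\<close>

definition W_bundle :: "('x, 'a) surface \<Rightarrow> ('x, 'a, 'r) vbundle \<Rightarrow> ('x, 'a, 'r + 'r \<times> unit) vbundle" where
  "W_bundle X F = sum_bundle F (tensor_bundle (dual_bundle F) (canonical_bundle X))"

definition W_metric ::
    "('a \<Rightarrow> 'x \<Rightarrow> real) \<Rightarrow> ('x, 'a, 'r) vbundle \<Rightarrow> ('a \<Rightarrow> 'x \<Rightarrow> 'r \<Rightarrow> 'r \<Rightarrow> complex) \<Rightarrow>
     'a \<Rightarrow> 'x \<Rightarrow> 'r + 'r \<times> unit \<Rightarrow> 'r + 'r \<times> unit \<Rightarrow> complex" where
  "W_metric \<rho> F h = sum_metric h (tensor_metric (dual_metric F h) (canonical_metric \<rho>))"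

text \<open>The parity shift does not change the underlying vector space, so the harmonic space of
  $E = \Pi W$ has the same elements as that of $W$; the parities enter only in \<open>O_BV\<close> below:
  degree-0 elements are odd, degree-1 elements (form degree 1 plus the shift) are even.\<close>

definition harmonic_E ::
    "('x::topological_space, 'a) surface \<Rightarrow> ('a \<Rightarrow> 'x \<Rightarrow> real) \<Rightarrow> ('x, 'a, 'r) vbundle \<Rightarrow>
     ('a \<Rightarrow> 'x \<Rightarrow> 'r \<Rightarrow> 'r \<Rightarrow> complex) \<Rightarrow> nat \<Rightarrow> ('x, 'a, 'r + 'r \<times> unit) form set" where
  "harmonic_E X \<rho> F h i = harmonic X \<rho> (W_bundle X F) (W_metric \<rho> F h) i"

text \<open>The symmetric pairing $B((f,\varphi),(f',\varphi')) = \varphi(f') + \varphi'(f)$ in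
  components, as a coefficient of $dz_\alpha$.\<close>

definition W_pairing ::
    "('x, 'a, 'r) vbundle \<Rightarrow> ('x, 'a, 'r + 'r \<times> unit) form \<Rightarrow> ('x, 'a, 'r + 'r \<times> unit) form \<Rightarrow>
     'a \<Rightarrow> 'x \<Rightarrow> complex" where
  "W_pairing F w w' \<alpha> x =
     (\<Sum>k\<in>frame_idx F. w \<alpha> x (Inr (k, ())) * w' \<alpha> x (Inl k)) +
     (\<Sum>k\<in>frame_idx F. w' \<alpha> x (Inr (k, ())) * w \<alpha> x (Inl k))"

text \<open>For forms \<open>w\<close>, \<open>w'\<close> of degree 0 and 1 the pairing is an element of
  $\Omega^{0,1}(X,\omega_X)$, which is identified with $\Omega^{1,1}(X)$ by
  $dz \otimes d\bar z \mapsto dz \wedge d\bar z$. For bases \<open>e0\<close>, \<open>e1\<close> of the harmonic spaces the matrix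
  is invertible by Serre duality.\<close>

definition serre_matrix ::
    "('x::topological_space, 'a) surface \<Rightarrow> ('x, 'a, 'r) vbundle \<Rightarrow>
     (nat \<Rightarrow> ('x, 'a, 'r + 'r \<times> unit) form) \<Rightarrow> (nat \<Rightarrow> ('x, 'a, 'r + 'r \<times> unit) form) \<Rightarrow>
     nat \<Rightarrow> nat \<Rightarrow> complex" where
  "serre_matrix X F e0 e1 i j = surface_integral X (W_pairing F (e0 i) (e1 j))"


section \<open>Exterior, symmetric and tensor product algebras\<close>

text \<open>A complex algebra is a ring with a scalar multiplication, i.e. a record
  \<^typ>\<open>(complex, 'm) module\<close>.\<close>

definition complex_ring :: "complex ring" where
  "complex_ring = \<lparr>carrier = UNIV, mult = (*), one = 1, zero = 0, add = (+)\<rparr>"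

definition monoid_algebra :: "('m, 'z) monoid_scheme \<Rightarrow> (complex, 'm \<Rightarrow>\<^sub>0 complex) module" where
  "monoid_algebra M =
     \<lparr>carrier = {p. Poly_Mapping.keys p \<subseteq> carrier M},
      mult = (\<lambda>p q. \<Sum>x\<in>Poly_Mapping.keys p. \<Sum>y\<in>Poly_Mapping.keys q.
        Poly_Mapping.single (x \<otimes>\<^bsub>M\<^esub> y) (Poly_Mapping.lookup p x * Poly_Mapping.lookup q y)),
      one = Poly_Mapping.single \<one>\<^bsub>M\<^esub> 1,
      zero = 0,
      add = (+),
      smult = (\<lambda>c p. Poly_Mapping.map ((*) c) p)\<rparr>"

text \<open>The quotient by the two-sided ideal generated by \<open>R\<close>, and the canonical projection to it.\<close>

definition quotient_algebra :: "(complex, 'm) module \<Rightarrow> 'm set \<Rightarrow> (complex, 'm set) module" where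
  "quotient_algebra A R =
     (let I = genideal A R; Q = A Quot I in
      \<lparr>carrier = carrier Q, mult = mult Q, one = one Q, zero = zero Q, add = add Q,
       smult = (\<lambda>c a. (I +>\<^bsub>A\<^esub> (c \<odot>\<^bsub>A\<^esub> \<one>\<^bsub>A\<^esub>)) \<otimes>\<^bsub>Q\<^esub> a)\<rparr>)"

definition quotient_map :: "(complex, 'm) module \<Rightarrow> 'm set \<Rightarrow> 'm \<Rightarrow> 'm set" where
  "quotient_map A R x = genideal A R +>\<^bsub>A\<^esub> x"

definition free_algebra :: "'v set \<Rightarrow> (complex, 'v list \<Rightarrow>\<^sub>0 complex) module" where
  "free_algebra V = monoid_algebra \<lparr>carrier = lists V, mult = (@), one = []\<rparr>"

text \<open>For a subspace \<open>V\<close> of a complex vector space with scalar multiplication \<open>sc\<close>, the free algebra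
  on the set \<open>V\<close> modulo these relations is the tensor algebra of \<open>V\<close>.\<close>

definition linear_relations ::
    "(complex \<Rightarrow> 'v \<Rightarrow> 'v) \<Rightarrow> 'v::ab_group_add set \<Rightarrow> ('v list \<Rightarrow>\<^sub>0 complex) set" where
  "linear_relations sc V =
     {Poly_Mapping.single [u + v] 1 - Poly_Mapping.single [u] 1 - Poly_Mapping.single [v] 1
        | u v. u \<in> V \<and> v \<in> V} \<union>
     {Poly_Mapping.single [sc c v] 1 - Poly_Mapping.single [v] c | c v. v \<in> V}"

definition exterior_relations ::
    "(complex \<Rightarrow> 'v \<Rightarrow> 'v) \<Rightarrow> 'v::ab_group_add set \<Rightarrow> ('v list \<Rightarrow>\<^sub>0 complex) set" where
  "exterior_relations sc V =
     linear_relations sc V \<union> {Poly_Mapping.single [v, v] 1 | v. v \<in> V}"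

definition exterior_algebra ::
    "(complex \<Rightarrow> 'v \<Rightarrow> 'v) \<Rightarrow> 'v::ab_group_add set \<Rightarrow> (complex, ('v list \<Rightarrow>\<^sub>0 complex) set) module" where
  "exterior_algebra sc V = quotient_algebra (free_algebra V) (exterior_relations sc V)"

text \<open>The part of the exterior algebra of degree \<open>p\<close> modulo 2.\<close>

definition exterior_parity ::
    "(complex \<Rightarrow> 'v \<Rightarrow> 'v) \<Rightarrow> 'v::ab_group_add set \<Rightarrow> nat \<Rightarrow> ('v list \<Rightarrow>\<^sub>0 complex) set set" where
  "exterior_parity sc V p = quotient_map (free_algebra V) (exterior_relations sc V) `
     {q. Poly_Mapping.keys q \<subseteq> {w \<in> lists V. length w mod 2 = p mod 2}}"

definition symmetric_relations ::
    "(complex \<Rightarrow> 'v \<Rightarrow> 'v) \<Rightarrow> 'v::ab_group_add set \<Rightarrow> ('v list \<Rightarrow>\<^sub>0 complex) set" where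
  "symmetric_relations sc V =
     linear_relations sc V \<union>
     {Poly_Mapping.single [u, v] 1 - Poly_Mapping.single [v, u] 1 | u v. u \<in> V \<and> v \<in> V}"

definition symmetric_algebra ::
    "(complex \<Rightarrow> 'v \<Rightarrow> 'v) \<Rightarrow> 'v::ab_group_add set \<Rightarrow> (complex, ('v list \<Rightarrow>\<^sub>0 complex) set) module" where
  "symmetric_algebra sc V = quotient_algebra (free_algebra V) (symmetric_relations sc V)"

text \<open>The tensor product over the complex numbers: the free vector space on
  $A \times B$, with componentwise multiplication, modulo bilinearity (the
  span of these relations is already an ideal). There is no Koszul sign: below, \<open>B\<close> is
  purely even.\<close>

definition bilinear_relations ::
    "(complex, 'm) module \<Rightarrow> (complex, 'k) module \<Rightarrow> ('m \<times> 'k \<Rightarrow>\<^sub>0 complex) set" where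
  "bilinear_relations A B =
     {Poly_Mapping.single (a \<oplus>\<^bsub>A\<^esub> a', b) 1 - Poly_Mapping.single (a, b) 1 - Poly_Mapping.single (a', b) 1
        | a a' b. a \<in> carrier A \<and> a' \<in> carrier A \<and> b \<in> carrier B} \<union>
     {Poly_Mapping.single (a, b \<oplus>\<^bsub>B\<^esub> b') 1 - Poly_Mapping.single (a, b) 1 - Poly_Mapping.single (a, b') 1
        | a b b'. a \<in> carrier A \<and> b \<in> carrier B \<and> b' \<in> carrier B} \<union>
     {Poly_Mapping.single (c \<odot>\<^bsub>A\<^esub> a, b) 1 - Poly_Mapping.single (a, b) c
        | c a b. a \<in> carrier A \<and> b \<in> carrier B} \<union>
     {Poly_Mapping.single (a, c \<odot>\<^bsub>B\<^esub> b) 1 - Poly_Mapping.single (a, b) c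
        | c a b. a \<in> carrier A \<and> b \<in> carrier B}"

definition tensor_algebra ::
    "(complex, 'm) module \<Rightarrow> (complex, 'k) module \<Rightarrow> (complex, ('m \<times> 'k \<Rightarrow>\<^sub>0 complex) set) module" where
  "tensor_algebra A B = quotient_algebra (monoid_algebra (A \<times>\<times> B)) (bilinear_relations A B)"

definition pure_tensor ::
    "(complex, 'm) module \<Rightarrow> (complex, 'k) module \<Rightarrow> 'm \<Rightarrow> 'k \<Rightarrow> ('m \<times> 'k \<Rightarrow>\<^sub>0 complex) set" where
  "pure_tensor A B a b =
     quotient_map (monoid_algebra (A \<times>\<times> B)) (bilinear_relations A B) (Poly_Mapping.single (a, b) 1)"


section \<open>Superalgebras and BV superalgebras\<close>

text \<open>The homogeneous parts are \<^term>\<open>G 0\<close> (even) and \<^term>\<open>G 1\<close> (odd); the index is read modulo 2.\<close>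

definition superalgebra :: "(complex, 'm) module \<Rightarrow> (nat \<Rightarrow> 'm set) \<Rightarrow> bool" where
  "superalgebra A G \<longleftrightarrow>
     ring A \<and> Module.module complex_ring A \<and>
     (\<forall>c. \<forall>a\<in>carrier A. \<forall>b\<in>carrier A.
        (c \<odot>\<^bsub>A\<^esub> a) \<otimes>\<^bsub>A\<^esub> b = c \<odot>\<^bsub>A\<^esub> (a \<otimes>\<^bsub>A\<^esub> b) \<and> a \<otimes>\<^bsub>A\<^esub> (c \<odot>\<^bsub>A\<^esub> b) = c \<odot>\<^bsub>A\<^esub> (a \<otimes>\<^bsub>A\<^esub> b)) \<and>
     (\<forall>p. G p = G (p mod 2) \<and> submodule (G p) complex_ring A) \<and>
     (\<forall>a\<in>carrier A. \<exists>!u. u \<in> G 0 \<times> G 1 \<and> a = fst u \<oplus>\<^bsub>A\<^esub> snd u) \<and>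
     \<one>\<^bsub>A\<^esub> \<in> G 0 \<and>
     (\<forall>p q. \<forall>a\<in>G p. \<forall>b\<in>G q. a \<otimes>\<^bsub>A\<^esub> b \<in> G (p + q))"

definition supercommutative :: "(complex, 'm) module \<Rightarrow> (nat \<Rightarrow> 'm set) \<Rightarrow> bool" where
  "supercommutative A G \<longleftrightarrow>
     (\<forall>p q. \<forall>a\<in>G p. \<forall>b\<in>G q. a \<otimes>\<^bsub>A\<^esub> b = (- 1) ^ (p * q) \<odot>\<^bsub>A\<^esub> (b \<otimes>\<^bsub>A\<^esub> a))"

definition homogeneous_operator ::
    "(complex, 'm) module \<Rightarrow> (nat \<Rightarrow> 'm set) \<Rightarrow> nat \<Rightarrow> ('m \<Rightarrow> 'm) \<Rightarrow> bool" where
  "homogeneous_operator A G p D \<longleftrightarrow>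
     D \<in> carrier A \<rightarrow> carrier A \<and>
     (\<forall>a\<in>carrier A. \<forall>b\<in>carrier A. D (a \<oplus>\<^bsub>A\<^esub> b) = D a \<oplus>\<^bsub>A\<^esub> D b) \<and>
     (\<forall>c. \<forall>a\<in>carrier A. D (c \<odot>\<^bsub>A\<^esub> a) = c \<odot>\<^bsub>A\<^esub> D a) \<and>
     (\<forall>q. \<forall>a\<in>G q. D a \<in> G (p + q))"

definition superderivation ::
    "(complex, 'm) module \<Rightarrow> (nat \<Rightarrow> 'm set) \<Rightarrow> nat \<Rightarrow> ('m \<Rightarrow> 'm) \<Rightarrow> bool" where
  "superderivation A G p D \<longleftrightarrow>
     homogeneous_operator A G p D \<and>
     (\<forall>q. \<forall>a\<in>G q. \<forall>b\<in>carrier A.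
        D (a \<otimes>\<^bsub>A\<^esub> b) = D a \<otimes>\<^bsub>A\<^esub> b \<oplus>\<^bsub>A\<^esub> (- 1) ^ (p * q) \<odot>\<^bsub>A\<^esub> (a \<otimes>\<^bsub>A\<^esub> D b))"

text \<open>The bracket of \<open>a\<close> and \<open>b\<close>, where \<open>a\<close> is homogeneous of parity \<open>p\<close>.\<close>

definition bv_bracket :: "(complex, 'm) module \<Rightarrow> ('m \<Rightarrow> 'm) \<Rightarrow> nat \<Rightarrow> 'm \<Rightarrow> 'm \<Rightarrow> 'm" where
  "bv_bracket A \<Delta> p a b =
     \<Delta> (a \<otimes>\<^bsub>A\<^esub> b) \<ominus>\<^bsub>A\<^esub> \<Delta> a \<otimes>\<^bsub>A\<^esub> b \<ominus>\<^bsub>A\<^esub> (- 1) ^ p \<odot>\<^bsub>A\<^esub> (a \<otimes>\<^bsub>A\<^esub> \<Delta> b)"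

definition bv_superalgebra ::
    "(complex, 'm) module \<Rightarrow> (nat \<Rightarrow> 'm set) \<Rightarrow> ('m \<Rightarrow> 'm) \<Rightarrow> bool" where
  "bv_superalgebra A G \<Delta> \<longleftrightarrow>
     superalgebra A G \<and> supercommutative A G \<and>
     homogeneous_operator A G 1 \<Delta> \<and>
     (\<forall>a\<in>carrier A. \<Delta> (\<Delta> a) = \<zero>\<^bsub>A\<^esub>) \<and>
     (\<forall>p q. \<forall>a\<in>G p. \<forall>b\<in>G q. \<forall>c\<in>carrier A.
        bv_bracket A \<Delta> p a (b \<otimes>\<^bsub>A\<^esub> c) =
          bv_bracket A \<Delta> p a b \<otimes>\<^bsub>A\<^esub> c \<oplus>\<^bsub>A\<^esub>
          (- 1) ^ ((p + 1) * q) \<odot>\<^bsub>A\<^esub> (b \<otimes>\<^bsub>A\<^esub> bv_bracket A \<Delta> p a c))"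


section \<open>The algebra O-BV and the operator Delta-BV\<close>

type_synonym 'v bv_elem =
  "(('v list \<Rightarrow>\<^sub>0 complex) set \<times> ('v list \<Rightarrow>\<^sub>0 complex) set \<Rightarrow>\<^sub>0 complex) set"

text \<open>In this section \<open>H0\<close> and \<open>H1\<close> are vector spaces of forms.\<close>

definition O_BV ::
    "('x, 'a, 'r) form set \<Rightarrow> ('x, 'a, 'r) form set \<Rightarrow> (complex, ('x, 'a, 'r) form bv_elem) module" where
  "O_BV H0 H1 = tensor_algebra (exterior_algebra form_scale H0) (symmetric_algebra form_scale H1)"

definition O_BV_parity ::
    "('x, 'a, 'r) form set \<Rightarrow> ('x, 'a, 'r) form set \<Rightarrow> nat \<Rightarrow> ('x, 'a, 'r) form bv_elem set" where
  "O_BV_parity H0 H1 p =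
     (let A = exterior_algebra form_scale H0; B = symmetric_algebra form_scale H1 in
      quotient_map (monoid_algebra (A \<times>\<times> B)) (bilinear_relations A B) `
        {t. Poly_Mapping.keys t \<subseteq> exterior_parity form_scale H0 p \<times> carrier B})"

definition odd_gen ::
    "('x, 'a, 'r) form set \<Rightarrow> ('x, 'a, 'r) form set \<Rightarrow> ('x, 'a, 'r) form \<Rightarrow> ('x, 'a, 'r) form bv_elem" where
  "odd_gen H0 H1 v =
     (let A = exterior_algebra form_scale H0; B = symmetric_algebra form_scale H1 in
      pure_tensor A B
        (quotient_map (free_algebra H0) (exterior_relations form_scale H0) (Poly_Mapping.single [v] 1))
        \<one>\<^bsub>B\<^esub>)"

definition even_gen ::
    "('x, 'a, 'r) form set \<Rightarrow> ('x, 'a, 'r) form set \<Rightarrow> ('x, 'a, 'r) form \<Rightarrow> ('x, 'a, 'r) form bv_elem" where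
  "even_gen H0 H1 v =
     (let A = exterior_algebra form_scale H0; B = symmetric_algebra form_scale H1 in
      pure_tensor A B \<one>\<^bsub>A\<^esub>
        (quotient_map (free_algebra H1) (symmetric_relations form_scale H1) (Poly_Mapping.single [v] 1)))"

text \<open>The derivations with respect to the generators given by bases \<open>e0\<close> of \<open>H0\<close> and \<open>e1\<close> of
  \<open>H1\<close>. A derivation is determined by its values on the generators; extensionality only fixes
  its junk values outside the carrier.\<close>

definition d_odd ::
    "('x, 'a, 'r) form set \<Rightarrow> ('x, 'a, 'r) form set \<Rightarrow> nat \<Rightarrow> (nat \<Rightarrow> ('x, 'a, 'r) form) \<Rightarrow>
     (nat \<Rightarrow> ('x, 'a, 'r) form) \<Rightarrow> nat \<Rightarrow> ('x, 'a, 'r) form bv_elem \<Rightarrow> ('x, 'a, 'r) form bv_elem" where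
  "d_odd H0 H1 n e0 e1 i = (let A = O_BV H0 H1 in
     (THE D. D \<in> extensional (carrier A) \<and> superderivation A (O_BV_parity H0 H1) 1 D \<and>
        (\<forall>k\<in>{1..n}. D (odd_gen H0 H1 (e0 k)) = (if k = i then \<one>\<^bsub>A\<^esub> else \<zero>\<^bsub>A\<^esub>)) \<and>
        (\<forall>k\<in>{1..n}. D (even_gen H0 H1 (e1 k)) = \<zero>\<^bsub>A\<^esub>)))"

definition d_even ::
    "('x, 'a, 'r) form set \<Rightarrow> ('x, 'a, 'r) form set \<Rightarrow> nat \<Rightarrow> (nat \<Rightarrow> ('x, 'a, 'r) form) \<Rightarrow>
     (nat \<Rightarrow> ('x, 'a, 'r) form) \<Rightarrow> nat \<Rightarrow> ('x, 'a, 'r) form bv_elem \<Rightarrow> ('x, 'a, 'r) form bv_elem" where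
  "d_even H0 H1 n e0 e1 j = (let A = O_BV H0 H1 in
     (THE D. D \<in> extensional (carrier A) \<and> superderivation A (O_BV_parity H0 H1) 0 D \<and>
        (\<forall>k\<in>{1..n}. D (odd_gen H0 H1 (e0 k)) = \<zero>\<^bsub>A\<^esub>) \<and>
        (\<forall>k\<in>{1..n}. D (even_gen H0 H1 (e1 k)) = (if k = j then \<one>\<^bsub>A\<^esub> else \<zero>\<^bsub>A\<^esub>))))"

definition Delta_BV ::
    "('x, 'a, 'r) form set \<Rightarrow> ('x, 'a, 'r) form set \<Rightarrow> nat \<Rightarrow> (nat \<Rightarrow> ('x, 'a, 'r) form) \<Rightarrow>
     (nat \<Rightarrow> ('x, 'a, 'r) form) \<Rightarrow> (nat \<Rightarrow> nat \<Rightarrow> complex) \<Rightarrow>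
     ('x, 'a, 'r) form bv_elem \<Rightarrow> ('x, 'a, 'r) form bv_elem" where
  "Delta_BV H0 H1 n e0 e1 I a = (let A = O_BV H0 H1 in
     (\<Oplus>\<^bsub>A\<^esub>i\<in>{1..n}. \<Oplus>\<^bsub>A\<^esub>j\<in>{1..n}.
        I i j \<odot>\<^bsub>A\<^esub> d_odd H0 H1 n e0 e1 i (d_even H0 H1 n e0 e1 j a)))"

end

(* The exterior algebra, the symmetric algebra and their tensor product are quotients of monoid
   algebras, so that homomorphisms and (twisted) derivations descend to them as soon as they kill the
   relations. In this way one obtains the parity involution, whose eigenspaces are the homogeneous
   parts, the contractions of the exterior algebra and the partial derivatives of the symmetric
   algebra, and hence the derivations D_i, E_j with respect to the generators. A superderivation is
   determined by its values on the generators; likewise D_i D_k = - D_k D_i, E_j E_l = E_l E_j and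
   E_j D_i = D_i E_j need only be propagated through products with generators. Hence every D_i E_j
   anticommutes with Delta = sum_ij I^ij D_i E_j, so Delta anticommutes with itself and its square
   is 0. The Leibniz rule for the bracket is linear in the operator, and for D_i E_j it follows
   from {a,b} = D_i a E_j b + (-1)^|a| E_j a D_i b. *)

theory Submission
  imports Defs
begin

section \<open>Algebras over the complex numbers\<close>

text \<open>The algebras are quotients of free algebras on whole vector spaces by generated ideals,
  so elements have no normal form at hand on which a derivative could be defined by a formula. Yet
  \<open>d_odd\<close> and \<open>d_even\<close> are definite descriptions, which say nothing until
  existence and uniqueness are known. Existence comes from universal properties fed with the
  coordinate functionals of the bases, uniqueness from generation by the basis vectors. Two
  obstacles shape the descent to quotients. The kernel of a derivation is not an ideal, so a
  derivation has to be treated together with its twisting homomorphisms. And an operator that acts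
  on one tensor factor only is merely linear, so for the tensor product one uses that the bilinear
  relations are stable under multiplication by monomials. The scalar 1/2 is essential: it gives the
  projectors onto the homogeneous parts, and the step from a = -a to a = 0 that ends the proof that
  the operator squares to zero.\<close>

locale complex_algebra = ring A for A :: "(complex, 'm) module" (structure) +
  assumes smult_closed [simp, intro]: "a \<in> carrier A \<Longrightarrow> c \<odot> a \<in> carrier A"
    and smult_l_distr: "a \<in> carrier A \<Longrightarrow> (c + d) \<odot> a = c \<odot> a \<oplus> d \<odot> a"
    and smult_r_distr:
      "\<lbrakk>a \<in> carrier A; b \<in> carrier A\<rbrakk> \<Longrightarrow> c \<odot> (a \<oplus> b) = c \<odot> a \<oplus> c \<odot> b"
    and smult_assoc: "a \<in> carrier A \<Longrightarrow> c \<odot> (d \<odot> a) = (c * d) \<odot> a"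
    and smult_one [simp]: "a \<in> carrier A \<Longrightarrow> 1 \<odot> a = a"
    and smult_mult_l:
      "\<lbrakk>a \<in> carrier A; b \<in> carrier A\<rbrakk> \<Longrightarrow> (c \<odot> a) \<otimes> b = c \<odot> (a \<otimes> b)"
    and smult_mult_r:
      "\<lbrakk>a \<in> carrier A; b \<in> carrier A\<rbrakk> \<Longrightarrow> a \<otimes> (c \<odot> b) = c \<odot> (a \<otimes> b)"
begin

lemma smult_zero_l [simp]: "a \<in> carrier A \<Longrightarrow> 0 \<odot> a = \<zero>"
  using smult_l_distr[of a 0 0] by simp

lemma smult_zero_r [simp]: "c \<odot> \<zero> = \<zero>"
  using smult_r_distr[of \<zero> \<zero> c] by simp

lemma a_inv_eq_smult: "a \<in> carrier A \<Longrightarrow> \<ominus> a = (- 1) \<odot> a"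
  using smult_l_distr[of a "- 1" 1] by (simp add: minus_equality)

lemma smult_minus_one_cancel [simp]: "a \<in> carrier A \<Longrightarrow> (- 1) \<odot> a \<oplus> a = \<zero>"
  using smult_l_distr[of a "- 1" 1] by simp

lemma a_minus_eq_smult:
  "\<lbrakk>a \<in> carrier A; b \<in> carrier A\<rbrakk> \<Longrightarrow> a \<ominus> b = a \<oplus> (- 1) \<odot> b"
  by (simp add: a_minus_def a_inv_eq_smult)

lemma a_minus_eq_zero_iff [simp]:
  "\<lbrakk>a \<in> carrier A; b \<in> carrier A\<rbrakk> \<Longrightarrow> a \<ominus> b = \<zero> \<longleftrightarrow> a = b"
  by (metis a_inv_closed a_minus_def minus_equality minus_minus r_neg)

text \<open>This is where characteristic 0 finishes the proof: the square of the BV operator is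
  shown to equal its own negative.\<close>

lemma eq_smult_minus_one_imp_zero:
  assumes "a \<in> carrier A" "a = (- 1) \<odot> a"
  shows "a = \<zero>"
proof -
  have "2 \<odot> a = a \<oplus> a"
    using smult_l_distr[of a 1 1] assms(1) by simp
  also have "\<dots> = (- 1) \<odot> a \<oplus> a"
    using assms(2) by simp
  finally have "(1 / 2) \<odot> (2 \<odot> a) = \<zero>"
    using assms(1) by simp
  then show ?thesis
    using assms(1) by (simp add: smult_assoc)
qed

lemma finsum_smult:
  "f \<in> S \<rightarrow> carrier A \<Longrightarrow> c \<odot> (\<Oplus>i\<in>S. f i) = (\<Oplus>i\<in>S. c \<odot> f i)"
proof (induction S rule: infinite_finite_induct)
  case (insert x F)
  then have "f \<in> F \<rightarrow> carrier A" "f x \<in> carrier A" by auto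
  moreover have "(\<lambda>i. c \<odot> f i) \<in> F \<rightarrow> carrier A"
    using \<open>f \<in> F \<rightarrow> carrier A\<close> by auto
  ultimately show ?case
    using insert by (simp add: smult_r_distr)
qed simp_all

text \<open>\<open>complex_algebra\<close> states the module axioms with plain complex arithmetic,
  which the simplifier can compute with; \<open>superalgebra\<close> asks for a module over the ring
  record \<open>complex_ring\<close>. This lemma translates back.\<close>

lemma module_complex_ring: "Module.module complex_ring A"
proof (rule moduleI)
  show "cring complex_ring"
    unfolding complex_ring_def
    by (intro cringI abelian_groupI comm_monoidI) (auto simp: algebra_simps intro: exI[of _ "- _"])
qed (auto simp: complex_ring_def smult_l_distr smult_r_distr smult_assoc is_abelian_group)

end

definition linear_map ::
    "(complex, 'm) module \<Rightarrow> (complex, 'k) module \<Rightarrow> ('m \<Rightarrow> 'k) \<Rightarrow> bool" where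
  "linear_map A B f \<longleftrightarrow>
     f \<in> carrier A \<rightarrow> carrier B \<and>
     (\<forall>a\<in>carrier A. \<forall>b\<in>carrier A. f (a \<oplus>\<^bsub>A\<^esub> b) = f a \<oplus>\<^bsub>B\<^esub> f b) \<and>
     (\<forall>c. \<forall>a\<in>carrier A. f (c \<odot>\<^bsub>A\<^esub> a) = c \<odot>\<^bsub>B\<^esub> f a)"

lemma linear_mapD:
  assumes "linear_map A B f"
  shows linear_map_closed: "a \<in> carrier A \<Longrightarrow> f a \<in> carrier B"
    and linear_map_add: "\<lbrakk>a \<in> carrier A; b \<in> carrier A\<rbrakk> \<Longrightarrow> f (a \<oplus>\<^bsub>A\<^esub> b) = f a \<oplus>\<^bsub>B\<^esub> f b"
    and linear_map_smult: "a \<in> carrier A \<Longrightarrow> f (c \<odot>\<^bsub>A\<^esub> a) = c \<odot>\<^bsub>B\<^esub> f a"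
  using assms by (auto simp: linear_map_def)

lemma linear_map_zero:
  assumes "complex_algebra A" "complex_algebra B" "linear_map A B f"
  shows "f \<zero>\<^bsub>A\<^esub> = \<zero>\<^bsub>B\<^esub>"
proof -
  interpret A: complex_algebra A by fact
  interpret B: complex_algebra B by fact
  have "f (0 \<odot>\<^bsub>A\<^esub> \<zero>\<^bsub>A\<^esub>) = 0 \<odot>\<^bsub>B\<^esub> f \<zero>\<^bsub>A\<^esub>"
    by (rule linear_map_smult[OF assms(3)]) simp
  then show ?thesis
    using linear_map_closed[OF assms(3)] by simp
qed

lemma linear_map_compose:
  "\<lbrakk>linear_map A B f; linear_map B C g\<rbrakk> \<Longrightarrow> linear_map A C (\<lambda>x. g (f x))"
  by (auto simp: linear_map_def Pi_iff)

lemma linear_map_finsum: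
  assumes "complex_algebra A" "complex_algebra B" "linear_map A B f" "g \<in> S \<rightarrow> carrier A"
  shows "f (\<Oplus>\<^bsub>A\<^esub>i\<in>S. g i) = (\<Oplus>\<^bsub>B\<^esub>i\<in>S. f (g i))"
proof -
  interpret A: complex_algebra A by fact
  interpret B: complex_algebra B by fact
  show ?thesis
    using assms(4)
  proof (induction S rule: infinite_finite_induct)
    case (insert x F)
    have "g \<in> F \<rightarrow> carrier A" "g x \<in> carrier A" "(\<lambda>i. f (g i)) \<in> F \<rightarrow> carrier B" "f (g x) \<in> carrier B"
      using insert.prems linear_map_closed[OF assms(3)] by auto
    then show ?case
      using insert by (simp add: linear_map_add[OF assms(3)])
  qed (simp_all add: linear_map_zero[OF assms(1-3)])
qed


section \<open>Monoid algebras\<close>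

lemma lookup_map_times [simp]:
  "Poly_Mapping.lookup (Poly_Mapping.map ((*) c) p) x = c * Poly_Mapping.lookup p x"
  for c :: complex
  by (simp add: Poly_Mapping.map.rep_eq when_def)

lemma keys_map_times_subset: "Poly_Mapping.keys (Poly_Mapping.map ((*) c) p) \<subseteq> Poly_Mapping.keys p"
  for c :: complex
  by (auto simp: in_keys_iff)

lemma map_times_single [simp]:
  "Poly_Mapping.map ((*) c) (Poly_Mapping.single x d) = Poly_Mapping.single x (c * d)"
  for c :: complex
  by (rule poly_mapping_eqI) (simp add: lookup_single when_def)

lemma monoid_algebra_simps:
  "carrier (monoid_algebra M) = {p. Poly_Mapping.keys p \<subseteq> carrier M}"
  "p \<oplus>\<^bsub>monoid_algebra M\<^esub> q = p + q"
  "\<zero>\<^bsub>monoid_algebra M\<^esub> = 0"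
  "\<one>\<^bsub>monoid_algebra M\<^esub> = Poly_Mapping.single \<one>\<^bsub>M\<^esub> 1"
  "c \<odot>\<^bsub>monoid_algebra M\<^esub> p = Poly_Mapping.map ((*) c) p"
  by (simp_all add: monoid_algebra_def)

lemma single_in_monoid_algebra [simp]:
  "x \<in> carrier M \<Longrightarrow> Poly_Mapping.single x c \<in> carrier (monoid_algebra M)"
  by (simp add: monoid_algebra_simps)

text \<open>The carriers below are given by bounds on the support, so the induction must never leave
  S. Splitting off the full term at x removes exactly x from the support and adds no new
  key.\<close>

lemma poly_mapping_keys_induct [consumes 1, case_names zero add]:
  fixes p :: "'a \<Rightarrow>\<^sub>0 'b::ab_group_add"
  assumes "Poly_Mapping.keys p \<subseteq> S"
    and "P 0"
    and "\<And>x c p. \<lbrakk>x \<in> S; Poly_Mapping.keys p \<subseteq> S; P p\<rbrakk> \<Longrightarrow> P (Poly_Mapping.single x c + p)"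
  shows "P p"
proof -
  have "finite (Poly_Mapping.keys p)" by simp
  then show ?thesis
    using assms(1)
  proof (induction "Poly_Mapping.keys p" arbitrary: p rule: finite_psubset_induct)
    case psubset
    show ?case
    proof (cases "p = 0")
      case True
      then show ?thesis using assms(2) by simp
    next
      case False
      then obtain x where x: "x \<in> Poly_Mapping.keys p"
        by (metis ex_in_conv keys_eq_empty)
      define q where "q = p - Poly_Mapping.single x (Poly_Mapping.lookup p x)"
      have q: "Poly_Mapping.keys q = Poly_Mapping.keys p - {x}"
        by (auto simp: q_def in_keys_iff lookup_minus lookup_single when_def split: if_splits)
      have "P q"
        using x psubset.prems by (intro psubset.hyps) (auto simp: q)
      then have "P (Poly_Mapping.single x (Poly_Mapping.lookup p x) + q)"
        using x q psubset.prems by (intro assms(3)) auto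
      then show ?thesis by (simp add: q_def)
    qed
  qed
qed

text \<open>The product is defined by sums over supports, and the support of a sum is only contained
  in the union of the supports. Summing over common finite supersets turns distributivity into a
  termwise identity.\<close>

lemma monoid_algebra_mult_superset:
  assumes "finite X" "finite Y" "Poly_Mapping.keys p \<subseteq> X" "Poly_Mapping.keys q \<subseteq> Y"
  shows "p \<otimes>\<^bsub>monoid_algebra M\<^esub> q =
    (\<Sum>x\<in>X. \<Sum>y\<in>Y. Poly_Mapping.single (x \<otimes>\<^bsub>M\<^esub> y) (Poly_Mapping.lookup p x * Poly_Mapping.lookup q y))"
proof -
  have "p \<otimes>\<^bsub>monoid_algebra M\<^esub> q = (\<Sum>x\<in>Poly_Mapping.keys p. \<Sum>y\<in>Y.
      Poly_Mapping.single (x \<otimes>\<^bsub>M\<^esub> y) (Poly_Mapping.lookup p x * Poly_Mapping.lookup q y))"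
    unfolding monoid_algebra_def using assms
    by (simp, intro sum.cong refl sum.mono_neutral_left) (auto simp: in_keys_iff)
  also have "\<dots> = (\<Sum>x\<in>X. \<Sum>y\<in>Y.
      Poly_Mapping.single (x \<otimes>\<^bsub>M\<^esub> y) (Poly_Mapping.lookup p x * Poly_Mapping.lookup q y))"
    using assms by (intro sum.mono_neutral_left) (auto simp: in_keys_iff)
  finally show ?thesis .
qed

lemma monoid_algebra_mult_single [simp]:
  "Poly_Mapping.single x c \<otimes>\<^bsub>monoid_algebra M\<^esub> Poly_Mapping.single y d =
     Poly_Mapping.single (x \<otimes>\<^bsub>M\<^esub> y) (c * d)"
  by (subst monoid_algebra_mult_superset[of "{x}" "{y}"]) auto

lemma monoid_algebra_mult_zero [simp]:
  "p \<otimes>\<^bsub>monoid_algebra M\<^esub> 0 = 0" "0 \<otimes>\<^bsub>monoid_algebra M\<^esub> p = 0"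
  by (simp_all add: monoid_algebra_def)

lemma monoid_algebra_mult_distrib:
  "(p + p') \<otimes>\<^bsub>monoid_algebra M\<^esub> q = p \<otimes>\<^bsub>monoid_algebra M\<^esub> q + p' \<otimes>\<^bsub>monoid_algebra M\<^esub> q" (is ?l)
  "q \<otimes>\<^bsub>monoid_algebra M\<^esub> (p + p') = q \<otimes>\<^bsub>monoid_algebra M\<^esub> p + q \<otimes>\<^bsub>monoid_algebra M\<^esub> p'" (is ?r)
proof -
  let ?X = "Poly_Mapping.keys p \<union> Poly_Mapping.keys p'" and ?Y = "Poly_Mapping.keys q"
  have X: "finite ?X" "finite ?Y" "Poly_Mapping.keys (p + p') \<subseteq> ?X"
    "Poly_Mapping.keys p \<subseteq> ?X" "Poly_Mapping.keys p' \<subseteq> ?X" "Poly_Mapping.keys q \<subseteq> ?Y"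
    using Poly_Mapping.keys_add[of p p'] by auto
  show ?l
    unfolding monoid_algebra_mult_superset[OF X(1,2,3,6)] monoid_algebra_mult_superset[OF X(1,2,4,6)]
      monoid_algebra_mult_superset[OF X(1,2,5,6)]
    by (simp add: lookup_add distrib_right single_add sum.distrib)
  show ?r
    unfolding monoid_algebra_mult_superset[OF X(2,1,6,3)] monoid_algebra_mult_superset[OF X(2,1,6,4)]
      monoid_algebra_mult_superset[OF X(2,1,6,5)]
    by (simp add: lookup_add distrib_left single_add sum.distrib)
qed

lemma map_times_add:
  "Poly_Mapping.map ((*) c) (p + q) = Poly_Mapping.map ((*) c) p + Poly_Mapping.map ((*) c) q"
  for c :: complex
  by (rule poly_mapping_eqI) (simp add: lookup_add algebra_simps)

lemma map_times_zero [simp]: "Poly_Mapping.map ((*) c) 0 = 0" for c :: complex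
  by (rule poly_mapping_eqI) simp

lemma keys_add_subset:
  "\<lbrakk>Poly_Mapping.keys p \<subseteq> S; Poly_Mapping.keys q \<subseteq> S\<rbrakk> \<Longrightarrow> Poly_Mapping.keys (p + q) \<subseteq> S"
  using Poly_Mapping.keys_add[of p q] by blast

text \<open>All laws of the product are linear in each argument, so they reduce, one argument at a
  time, to monomials, where they are the monoid laws and arithmetic of coefficients.\<close>

lemma (in monoid) complex_algebra_monoid_algebra: "complex_algebra (monoid_algebra G)"
proof -
  let ?P = "monoid_algebra G"
  have closed: "p \<otimes>\<^bsub>?P\<^esub> q \<in> carrier ?P" if "p \<in> carrier ?P" "q \<in> carrier ?P" for p q
  proof -
    have "Poly_Mapping.keys p \<subseteq> carrier G" "Poly_Mapping.keys q \<subseteq> carrier G"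
      using that by (auto simp: monoid_algebra_simps)
    then show ?thesis
    proof (induction p rule: poly_mapping_keys_induct)
      case (add x c p)
      have "Poly_Mapping.single x c \<otimes>\<^bsub>?P\<^esub> q \<in> carrier ?P"
        using add(4)
      proof (induction q rule: poly_mapping_keys_induct)
        case (add y d q)
        then show ?case
          using \<open>x \<in> carrier G\<close>
          by (simp add: monoid_algebra_mult_distrib monoid_algebra_simps keys_add_subset)
      qed (simp add: monoid_algebra_simps)
      then show ?case
        using add by (simp add: monoid_algebra_mult_distrib monoid_algebra_simps keys_add_subset)
    qed (simp add: monoid_algebra_simps)
  qed
  have assoc: "(p \<otimes>\<^bsub>?P\<^esub> q) \<otimes>\<^bsub>?P\<^esub> r = p \<otimes>\<^bsub>?P\<^esub> (q \<otimes>\<^bsub>?P\<^esub> r)"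
    if "Poly_Mapping.keys p \<subseteq> carrier G" "Poly_Mapping.keys q \<subseteq> carrier G" "Poly_Mapping.keys r \<subseteq> carrier G" for p q r
    using that
  proof (induction p rule: poly_mapping_keys_induct)
    case (add x c p)
    have "(Poly_Mapping.single x c \<otimes>\<^bsub>?P\<^esub> q) \<otimes>\<^bsub>?P\<^esub> r = Poly_Mapping.single x c \<otimes>\<^bsub>?P\<^esub> (q \<otimes>\<^bsub>?P\<^esub> r)"
      using add(4)
    proof (induction q rule: poly_mapping_keys_induct)
      case (add y d q)
      have "(Poly_Mapping.single x c \<otimes>\<^bsub>?P\<^esub> Poly_Mapping.single y d) \<otimes>\<^bsub>?P\<^esub> r =
          Poly_Mapping.single x c \<otimes>\<^bsub>?P\<^esub> (Poly_Mapping.single y d \<otimes>\<^bsub>?P\<^esub> r)"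
        using that(3)
      proof (induction r rule: poly_mapping_keys_induct)
        case (add z e r)
        then show ?case
          using \<open>x \<in> carrier G\<close> \<open>y \<in> carrier G\<close>
          by (simp add: monoid_algebra_mult_distrib m_assoc mult.assoc)
      qed simp
      then show ?case
        using add by (simp add: monoid_algebra_mult_distrib)
    qed simp
    then show ?case
      using add by (simp add: monoid_algebra_mult_distrib)
  qed simp
  have one: "Poly_Mapping.single \<one> 1 \<otimes>\<^bsub>?P\<^esub> p = p" "p \<otimes>\<^bsub>?P\<^esub> Poly_Mapping.single \<one> 1 = p"
    if "Poly_Mapping.keys p \<subseteq> carrier G" for p
    using that
    by (induction p rule: poly_mapping_keys_induct) (simp_all add: monoid_algebra_mult_distrib)
  have smult: "Poly_Mapping.map ((*) c) p \<otimes>\<^bsub>?P\<^esub> q = Poly_Mapping.map ((*) c) (p \<otimes>\<^bsub>?P\<^esub> q)"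
      "p \<otimes>\<^bsub>?P\<^esub> Poly_Mapping.map ((*) c) q = Poly_Mapping.map ((*) c) (p \<otimes>\<^bsub>?P\<^esub> q)"
    if "Poly_Mapping.keys p \<subseteq> carrier G" "Poly_Mapping.keys q \<subseteq> carrier G" for c p q
  proof -
    have *: "Poly_Mapping.map ((*) c) (Poly_Mapping.single x d) \<otimes>\<^bsub>?P\<^esub> q =
          Poly_Mapping.map ((*) c) (Poly_Mapping.single x d \<otimes>\<^bsub>?P\<^esub> q) \<and>
        Poly_Mapping.single x d \<otimes>\<^bsub>?P\<^esub> Poly_Mapping.map ((*) c) q =
          Poly_Mapping.map ((*) c) (Poly_Mapping.single x d \<otimes>\<^bsub>?P\<^esub> q)" for x d
      using that(2)
      by (induction q rule: poly_mapping_keys_induct)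
        (simp_all add: monoid_algebra_mult_distrib map_times_add mult.left_commute mult.assoc)
    show "Poly_Mapping.map ((*) c) p \<otimes>\<^bsub>?P\<^esub> q = Poly_Mapping.map ((*) c) (p \<otimes>\<^bsub>?P\<^esub> q)"
      "p \<otimes>\<^bsub>?P\<^esub> Poly_Mapping.map ((*) c) q = Poly_Mapping.map ((*) c) (p \<otimes>\<^bsub>?P\<^esub> q)"
      using that(1) *
      by (induction p rule: poly_mapping_keys_induct)
        (simp_all add: monoid_algebra_mult_distrib map_times_add del: map_times_single)
  qed
  have "ring ?P"
  proof (rule ringI)
    show "abelian_group ?P"
    proof (rule abelian_groupI)
      fix p assume "p \<in> carrier ?P"
      then show "\<exists>q\<in>carrier ?P. q \<oplus>\<^bsub>?P\<^esub> p = \<zero>\<^bsub>?P\<^esub>"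
        by (intro bexI[of _ "- p"]) (auto simp: monoid_algebra_simps)
    qed (simp_all add: monoid_algebra_simps add_ac keys_add_subset)
    show "Group.monoid ?P"
      using closed by (intro monoidI) (auto simp: monoid_algebra_simps assoc one)
  qed (auto simp: monoid_algebra_simps monoid_algebra_mult_distrib)
  then show ?thesis
  proof (intro complex_algebra.intro complex_algebra_axioms.intro)
    fix p c assume "p \<in> carrier ?P"
    then show "c \<odot>\<^bsub>?P\<^esub> p \<in> carrier ?P"
      using keys_map_times_subset by (fastforce simp: monoid_algebra_simps)
  qed (auto simp: monoid_algebra_simps smult map_times_add intro!: poly_mapping_eqI
        simp: lookup_add algebra_simps)
qed

text \<open>With these rules both sides of an identity are recognized as linear in one variable, so
  that it only has to be tested on monomials or on pure tensors.\<close>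

lemma (in complex_algebra) linear_map_intros:
  fixes X :: "(complex, 'x) module" (structure)
  shows linear_map_id: "linear_map A A (\<lambda>x. x)"
    and linear_map_plus: "\<lbrakk>linear_map X A f; linear_map X A g\<rbrakk> \<Longrightarrow> linear_map X A (\<lambda>x. f x \<oplus>\<^bsub>A\<^esub> g x)"
    and linear_map_scale: "linear_map X A f \<Longrightarrow> linear_map X A (\<lambda>x. c \<odot>\<^bsub>A\<^esub> f x)"
    and linear_map_mult_l:
      "\<lbrakk>linear_map X A f; b \<in> carrier A\<rbrakk> \<Longrightarrow> linear_map X A (\<lambda>x. f x \<otimes>\<^bsub>A\<^esub> b)"
    and linear_map_mult_r:
      "\<lbrakk>linear_map X A f; b \<in> carrier A\<rbrakk> \<Longrightarrow> linear_map X A (\<lambda>x. b \<otimes>\<^bsub>A\<^esub> f x)"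
    and linear_map_const_zero: "linear_map X A (\<lambda>x. \<zero>\<^bsub>A\<^esub>)"
  unfolding linear_map_def
  by (auto simp: Pi_iff a_ac smult_r_distr smult_assoc mult.commute l_distr r_distr
      smult_mult_l smult_mult_r)

text \<open>Closure under scalars replaces closure under additive inverses, which is the scalar -1;
  the joint kernels of linear maps used below have it for free.\<close>

lemma (in complex_algebra) idealI_linear:
  assumes "S \<subseteq> carrier A" "\<zero> \<in> S"
    and "\<And>x y. \<lbrakk>x \<in> S; y \<in> S\<rbrakk> \<Longrightarrow> x \<oplus> y \<in> S"
    and "\<And>c x. x \<in> S \<Longrightarrow> c \<odot> x \<in> S"
    and "\<And>x y. \<lbrakk>x \<in> S; y \<in> carrier A\<rbrakk> \<Longrightarrow> x \<otimes> y \<in> S"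
    and "\<And>x y. \<lbrakk>x \<in> S; y \<in> carrier A\<rbrakk> \<Longrightarrow> y \<otimes> x \<in> S"
  shows "ideal S A"
proof (rule idealI)
  show "subgroup S (add_monoid A)"
  proof (rule add.subgroupI)
    fix x assume "x \<in> S"
    then show "\<ominus> x \<in> S"
      using assms(1) assms(4)[of x "- 1"] by (auto simp: a_inv_eq_smult subset_iff)
  qed (use assms in auto)
qed (use assms ring_axioms in auto)

section \<open>Homomorphisms and twisted derivations\<close>

definition algebra_hom ::
    "(complex, 'm) module \<Rightarrow> (complex, 'k) module \<Rightarrow> ('m \<Rightarrow> 'k) \<Rightarrow> bool" where
  "algebra_hom A B f \<longleftrightarrow>
     linear_map A B f \<and> f \<one>\<^bsub>A\<^esub> = \<one>\<^bsub>B\<^esub> \<and>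
     (\<forall>a\<in>carrier A. \<forall>b\<in>carrier A. f (a \<otimes>\<^bsub>A\<^esub> b) = f a \<otimes>\<^bsub>B\<^esub> f b)"

lemma algebra_homD:
  assumes "algebra_hom A B f"
  shows algebra_hom_linear: "linear_map A B f"
    and algebra_hom_one: "f \<one>\<^bsub>A\<^esub> = \<one>\<^bsub>B\<^esub>"
    and algebra_hom_mult:
      "\<lbrakk>a \<in> carrier A; b \<in> carrier A\<rbrakk> \<Longrightarrow> f (a \<otimes>\<^bsub>A\<^esub> b) = f a \<otimes>\<^bsub>B\<^esub> f b"
  using assms by (auto simp: algebra_hom_def)

lemma algebra_hom_compose:
  "\<lbrakk>algebra_hom A B f; algebra_hom B C g\<rbrakk> \<Longrightarrow> algebra_hom A C (\<lambda>x. g (f x))"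
  by (auto simp: algebra_hom_def linear_map_compose linear_map_closed)

text \<open>This covers derivations (\<open>\<phi> = \<psi>\<close>), odd superderivations (\<open>\<phi>\<close> is \<open>\<psi>\<close> followed by the
  parity involution) and multiplicative maps (\<open>\<phi> = 0\<close>, \<open>\<psi> = f\<close>).\<close>

definition twisted_derivation ::
    "(complex, 'm) module \<Rightarrow> (complex, 'k) module \<Rightarrow> ('m \<Rightarrow> 'k) \<Rightarrow> ('m \<Rightarrow> 'k) \<Rightarrow> ('m \<Rightarrow> 'k) \<Rightarrow> bool" where
  "twisted_derivation A B \<phi> \<psi> f \<longleftrightarrow>
     linear_map A B f \<and>
     (\<forall>a\<in>carrier A. \<forall>b\<in>carrier A.
        f (a \<otimes>\<^bsub>A\<^esub> b) = f a \<otimes>\<^bsub>B\<^esub> \<psi> b \<oplus>\<^bsub>B\<^esub> \<phi> a \<otimes>\<^bsub>B\<^esub> f b)"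

lemma twisted_derivationD:
  assumes "twisted_derivation A B \<phi> \<psi> f"
  shows twisted_derivation_linear: "linear_map A B f"
    and twisted_derivation_mult:
      "\<lbrakk>a \<in> carrier A; b \<in> carrier A\<rbrakk> \<Longrightarrow> f (a \<otimes>\<^bsub>A\<^esub> b) = f a \<otimes>\<^bsub>B\<^esub> \<psi> b \<oplus>\<^bsub>B\<^esub> \<phi> a \<otimes>\<^bsub>B\<^esub> f b"
  using assms by (auto simp: twisted_derivation_def)

section \<open>Linear extension from monomials\<close>

definition lin_ext ::
    "(complex, 'k) module \<Rightarrow> ('m \<Rightarrow> 'k) \<Rightarrow> ('m \<Rightarrow>\<^sub>0 complex) \<Rightarrow> 'k" where
  "lin_ext B f p = (\<Oplus>\<^bsub>B\<^esub>x\<in>Poly_Mapping.keys p. Poly_Mapping.lookup p x \<odot>\<^bsub>B\<^esub> f x)"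

context complex_algebra
begin

lemma lin_ext_superset:
  assumes "finite X" "Poly_Mapping.keys p \<subseteq> X" "f \<in> X \<rightarrow> carrier A"
  shows "lin_ext A f p = (\<Oplus>x\<in>X. Poly_Mapping.lookup p x \<odot> f x)"
  unfolding lin_ext_def using assms
  by (intro add.finprod_mono_neutral_cong_left) (auto simp: in_keys_iff Pi_iff)

lemma lin_ext_linear:
  fixes f :: "'x \<Rightarrow> 'm"
  assumes "f \<in> carrier M \<rightarrow> carrier A"
  shows "linear_map (monoid_algebra M) A (lin_ext A f)"
  unfolding linear_map_def monoid_algebra_simps
proof (intro conjI ballI allI)
  show "lin_ext A f \<in> {p. Poly_Mapping.keys p \<subseteq> carrier M} \<rightarrow> carrier A"
    using assms by (force simp: lin_ext_def intro!: finsum_closed)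
  fix p :: "'x \<Rightarrow>\<^sub>0 complex" assume "p \<in> {p. Poly_Mapping.keys p \<subseteq> carrier M}"
  then have p: "Poly_Mapping.keys p \<subseteq> carrier M" by simp
  then have fp: "f \<in> Poly_Mapping.keys p \<rightarrow> carrier A" using assms by auto
  show "lin_ext A f (Poly_Mapping.map ((*) c) p) = c \<odot> lin_ext A f p" for c
  proof -
    have "lin_ext A f (Poly_Mapping.map ((*) c) p) =
        (\<Oplus>x\<in>Poly_Mapping.keys p. c \<odot> (Poly_Mapping.lookup p x \<odot> f x))"
      using fp by (subst lin_ext_superset[of "Poly_Mapping.keys p"])
        (auto simp: keys_map_times_subset smult_assoc Pi_iff intro!: finsum_cong')
    also have "\<dots> = c \<odot> lin_ext A f p"
      unfolding lin_ext_def using fp by (subst finsum_smult) auto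
    finally show ?thesis .
  qed
  fix q :: "'x \<Rightarrow>\<^sub>0 complex" assume "q \<in> {p. Poly_Mapping.keys p \<subseteq> carrier M}"
  then have q: "Poly_Mapping.keys q \<subseteq> carrier M" by simp
  let ?X = "Poly_Mapping.keys p \<union> Poly_Mapping.keys q"
  have X: "finite ?X" "f \<in> ?X \<rightarrow> carrier A" "Poly_Mapping.keys (p + q) \<subseteq> ?X"
    "Poly_Mapping.keys p \<subseteq> ?X" "Poly_Mapping.keys q \<subseteq> ?X"
    using p q assms Poly_Mapping.keys_add[of p q] by auto
  have "lin_ext A f (p + q) =
      (\<Oplus>x\<in>?X. Poly_Mapping.lookup p x \<odot> f x \<oplus> Poly_Mapping.lookup q x \<odot> f x)"
    using X(2) by (subst lin_ext_superset[OF X(1,3,2)], intro finsum_cong')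
      (auto simp: lookup_add smult_l_distr Pi_iff)
  also have "\<dots> = lin_ext A f p \<oplus> lin_ext A f q"
    unfolding lin_ext_superset[OF X(1,4,2)] lin_ext_superset[OF X(1,5,2)]
    using X(2) by (intro finsum_addf) (auto simp: Pi_iff)
  finally show "lin_ext A f (p + q) = lin_ext A f p \<oplus> lin_ext A f q" .
qed

lemma lin_ext_single [simp]:
  assumes "f x \<in> carrier A"
  shows "lin_ext A f (Poly_Mapping.single x c) = c \<odot> f x"
  using assms by (subst lin_ext_superset[of "{x}"]) (auto simp: Pi_iff)

lemma linear_map_single:
  assumes "x \<in> carrier M" "linear_map (monoid_algebra M) A f"
  shows "f (Poly_Mapping.single x c) = c \<odot> f (Poly_Mapping.single x 1)"
  using linear_map_smult[OF assms(2), of "Poly_Mapping.single x 1" c] assms(1)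
  by (simp add: monoid_algebra_simps)

lemma linear_map_monoid_algebra_eqI:
  assumes "monoid M" "linear_map (monoid_algebra M) A f" "linear_map (monoid_algebra M) A g"
    and "\<And>x. x \<in> carrier M \<Longrightarrow> f (Poly_Mapping.single x 1) = g (Poly_Mapping.single x 1)"
    and "p \<in> carrier (monoid_algebra M)"
  shows "f p = g p"
proof -
  interpret P: complex_algebra "monoid_algebra M"
    by (rule monoid.complex_algebra_monoid_algebra) fact
  have "Poly_Mapping.keys p \<subseteq> carrier M"
    using assms(5) by (simp add: monoid_algebra_simps)
  then show ?thesis
  proof (induction p rule: poly_mapping_keys_induct)
    case zero
    have "f \<zero>\<^bsub>monoid_algebra M\<^esub> = \<zero>" "g \<zero>\<^bsub>monoid_algebra M\<^esub> = \<zero>"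
      using assms(2,3)
      by (auto intro: linear_map_zero[OF P.complex_algebra_axioms complex_algebra_axioms])
    then show ?case by (simp add: monoid_algebra_simps)
  next
    case (add x c p)
    then have "Poly_Mapping.single x c \<in> carrier (monoid_algebra M)" "p \<in> carrier (monoid_algebra M)"
      by (auto simp: monoid_algebra_simps)
    then have "f (Poly_Mapping.single x c + p) = f (Poly_Mapping.single x c) \<oplus> f p"
      "g (Poly_Mapping.single x c + p) = g (Poly_Mapping.single x c) \<oplus> g p"
      using linear_map_add[OF assms(2)] linear_map_add[OF assms(3)]
      by (auto simp: monoid_algebra_simps)
    then show ?case
      using add(3) assms(4)[OF add(1)] linear_map_single[OF add(1) assms(2), of c]
        linear_map_single[OF add(1) assms(3), of c] by simp
  qed
qed

lemma twisted_derivation_monoid_algebraI: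
  assumes "monoid M"
    and lin: "linear_map (monoid_algebra M) A \<phi>" "linear_map (monoid_algebra M) A \<psi>"
      "linear_map (monoid_algebra M) A f"
    and eq: "\<And>x y. \<lbrakk>x \<in> carrier M; y \<in> carrier M\<rbrakk> \<Longrightarrow>
      f (Poly_Mapping.single (x \<otimes>\<^bsub>M\<^esub> y) 1) =
        f (Poly_Mapping.single x 1) \<otimes> \<psi> (Poly_Mapping.single y 1) \<oplus>
        \<phi> (Poly_Mapping.single x 1) \<otimes> f (Poly_Mapping.single y 1)"
  shows "twisted_derivation (monoid_algebra M) A \<phi> \<psi> f"
proof -
  let ?P = "monoid_algebra M"
  interpret P: complex_algebra ?P
    by (rule monoid.complex_algebra_monoid_algebra) fact
  \<comment> \<open>The rule to be proved is bilinear: the right factor is freed first, with a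
    monomial on the left, and then the left factor.\<close>
  have 1: "f (Poly_Mapping.single x 1 \<otimes>\<^bsub>?P\<^esub> q) =
      f (Poly_Mapping.single x 1) \<otimes> \<psi> q \<oplus> \<phi> (Poly_Mapping.single x 1) \<otimes> f q"
    if x: "x \<in> carrier M" and q: "q \<in> carrier ?P" for x q
    using q
  proof (rule linear_map_monoid_algebra_eqI[OF \<open>monoid M\<close>, rotated -1])
    show "linear_map ?P A (\<lambda>q. f (Poly_Mapping.single x 1 \<otimes>\<^bsub>?P\<^esub> q))"
      by (rule linear_map_compose[OF P.linear_map_mult_r[OF P.linear_map_id] lin(3)]) (simp add: x)
    show "linear_map ?P A
        (\<lambda>q. f (Poly_Mapping.single x 1) \<otimes> \<psi> q \<oplus> \<phi> (Poly_Mapping.single x 1) \<otimes> f q)"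
      using x by (intro linear_map_plus linear_map_mult_r lin linear_map_closed[OF lin(1)]
          linear_map_closed[OF lin(3)]) auto
  qed (simp add: x eq)
  have "f (p \<otimes>\<^bsub>?P\<^esub> q) = f p \<otimes> \<psi> q \<oplus> \<phi> p \<otimes> f q"
    if p: "p \<in> carrier ?P" and q: "q \<in> carrier ?P" for p q
    using p
  proof (rule linear_map_monoid_algebra_eqI[OF \<open>monoid M\<close>, rotated -1])
    show "linear_map ?P A (\<lambda>p. f (p \<otimes>\<^bsub>?P\<^esub> q))"
      by (rule linear_map_compose[OF P.linear_map_mult_l[OF P.linear_map_id] lin(3)]) (simp add: q)
    show "linear_map ?P A (\<lambda>p. f p \<otimes> \<psi> q \<oplus> \<phi> p \<otimes> f q)"
      using q by (intro linear_map_plus linear_map_mult_l lin linear_map_closed[OF lin(2)]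
          linear_map_closed[OF lin(3)]) auto
  qed (simp add: 1 q)
  then show ?thesis
    using lin(3) by (simp add: twisted_derivation_def)
qed

lemma algebra_hom_monoid_algebraI:
  assumes "monoid M" "linear_map (monoid_algebra M) A f"
    and "f (Poly_Mapping.single \<one>\<^bsub>M\<^esub> 1) = \<one>"
    and "\<And>x y. \<lbrakk>x \<in> carrier M; y \<in> carrier M\<rbrakk> \<Longrightarrow>
      f (Poly_Mapping.single (x \<otimes>\<^bsub>M\<^esub> y) 1) = f (Poly_Mapping.single x 1) \<otimes> f (Poly_Mapping.single y 1)"
  shows "algebra_hom (monoid_algebra M) A f"
proof -
  have "twisted_derivation (monoid_algebra M) A (\<lambda>_. \<zero>) f f"
    using assms by (intro twisted_derivation_monoid_algebraI linear_map_const_zero)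
      (auto simp: linear_map_closed)
  then show ?thesis
    using assms(2,3) linear_map_closed[OF assms(2)]
    by (auto simp: algebra_hom_def twisted_derivation_def monoid_algebra_simps)
qed

end


section \<open>Quotient algebras\<close>

locale algebra_quotient = complex_algebra A for A :: "(complex, 'm) module" (structure) +
  fixes R :: "'m set"
  assumes relations_closed: "R \<subseteq> carrier A"
begin

abbreviation "Q \<equiv> quotient_algebra A R"
abbreviation "\<pi> \<equiv> quotient_map A R"

sublocale I: ideal "genideal A R" A
  by (rule genideal_ideal[OF relations_closed])

lemma quotient_algebra_simps:
  "carrier Q = carrier (A Quot genideal A R)"
  "mult Q = mult (A Quot genideal A R)"
  "one Q = one (A Quot genideal A R)"
  "zero Q = zero (A Quot genideal A R)"
  "add Q = add (A Quot genideal A R)"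
  "smult Q c a = \<pi> (c \<odot> \<one>) \<otimes>\<^bsub>Q\<^esub> a"
  by (simp_all add: quotient_algebra_def Let_def quotient_map_def)

lemma quotient_map_basic:
  shows quotient_map_closed [simp]: "x \<in> carrier A \<Longrightarrow> \<pi> x \<in> carrier Q"
    and quotient_map_add:
      "\<lbrakk>x \<in> carrier A; y \<in> carrier A\<rbrakk> \<Longrightarrow> \<pi> (x \<oplus> y) = \<pi> x \<oplus>\<^bsub>Q\<^esub> \<pi> y"
    and quotient_map_mult:
      "\<lbrakk>x \<in> carrier A; y \<in> carrier A\<rbrakk> \<Longrightarrow> \<pi> (x \<otimes> y) = \<pi> x \<otimes>\<^bsub>Q\<^esub> \<pi> y"
    and quotient_map_one: "\<pi> \<one> = \<one>\<^bsub>Q\<^esub>"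
  using ring_hom_closed[OF I.rcos_ring_hom] ring_hom_add[OF I.rcos_ring_hom]
    ring_hom_mult[OF I.rcos_ring_hom] ring_hom_one[OF I.rcos_ring_hom]
  by (auto simp: quotient_algebra_simps(1-5) quotient_map_def)

text \<open>Scalars act on the quotient as multiplication by the class of c times the unit, so the
  claim is (c 1) x = c x, projected.\<close>

lemma quotient_map_smult: "x \<in> carrier A \<Longrightarrow> \<pi> (c \<odot> x) = c \<odot>\<^bsub>Q\<^esub> \<pi> x"
  by (simp add: quotient_algebra_simps(6) flip: quotient_map_mult) (simp add: smult_mult_l)

lemma quotient_map_surj:
  assumes "a \<in> carrier Q"
  obtains x where "x \<in> carrier A" "a = \<pi> x"
  using assms by (auto simp: quotient_algebra_simps(1) FactRing_def A_RCOSETS_def' quotient_map_def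
      a_r_coset_def')

lemma quotient_map_ideal: "x \<in> genideal A R \<Longrightarrow> \<pi> x = \<zero>\<^bsub>Q\<^esub>"
  using a_rcos_zero[OF I.is_ideal] by (simp add: quotient_map_def quotient_algebra_simps FactRing_def)

lemma quotient_map_relation: "x \<in> R \<Longrightarrow> \<pi> x = \<zero>\<^bsub>Q\<^esub>"
  using quotient_map_ideal genideal_self[OF relations_closed] by blast

lemma quotient_map_eqD:
  assumes "x \<in> carrier A" "y \<in> carrier A" "\<pi> x = \<pi> y"
  shows "x \<ominus> y \<in> genideal A R"
proof -
  have "x \<in> genideal A R +> y"
    using assms I.a_rcos_self[of x] by (simp add: quotient_map_def)
  then show ?thesis
    using I.a_rcos_module_minus[of y x] assms ring_axioms by simp
qed

sublocale Q: complex_algebra Q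
proof -
  interpret quot: ring "A Quot genideal A R"
    by (rule I.quotient_is_ring)
  \<comment> \<open>\<open>Q\<close> is a new record that shares only its ring operations with the
    factor ring, so the ring laws are carried over one by one.\<close>
  have ring: "ring Q"
  proof (rule ringI)
    show "abelian_group Q"
      by (rule abelian_groupI)
        (use quot.add.l_inv_ex in \<open>auto simp: quotient_algebra_simps(1-5) quot.a_ac\<close>)
    show "Group.monoid Q"
      by (rule monoidI) (auto simp: quotient_algebra_simps(1-5) quot.m_assoc)
  qed (auto simp: quotient_algebra_simps(1-5) quot.l_distr quot.r_distr)
  then interpret QR: ring Q .
  show "complex_algebra Q"
  proof (intro complex_algebra.intro complex_algebra_axioms.intro ring)
    fix a b c d assume "a \<in> carrier Q" "b \<in> carrier Q"
    then obtain x y where [simp]: "x \<in> carrier A" "a = \<pi> x" "y \<in> carrier A" "b = \<pi> y"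
      by (metis quotient_map_surj)
    note * = quotient_map_smult[symmetric] quotient_map_add[symmetric] quotient_map_mult[symmetric]
    show "c \<odot>\<^bsub>Q\<^esub> a \<in> carrier Q" "1 \<odot>\<^bsub>Q\<^esub> a = a" "(c + d) \<odot>\<^bsub>Q\<^esub> a = c \<odot>\<^bsub>Q\<^esub> a \<oplus>\<^bsub>Q\<^esub> d \<odot>\<^bsub>Q\<^esub> a"
      "c \<odot>\<^bsub>Q\<^esub> (a \<oplus>\<^bsub>Q\<^esub> b) = c \<odot>\<^bsub>Q\<^esub> a \<oplus>\<^bsub>Q\<^esub> c \<odot>\<^bsub>Q\<^esub> b" "c \<odot>\<^bsub>Q\<^esub> (d \<odot>\<^bsub>Q\<^esub> a) = (c * d) \<odot>\<^bsub>Q\<^esub> a"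
      "(c \<odot>\<^bsub>Q\<^esub> a) \<otimes>\<^bsub>Q\<^esub> b = c \<odot>\<^bsub>Q\<^esub> (a \<otimes>\<^bsub>Q\<^esub> b)" "a \<otimes>\<^bsub>Q\<^esub> (c \<odot>\<^bsub>Q\<^esub> b) = c \<odot>\<^bsub>Q\<^esub> (a \<otimes>\<^bsub>Q\<^esub> b)"
      by (simp_all add: * smult_l_distr smult_r_distr smult_assoc smult_mult_l smult_mult_r)
  qed
qed

lemma quotient_map_hom: "algebra_hom A Q \<pi>"
  by (simp add: algebra_hom_def linear_map_def quotient_map_add quotient_map_mult quotient_map_one
      quotient_map_smult)

text \<open>For x in the kernel of f, the values f(xy) and f(yx) still contain the terms with \<phi>
  x and \<psi> x. Hence it is the joint kernel of f, \<phi> and \<psi> that is an ideal, and all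
  three maps have to kill the relations.\<close>

lemma twisted_derivation_ideal:
  assumes "complex_algebra B" "algebra_hom A B \<phi>" "algebra_hom A B \<psi>" "twisted_derivation A B \<phi> \<psi> f"
    and "\<And>r. r \<in> R \<Longrightarrow> \<phi> r = \<zero>\<^bsub>B\<^esub>" "\<And>r. r \<in> R \<Longrightarrow> \<psi> r = \<zero>\<^bsub>B\<^esub>" "\<And>r. r \<in> R \<Longrightarrow> f r = \<zero>\<^bsub>B\<^esub>"
    and "x \<in> genideal A R"
  shows "f x = \<zero>\<^bsub>B\<^esub>"
proof -
  interpret B: complex_algebra B by fact
  note lin = algebra_hom_linear[OF assms(2)] algebra_hom_linear[OF assms(3)]
    twisted_derivation_linear[OF assms(4)]
  note lin_simps = lin[THEN linear_map_closed] lin[THEN linear_map_add] lin[THEN linear_map_smult]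
    lin[THEN linear_map_zero[OF complex_algebra_axioms assms(1)]]
  have "ideal {x \<in> carrier A. \<phi> x = \<zero>\<^bsub>B\<^esub> \<and> \<psi> x = \<zero>\<^bsub>B\<^esub> \<and> f x = \<zero>\<^bsub>B\<^esub>} A"
    by (rule idealI_linear)
      (auto simp: lin_simps twisted_derivation_mult[OF assms(4)] algebra_hom_mult[OF assms(2)]
        algebra_hom_mult[OF assms(3)])
  then have "genideal A R \<subseteq> {x \<in> carrier A. \<phi> x = \<zero>\<^bsub>B\<^esub> \<and> \<psi> x = \<zero>\<^bsub>B\<^esub> \<and> f x = \<zero>\<^bsub>B\<^esub>}"
    using assms(5-7) relations_closed by (intro genideal_minimal) auto
  then show ?thesis
    using assms(8) by auto
qed

lemma algebra_hom_ideal: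
  assumes "complex_algebra B" "algebra_hom A B f" "\<And>r. r \<in> R \<Longrightarrow> f r = \<zero>\<^bsub>B\<^esub>" "x \<in> genideal A R"
  shows "f x = \<zero>\<^bsub>B\<^esub>"
proof -
  interpret B: complex_algebra B by fact
  note lin = algebra_hom_linear[OF assms(2)]
  note lin_simps = linear_map_closed[OF lin] linear_map_add[OF lin] linear_map_smult[OF lin]
    linear_map_zero[OF complex_algebra_axioms assms(1) lin]
  have "ideal {x \<in> carrier A. f x = \<zero>\<^bsub>B\<^esub>} A"
    by (rule idealI_linear) (auto simp: lin_simps algebra_hom_mult[OF assms(2)])
  then have "genideal A R \<subseteq> {x \<in> carrier A. f x = \<zero>\<^bsub>B\<^esub>}"
    using assms(3) relations_closed by (intro genideal_minimal) auto
  then show ?thesis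
    using assms(4) by auto
qed

text \<open>The map on the quotient evaluates f at a chosen representative; two representatives
  differ by an element of the ideal, where f vanishes. Multiplicativity and Leibniz rules are read
  off later from the values on classes.\<close>

lemma linear_map_descends:
  assumes "complex_algebra B" "linear_map A B f" "\<And>x. x \<in> genideal A R \<Longrightarrow> f x = \<zero>\<^bsub>B\<^esub>"
  obtains g where "linear_map Q B g" "\<And>x. x \<in> carrier A \<Longrightarrow> g (\<pi> x) = f x"
proof -
  interpret B: complex_algebra B by fact
  define g where "g a = f (SOME x. x \<in> carrier A \<and> \<pi> x = a)" for a
  have g: "g (\<pi> x) = f x" if x: "x \<in> carrier A" for x
  proof -
    define y where "y = (SOME y. y \<in> carrier A \<and> \<pi> y = \<pi> x)"
    have y: "y \<in> carrier A" "\<pi> y = \<pi> x"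
      using someI[of "\<lambda>y. y \<in> carrier A \<and> \<pi> y = \<pi> x" x] x by (auto simp: y_def)
    then have "f (y \<ominus> x) = \<zero>\<^bsub>B\<^esub>"
      using x by (intro assms(3) quotient_map_eqD)
    moreover have "y = (y \<ominus> x) \<oplus> x"
      using x y by (simp add: a_minus_def a_assoc l_neg)
    ultimately have "f y = f x"
      using linear_map_add[OF assms(2), of "y \<ominus> x" x] linear_map_closed[OF assms(2)] x y by simp
    then show ?thesis by (simp add: g_def y_def)
  qed
  have "linear_map Q B g"
    unfolding linear_map_def
  proof (intro conjI ballI allI funcsetI)
    fix a b assume "a \<in> carrier Q" "b \<in> carrier Q"
    then obtain x y where [simp]: "x \<in> carrier A" "a = \<pi> x" "y \<in> carrier A" "b = \<pi> y"
      by (metis quotient_map_surj)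
    show "g a \<in> carrier B" "g (a \<oplus>\<^bsub>Q\<^esub> b) = g a \<oplus>\<^bsub>B\<^esub> g b" "g (c \<odot>\<^bsub>Q\<^esub> a) = c \<odot>\<^bsub>B\<^esub> g a" for c
      using linear_mapD[OF assms(2)]
      by (simp_all add: g flip: quotient_map_add quotient_map_smult)
  qed
  with g show ?thesis using that by blast
qed

end

text \<open>The relations are written with the subtraction of the type of polynomial mappings,
  whereas the algebra record only knows its own addition and scalars; this lemma connects the
  two.\<close>

lemma linear_map_monoid_algebra_diff:
  assumes "monoid M" "complex_algebra B" "linear_map (monoid_algebra M) B f"
    and "p \<in> carrier (monoid_algebra M)" "q \<in> carrier (monoid_algebra M)"
  shows "f (p - q) = f p \<ominus>\<^bsub>B\<^esub> f q"
proof -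
  interpret P: complex_algebra "monoid_algebra M"
    by (rule monoid.complex_algebra_monoid_algebra) fact
  interpret B: complex_algebra B by fact
  have "p - q = p \<oplus>\<^bsub>monoid_algebra M\<^esub> (- 1) \<odot>\<^bsub>monoid_algebra M\<^esub> q"
    by (rule poly_mapping_eqI) (simp add: monoid_algebra_simps lookup_add lookup_minus)
  then show ?thesis
    using assms(4,5) linear_map_closed[OF assms(3)]
    by (simp add: linear_map_add[OF assms(3)] linear_map_smult[OF assms(3)] B.a_minus_eq_smult)
qed

lemma monoid_algebra_diff_closed:
  "\<lbrakk>p \<in> carrier (monoid_algebra M); q \<in> carrier (monoid_algebra M)\<rbrakk> \<Longrightarrow>
     p - q \<in> carrier (monoid_algebra M)"
  using keys_diff[of p q] by (auto simp: monoid_algebra_simps)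

lemma monoid_algebra_mult_diff:
  "(p - p') \<otimes>\<^bsub>monoid_algebra M\<^esub> q = p \<otimes>\<^bsub>monoid_algebra M\<^esub> q - p' \<otimes>\<^bsub>monoid_algebra M\<^esub> q"
  "q \<otimes>\<^bsub>monoid_algebra M\<^esub> (p - p') = q \<otimes>\<^bsub>monoid_algebra M\<^esub> p - q \<otimes>\<^bsub>monoid_algebra M\<^esub> p'"
  by (simp_all add: eq_diff_eq flip: monoid_algebra_mult_distrib)


section \<open>Free algebras and their quotients\<close>

abbreviation word_monoid :: "'v set \<Rightarrow> 'v list monoid" where
  "word_monoid V \<equiv> \<lparr>carrier = lists V, mult = (@), one = []\<rparr>"

lemma monoid_word_monoid: "monoid (word_monoid V)"
  by (rule monoidI) auto

lemma complex_algebra_free_algebra: "complex_algebra (free_algebra V)"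
  unfolding free_algebra_def
  by (rule monoid.complex_algebra_monoid_algebra[OF monoid_word_monoid])

lemma free_algebra_simps:
  "carrier (free_algebra V) = {p. Poly_Mapping.keys p \<subseteq> lists V}"
  "p \<oplus>\<^bsub>free_algebra V\<^esub> q = p + q"
  "\<zero>\<^bsub>free_algebra V\<^esub> = 0"
  "\<one>\<^bsub>free_algebra V\<^esub> = Poly_Mapping.single [] 1"
  "c \<odot>\<^bsub>free_algebra V\<^esub> p = Poly_Mapping.map ((*) c) p"
  "Poly_Mapping.single w c \<otimes>\<^bsub>free_algebra V\<^esub> Poly_Mapping.single w' d =
     Poly_Mapping.single (w @ w') (c * d)"
  by (simp_all add: free_algebra_def monoid_algebra_simps)

lemmas linear_map_free_algebra_diff =
  linear_map_monoid_algebra_diff[OF monoid_word_monoid, folded free_algebra_def]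

context complex_algebra
begin

text \<open>The universal property of the free algebra: multiplying the values along a word is a
  homomorphism of monoids, and its linear extension is therefore multiplicative.\<close>

lemma free_algebra_hom_exists:
  assumes f: "f \<in> V \<rightarrow> carrier A"
  obtains g where "algebra_hom (free_algebra V) A g"
    and "\<And>v. v \<in> V \<Longrightarrow> g (Poly_Mapping.single [v] 1) = f v"
proof -
  define h where "h w = foldr (\<lambda>v b. f v \<otimes> b) w \<one>" for w
  have h_closed: "h w \<in> carrier A" if "w \<in> lists V" for w
    using that f by (induction w) (auto simp: h_def)
  have h_append: "h (w @ w') = h w \<otimes> h w'" if "w \<in> lists V" "w' \<in> lists V" for w w'
    using that(1)
  proof (induction w)
    case (Cons v w)
    have "h ((v # w) @ w') = f v \<otimes> h (w @ w')" "h (v # w) = f v \<otimes> h w"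
      by (simp_all add: h_def)
    moreover have "f v \<in> carrier A" "h w \<in> carrier A" "h w' \<in> carrier A"
      using f Cons h_closed that(2) by auto
    ultimately show ?case
      using Cons by (simp add: m_assoc)
  qed (use h_closed[OF that(2)] in \<open>simp add: h_def\<close>)
  have h: "h \<in> carrier (word_monoid V) \<rightarrow> carrier A"
    using h_closed by auto
  show ?thesis
  proof (rule that)
    show "algebra_hom (free_algebra V) A (lin_ext A h)"
      unfolding free_algebra_def
      using h_closed h_append
      by (intro algebra_hom_monoid_algebraI monoid_word_monoid lin_ext_linear h)
        (auto simp: h_def[of "[]"])
    show "lin_ext A h (Poly_Mapping.single [v] 1) = f v" if "v \<in> V" for v
      using that f h_closed[of "[v]"] by (auto simp: h_def Pi_iff)
  qed
qed

text \<open>Splitting off the first letter forces the value of a twisted derivation on a word, and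
  \<open>D\<close> is this recursion. That it obeys the Leibniz rule at every other cut of the word,
  not only after the first letter, is \<open>D_append\<close>; it needs \<phi> and \<psi> to be
  multiplicative.\<close>

lemma free_algebra_derivation_exists:
  assumes \<phi>: "algebra_hom (free_algebra V) A \<phi>" and \<psi>: "algebra_hom (free_algebra V) A \<psi>"
    and d: "d \<in> V \<rightarrow> carrier A"
  obtains g where "twisted_derivation (free_algebra V) A \<phi> \<psi> g"
    and "\<And>v. v \<in> V \<Longrightarrow> g (Poly_Mapping.single [v] 1) = d v"
proof -
  define D where "D = rec_list \<zero> (\<lambda>v w b.
    d v \<otimes> \<psi> (Poly_Mapping.single w 1) \<oplus> \<phi> (Poly_Mapping.single [v] 1) \<otimes> b)"
  have D_simps: "D [] = \<zero>" "\<And>v w. D (v # w) =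
      d v \<otimes> \<psi> (Poly_Mapping.single w 1) \<oplus> \<phi> (Poly_Mapping.single [v] 1) \<otimes> D w"
    by (simp_all add: D_def)
  have closed: "\<phi> (Poly_Mapping.single w 1) \<in> carrier A" "\<psi> (Poly_Mapping.single w 1) \<in> carrier A"
    if "w \<in> lists V" for w
    using that linear_map_closed[OF algebra_hom_linear[OF \<phi>]] linear_map_closed[OF algebra_hom_linear[OF \<psi>]]
    by (auto simp: free_algebra_simps)
  have one: "\<phi> (Poly_Mapping.single [] 1) = \<one>" "\<psi> (Poly_Mapping.single [] 1) = \<one>"
    using algebra_hom_one[OF \<phi>] algebra_hom_one[OF \<psi>] by (simp_all add: free_algebra_simps)
  have app: "\<phi> (Poly_Mapping.single (w @ w') 1) = \<phi> (Poly_Mapping.single w 1) \<otimes> \<phi> (Poly_Mapping.single w' 1)"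
    "\<psi> (Poly_Mapping.single (w @ w') 1) = \<psi> (Poly_Mapping.single w 1) \<otimes> \<psi> (Poly_Mapping.single w' 1)"
    if "w \<in> lists V" "w' \<in> lists V" for w w'
    using that algebra_hom_mult[OF \<phi>, of "Poly_Mapping.single w 1" "Poly_Mapping.single w' 1"]
      algebra_hom_mult[OF \<psi>, of "Poly_Mapping.single w 1" "Poly_Mapping.single w' 1"]
    by (simp_all add: free_algebra_simps)
  have D_closed: "D w \<in> carrier A" if "w \<in> lists V" for w
    using that
  proof (induction w)
    case (Cons v w)
    then show ?case
      using d closed[of w] closed[of "[v]"] by (auto simp: D_simps)
  qed (simp add: D_simps)
  have D_append: "D (w @ w') =
      D w \<otimes> \<psi> (Poly_Mapping.single w' 1) \<oplus> \<phi> (Poly_Mapping.single w 1) \<otimes> D w'"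
    if w: "w \<in> lists V" and w': "w' \<in> lists V" for w w'
    using w
  proof (induction w)
    case (Cons v w)
    have [simp]: "d v \<in> carrier A" "D w \<in> carrier A" "D w' \<in> carrier A"
      using d Cons D_closed w' by auto
    have "\<phi> (Poly_Mapping.single (v # w) 1) = \<phi> (Poly_Mapping.single [v] 1) \<otimes> \<phi> (Poly_Mapping.single w 1)"
      using Cons app(1)[of "[v]" w] by simp
    then show ?case
      using Cons closed[of w] closed[of w'] closed[of "[v]"] w' app(2)[of w w']
      by (simp add: D_simps m_assoc l_distr r_distr a_assoc)
  qed (use w' in \<open>simp add: D_simps one closed D_closed\<close>)
  have D: "D \<in> carrier (word_monoid V) \<rightarrow> carrier A"
    using D_closed by auto
  show ?thesis
  proof (rule that)
    show "twisted_derivation (free_algebra V) A \<phi> \<psi> (lin_ext A D)"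
      using algebra_hom_linear[OF \<phi>] algebra_hom_linear[OF \<psi>] unfolding free_algebra_def
      by (intro twisted_derivation_monoid_algebraI monoid_word_monoid lin_ext_linear D)
        (auto simp: D_append D_closed closed)
    show "lin_ext A D (Poly_Mapping.single [v] 1) = d v" if "v \<in> V" for v
      using that d D_closed[of "[v]"] closed[of "[v]"] by (auto simp: D_simps one Pi_iff)
  qed
qed

end

locale free_algebra_quotient = algebra_quotient "free_algebra V" R
  for V :: "'v set" and R :: "('v list \<Rightarrow>\<^sub>0 complex) set"
begin

definition \<iota> :: "'v \<Rightarrow> ('v list \<Rightarrow>\<^sub>0 complex) set" where
  "\<iota> v = \<pi> (Poly_Mapping.single [v] 1)"

abbreviation word :: "'v list \<Rightarrow> ('v list \<Rightarrow>\<^sub>0 complex) set" where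
  "word w \<equiv> \<pi> (Poly_Mapping.single w 1)"

lemma single_closed [simp]: "w \<in> lists V \<Longrightarrow> Poly_Mapping.single w c \<in> carrier (free_algebra V)"
  by (simp add: free_algebra_simps)

lemma \<iota>_closed [simp]: "v \<in> V \<Longrightarrow> \<iota> v \<in> carrier Q"
  by (simp add: \<iota>_def)

lemma word_Nil: "word [] = \<one>\<^bsub>Q\<^esub>"
  using quotient_map_one by (simp add: free_algebra_simps)

lemma word_append: "\<lbrakk>w \<in> lists V; w' \<in> lists V\<rbrakk> \<Longrightarrow> word (w @ w') = word w \<otimes>\<^bsub>Q\<^esub> word w'"
  using quotient_map_mult[of "Poly_Mapping.single w 1" "Poly_Mapping.single w' 1"]
  by (simp add: free_algebra_simps)

lemma word_Cons: "\<lbrakk>v \<in> V; w \<in> lists V\<rbrakk> \<Longrightarrow> word (v # w) = \<iota> v \<otimes>\<^bsub>Q\<^esub> word w"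
  using word_append[of "[v]" w] by (simp add: \<iota>_def)

lemma quotient_map_single: "w \<in> lists V \<Longrightarrow> \<pi> (Poly_Mapping.single w c) = c \<odot>\<^bsub>Q\<^esub> word w"
  using quotient_map_smult[of "Poly_Mapping.single w 1" c] by (simp add: free_algebra_simps)

text \<open>The set S restricts the words of the representative; with the words of one length parity
  this becomes induction over a homogeneous part.\<close>

lemma quotient_map_keys_induct [consumes 2, case_names zero add]:
  assumes "Poly_Mapping.keys p \<subseteq> S" "S \<subseteq> lists V"
    and "P \<zero>\<^bsub>Q\<^esub>"
    and "\<And>w c q. \<lbrakk>w \<in> S; Poly_Mapping.keys q \<subseteq> S; P (\<pi> q)\<rbrakk> \<Longrightarrow> P (c \<odot>\<^bsub>Q\<^esub> word w \<oplus>\<^bsub>Q\<^esub> \<pi> q)"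
  shows "P (\<pi> p)"
  using assms(1)
proof (induction p rule: poly_mapping_keys_induct)
  case zero
  have "\<pi> \<zero>\<^bsub>free_algebra V\<^esub> = \<zero>\<^bsub>Q\<^esub>"
    using Q.complex_algebra_axioms complex_algebra_axioms linear_map_zero[OF _ _ algebra_hom_linear[OF quotient_map_hom]]
    by blast
  then show ?case
    using assms(3) by (simp add: free_algebra_simps)
next
  case (add w c q)
  then have w: "w \<in> lists V" and q: "q \<in> carrier (free_algebra V)"
    using assms(2) by (auto simp: free_algebra_simps)
  have "\<pi> (Poly_Mapping.single w c + q) = c \<odot>\<^bsub>Q\<^esub> word w \<oplus>\<^bsub>Q\<^esub> \<pi> q"
    using quotient_map_add[OF single_closed[OF w] q] quotient_map_single[OF w, of c]
    by (simp add: free_algebra_simps)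
  then show ?case
    using assms(4) add by simp
qed

text \<open>Words grow by one letter on the left, so left multiplication by a generator is the only
  product case.\<close>

lemma quotient_induct [consumes 1, case_names zero one add smult mult]:
  assumes "a \<in> carrier Q"
    and "P \<zero>\<^bsub>Q\<^esub>"
    and "P \<one>\<^bsub>Q\<^esub>"
    and "\<And>a b. \<lbrakk>a \<in> carrier Q; b \<in> carrier Q; P a; P b\<rbrakk> \<Longrightarrow> P (a \<oplus>\<^bsub>Q\<^esub> b)"
    and "\<And>c a. \<lbrakk>a \<in> carrier Q; P a\<rbrakk> \<Longrightarrow> P (c \<odot>\<^bsub>Q\<^esub> a)"
    and "\<And>v a. \<lbrakk>v \<in> V; a \<in> carrier Q; P a\<rbrakk> \<Longrightarrow> P (\<iota> v \<otimes>\<^bsub>Q\<^esub> a)"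
  shows "P a"
proof -
  have w: "P (word w)" if "w \<in> lists V" for w
    using that by (induction w) (auto simp: word_Nil word_Cons assms)
  obtain p where p: "p \<in> carrier (free_algebra V)" "a = \<pi> p"
    using quotient_map_surj[OF assms(1)] .
  then have "Poly_Mapping.keys p \<subseteq> lists V"
    by (simp add: free_algebra_simps)
  then have "P (\<pi> p)"
    using subset_refl[of "lists V"]
  proof (induction p rule: quotient_map_keys_induct)
    case (add x c q)
    then show ?case
      by (intro assms(4,5) w) (auto simp: free_algebra_simps)
  qed (use assms in auto)
  then show ?thesis using p by simp
qed

text \<open>The lift to the free algebra is hidden in an existence statement. The premise on R
  therefore speaks of every homomorphism with the prescribed values on letters; that is enough to
  evaluate it on a relation.\<close>

lemma algebra_hom_exists:
  assumes B: "complex_algebra B" and f: "f \<in> V \<rightarrow> carrier B"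
    and R: "\<And>g r. \<lbrakk>algebra_hom (free_algebra V) B g;
      \<And>v. v \<in> V \<Longrightarrow> g (Poly_Mapping.single [v] 1) = f v; r \<in> R\<rbrakk> \<Longrightarrow> g r = \<zero>\<^bsub>B\<^esub>"
  obtains g where "algebra_hom Q B g" "\<And>v. v \<in> V \<Longrightarrow> g (\<iota> v) = f v"
proof -
  interpret B: complex_algebra B by fact
  obtain h where h: "algebra_hom (free_algebra V) B h"
    "\<And>v. v \<in> V \<Longrightarrow> h (Poly_Mapping.single [v] 1) = f v"
    using B.free_algebra_hom_exists[OF f] by blast
  have h_zero: "h x = \<zero>\<^bsub>B\<^esub>" if "x \<in> genideal (free_algebra V) R" for x
    using algebra_hom_ideal[OF B h(1) R[OF h] that] .
  obtain g where g: "linear_map Q B g" "\<And>x. x \<in> carrier (free_algebra V) \<Longrightarrow> g (\<pi> x) = h x"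
    using linear_map_descends[OF B algebra_hom_linear[OF h(1)] h_zero] by blast
  have "algebra_hom Q B g"
    unfolding algebra_hom_def
  proof (intro conjI ballI)
    fix a b assume "a \<in> carrier Q" "b \<in> carrier Q"
    then obtain x y where [simp]: "x \<in> carrier (free_algebra V)" "a = \<pi> x"
        "y \<in> carrier (free_algebra V)" "b = \<pi> y"
      by (metis quotient_map_surj)
    show "g (a \<otimes>\<^bsub>Q\<^esub> b) = g a \<otimes>\<^bsub>B\<^esub> g b"
      by (simp add: g algebra_hom_mult[OF h(1)] flip: quotient_map_mult)
  qed (use g algebra_hom_one[OF h(1)] in \<open>auto simp flip: quotient_map_one\<close>)
  moreover have "g (\<iota> v) = f v" if "v \<in> V" for v
    using that by (simp add: \<iota>_def g h)
  ultimately show ?thesis using that by blast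
qed

text \<open>The twists are given on the quotient already, so their pullbacks kill the relations
  automatically and only the values of the derivation itself remain to be checked.\<close>

lemma twisted_derivation_exists:
  assumes B: "complex_algebra B" and d: "d \<in> V \<rightarrow> carrier B"
    and \<phi>: "algebra_hom Q B \<phi>" and \<psi>: "algebra_hom Q B \<psi>"
    and R: "\<And>g r. \<lbrakk>twisted_derivation (free_algebra V) B (\<lambda>x. \<phi> (\<pi> x)) (\<lambda>x. \<psi> (\<pi> x)) g;
      \<And>v. v \<in> V \<Longrightarrow> g (Poly_Mapping.single [v] 1) = d v; r \<in> R\<rbrakk> \<Longrightarrow> g r = \<zero>\<^bsub>B\<^esub>"
  obtains g where "twisted_derivation Q B \<phi> \<psi> g" "\<And>v. v \<in> V \<Longrightarrow> g (\<iota> v) = d v"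
proof -
  interpret B: complex_algebra B by fact
  note comp = algebra_hom_compose[OF quotient_map_hom \<phi>] algebra_hom_compose[OF quotient_map_hom \<psi>]
  obtain h where h: "twisted_derivation (free_algebra V) B (\<lambda>x. \<phi> (\<pi> x)) (\<lambda>x. \<psi> (\<pi> x)) h"
    "\<And>v. v \<in> V \<Longrightarrow> h (Poly_Mapping.single [v] 1) = d v"
    using B.free_algebra_derivation_exists[OF comp d] by blast
  have zero: "\<phi> \<zero>\<^bsub>Q\<^esub> = \<zero>\<^bsub>B\<^esub>" "\<psi> \<zero>\<^bsub>Q\<^esub> = \<zero>\<^bsub>B\<^esub>"
    using linear_map_zero[OF Q.complex_algebra_axioms B] algebra_hom_linear \<phi> \<psi> by auto
  have "h x = \<zero>\<^bsub>B\<^esub>" if "x \<in> genideal (free_algebra V) R" for x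
    by (rule twisted_derivation_ideal[OF B comp h(1) _ _ R[OF h] that])
      (auto simp: quotient_map_relation zero)
  then obtain g where g: "linear_map Q B g" "\<And>x. x \<in> carrier (free_algebra V) \<Longrightarrow> g (\<pi> x) = h x"
    using linear_map_descends[OF B twisted_derivation_linear[OF h(1)]] by blast
  have "twisted_derivation Q B \<phi> \<psi> g"
    unfolding twisted_derivation_def
  proof (intro conjI ballI)
    fix a b assume "a \<in> carrier Q" "b \<in> carrier Q"
    then obtain x y where [simp]: "x \<in> carrier (free_algebra V)" "a = \<pi> x"
        "y \<in> carrier (free_algebra V)" "b = \<pi> y"
      by (metis quotient_map_surj)
    show "g (a \<otimes>\<^bsub>Q\<^esub> b) = g a \<otimes>\<^bsub>B\<^esub> \<psi> b \<oplus>\<^bsub>B\<^esub> \<phi> a \<otimes>\<^bsub>B\<^esub> g b"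
      by (simp add: g twisted_derivation_mult[OF h(1)] flip: quotient_map_mult)
  qed (use g in auto)
  moreover have "g (\<iota> v) = d v" if "v \<in> V" for v
    using that by (simp add: \<iota>_def g h)
  ultimately show ?thesis using that by blast
qed

end

text \<open>The common core of the exterior and the symmetric algebra: once the linear relations are
  among those divided out, the map \<open>\<iota>\<close> is linear.\<close>

locale presented_algebra = vs: vector_space sc + free_algebra_quotient V R
  for sc :: "complex \<Rightarrow> 'v::ab_group_add \<Rightarrow> 'v" and V :: "'v set" and R +
  assumes subspace: "vs.subspace V"
    and linear_relations_subset: "linear_relations sc V \<subseteq> R"
begin

lemma \<iota>_add: "\<lbrakk>u \<in> V; v \<in> V\<rbrakk> \<Longrightarrow> \<iota> (u + v) = \<iota> u \<oplus>\<^bsub>Q\<^esub> \<iota> v"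
  and \<iota>_scale: "v \<in> V \<Longrightarrow> \<iota> (sc c v) = c \<odot>\<^bsub>Q\<^esub> \<iota> v"
proof -
  note diff = linear_map_free_algebra_diff[OF Q.complex_algebra_axioms algebra_hom_linear[OF quotient_map_hom]]
  have diff_closed: "p - q \<in> carrier (free_algebra V)"
    if "p \<in> carrier (free_algebra V)" "q \<in> carrier (free_algebra V)" for p q
    using that keys_diff[of p q] by (auto simp: free_algebra_simps)
  have eqI: "a = b" if "a \<ominus>\<^bsub>Q\<^esub> b = \<zero>\<^bsub>Q\<^esub>" "a \<in> carrier Q" "b \<in> carrier Q" for a b
    using that by simp
  show "\<iota> (u + v) = \<iota> u \<oplus>\<^bsub>Q\<^esub> \<iota> v" if [simp]: "u \<in> V" "v \<in> V"
  proof -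
    have [simp]: "u + v \<in> V" using that subspace vs.subspace_add by blast
    have "\<pi> (Poly_Mapping.single [u + v] 1 - Poly_Mapping.single [u] 1 - Poly_Mapping.single [v] 1) = \<zero>\<^bsub>Q\<^esub>"
      using linear_relations_subset that by (intro quotient_map_relation) (force simp: linear_relations_def)
    then have "\<iota> (u + v) \<ominus>\<^bsub>Q\<^esub> \<iota> u \<ominus>\<^bsub>Q\<^esub> \<iota> v = \<zero>\<^bsub>Q\<^esub>"
      by (simp add: diff diff_closed \<iota>_def)
    then have "\<iota> (u + v) \<ominus>\<^bsub>Q\<^esub> (\<iota> u \<oplus>\<^bsub>Q\<^esub> \<iota> v) = \<zero>\<^bsub>Q\<^esub>"
      by (simp add: Q.a_minus_eq_smult Q.smult_r_distr Q.a_assoc)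
    then show ?thesis by (rule eqI) simp_all
  qed
  show "\<iota> (sc c v) = c \<odot>\<^bsub>Q\<^esub> \<iota> v" if [simp]: "v \<in> V"
  proof -
    have [simp]: "sc c v \<in> V" using that subspace vs.subspace_scale by blast
    have "\<pi> (Poly_Mapping.single [sc c v] 1 - Poly_Mapping.single [v] c) = \<zero>\<^bsub>Q\<^esub>"
      using linear_relations_subset that by (intro quotient_map_relation) (force simp: linear_relations_def)
    then have "\<iota> (sc c v) \<ominus>\<^bsub>Q\<^esub> c \<odot>\<^bsub>Q\<^esub> \<iota> v = \<zero>\<^bsub>Q\<^esub>"
      by (simp add: diff quotient_map_single[of "[v]" c] \<iota>_def)
    then show ?thesis by (rule eqI) simp_all
  qed
qed

text \<open>Disposes of the linear relations in every existence proof below. Only the linearity of g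
  is used, so it serves homomorphisms and twisted derivations alike.\<close>

lemma linear_relations_vanish:
  assumes B: "complex_algebra B" and g: "linear_map (free_algebra V) B g"
    and f: "\<And>v. v \<in> V \<Longrightarrow> g (Poly_Mapping.single [v] 1) = f v"
    and f_add: "\<And>u v. \<lbrakk>u \<in> V; v \<in> V\<rbrakk> \<Longrightarrow> f (u + v) = f u \<oplus>\<^bsub>B\<^esub> f v"
    and f_scale: "\<And>c v. v \<in> V \<Longrightarrow> f (sc c v) = c \<odot>\<^bsub>B\<^esub> f v"
    and "r \<in> linear_relations sc V"
  shows "g r = \<zero>\<^bsub>B\<^esub>"
proof -
  interpret B: complex_algebra B by fact
  have closed: "f v \<in> carrier B" if "v \<in> V" for v
    using linear_map_closed[OF g, of "Poly_Mapping.single [v] 1"] f[OF that] that by simp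
  have diff_closed: "p - q \<in> carrier (free_algebra V)"
    if "p \<in> carrier (free_algebra V)" "q \<in> carrier (free_algebra V)" for p q
    using that keys_diff[of p q] by (auto simp: free_algebra_simps)
  have g_single: "g (Poly_Mapping.single [v] c) = c \<odot>\<^bsub>B\<^esub> f v" if "v \<in> V" for v c
    using linear_map_smult[OF g, of "Poly_Mapping.single [v] 1" c] f that
    by (simp add: free_algebra_simps)
  note diff = linear_map_free_algebra_diff[OF B g]
  from \<open>r \<in> linear_relations sc V\<close> show ?thesis
    unfolding linear_relations_def
  proof (elim UnE CollectE exE conjE)
    fix u v assume uv: "u \<in> V" "v \<in> V"
      and r: "r = Poly_Mapping.single [u + v] 1 - Poly_Mapping.single [u] 1 - Poly_Mapping.single [v] 1"
    have [simp]: "u + v \<in> V" using uv subspace vs.subspace_add by blast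
    have "g r = (f u \<oplus>\<^bsub>B\<^esub> f v) \<ominus>\<^bsub>B\<^esub> f u \<ominus>\<^bsub>B\<^esub> f v"
      using uv by (simp add: r diff diff_closed f f_add)
    also have "\<dots> = (f u \<oplus>\<^bsub>B\<^esub> f v) \<ominus>\<^bsub>B\<^esub> (f u \<oplus>\<^bsub>B\<^esub> f v)"
      using uv closed by (simp add: B.a_minus_eq_smult B.smult_r_distr B.a_assoc)
    finally show ?thesis using uv closed by simp
  next
    fix c v assume v: "v \<in> V" and r: "r = Poly_Mapping.single [sc c v] 1 - Poly_Mapping.single [v] c"
    have [simp]: "sc c v \<in> V" using v subspace vs.subspace_scale by blast
    show ?thesis
      using v closed by (simp add: r diff diff_closed f_scale g_single f)
  qed
qed

end


section \<open>Exterior and symmetric algebras\<close>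

locale vector_subspace = vector_space sc
  for sc :: "complex \<Rightarrow> 'v::ab_group_add \<Rightarrow> 'v" +
  fixes V :: "'v set"
  assumes subspace: "subspace V"
begin

lemma free_algebra_diff_closed:
  "\<lbrakk>p \<in> carrier (free_algebra V); q \<in> carrier (free_algebra V)\<rbrakk> \<Longrightarrow> p - q \<in> carrier (free_algebra V)"
  using keys_diff[of p q] by (auto simp: free_algebra_simps)

lemma linear_relations_closed: "linear_relations sc V \<subseteq> carrier (free_algebra V)"
proof
  fix r assume "r \<in> linear_relations sc V"
  then show "r \<in> carrier (free_algebra V)"
    unfolding linear_relations_def
    by (elim UnE CollectE exE conjE, simp_all only:)
      (intro free_algebra_diff_closed; simp add: free_algebra_simps subspace_add[OF subspace]
        subspace_scale[OF subspace])+
qed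

lemma symmetric_relations_closed: "symmetric_relations sc V \<subseteq> carrier (free_algebra V)"
  unfolding symmetric_relations_def
  by (intro Un_least linear_relations_closed, clarify, intro free_algebra_diff_closed)
    (simp_all add: free_algebra_simps)

end

text \<open>A locale of its own, and likewise \<open>symmetric_space\<close> later:
  \<open>vector_subspace\<close> itself would otherwise become a presented algebra for two different
  sets of relations.\<close>

locale exterior_space = vector_subspace sc V
  for sc :: "complex \<Rightarrow> 'v::ab_group_add \<Rightarrow> 'v" and V :: "'v set"

sublocale exterior_space \<subseteq> presented_algebra sc V "exterior_relations sc V"
  by (intro presented_algebra.intro free_algebra_quotient.intro algebra_quotient.intro
      complex_algebra_free_algebra algebra_quotient_axioms.intro presented_algebra_axioms.intro
      vector_space_axioms subspace)
    (use linear_relations_closed in \<open>auto simp: exterior_relations_def free_algebra_simps\<close>)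

section \<open>Exterior algebra: parity involution, supercommutativity, contractions\<close>

context exterior_space
begin

lemma \<iota>_square:
  assumes "v \<in> V"
  shows "\<iota> v \<otimes>\<^bsub>Q\<^esub> \<iota> v = \<zero>\<^bsub>Q\<^esub>"
proof -
  have "Poly_Mapping.single [v, v] 1 \<in> exterior_relations sc V"
    using assms by (auto simp: exterior_relations_def)
  then show ?thesis
    using quotient_map_relation word_Cons[of v "[v]"] assms by (simp add: \<iota>_def)
qed

text \<open>Polarization: expand the vanishing square of the generator for u + v.\<close>

lemma \<iota>_anticommute:
  assumes [simp]: "u \<in> V" "v \<in> V"
  shows "\<iota> u \<otimes>\<^bsub>Q\<^esub> \<iota> v = (- 1) \<odot>\<^bsub>Q\<^esub> (\<iota> v \<otimes>\<^bsub>Q\<^esub> \<iota> u)"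
proof -
  have [simp]: "u + v \<in> V" using subspace subspace_add by simp
  have "(\<iota> u \<oplus>\<^bsub>Q\<^esub> \<iota> v) \<otimes>\<^bsub>Q\<^esub> (\<iota> u \<oplus>\<^bsub>Q\<^esub> \<iota> v) = \<zero>\<^bsub>Q\<^esub>"
    using \<iota>_square[of "u + v"] by (simp add: \<iota>_add)
  then have "\<iota> u \<otimes>\<^bsub>Q\<^esub> \<iota> v \<oplus>\<^bsub>Q\<^esub> \<iota> v \<otimes>\<^bsub>Q\<^esub> \<iota> u = \<zero>\<^bsub>Q\<^esub>"
    by (simp add: Q.l_distr Q.r_distr \<iota>_square Q.a_ac)
  then show ?thesis
    by (simp add: Q.minus_equality flip: Q.a_inv_eq_smult)
qed

text \<open>Negation of vectors respects the linear relations because it is linear, and the relation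
  \<open>[v, v]\<close> because the two signs cancel.\<close>

lemma parity_involution_exists:
  "\<exists>g. algebra_hom Q Q g \<and> (\<forall>v\<in>V. g (\<iota> v) = (- 1) \<odot>\<^bsub>Q\<^esub> \<iota> v)"
proof (rule algebra_hom_exists[OF Q.complex_algebra_axioms, of "\<lambda>v. (- 1) \<odot>\<^bsub>Q\<^esub> \<iota> v"])
  fix g r
  assume g: "algebra_hom (free_algebra V) Q g"
    and f: "\<And>v. v \<in> V \<Longrightarrow> g (Poly_Mapping.single [v] 1) = (- 1) \<odot>\<^bsub>Q\<^esub> \<iota> v"
    and "r \<in> exterior_relations sc V"
  then consider "r \<in> linear_relations sc V" | v where "v \<in> V" "r = Poly_Mapping.single [v, v] 1"
    by (auto simp: exterior_relations_def)
  then show "g r = \<zero>\<^bsub>Q\<^esub>"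
  proof cases
    case 1
    show ?thesis
      by (rule linear_relations_vanish[OF Q.complex_algebra_axioms algebra_hom_linear[OF g] f _ _ 1])
        (auto simp: \<iota>_add \<iota>_scale Q.smult_r_distr Q.smult_assoc)
  next
    case 2
    then show ?thesis
      using algebra_hom_mult[OF g, of "Poly_Mapping.single [v] 1" "Poly_Mapping.single [v] 1"]
      by (simp add: free_algebra_simps f Q.smult_mult_l Q.smult_mult_r \<iota>_square)
  qed
qed auto

definition \<sigma> :: "('v list \<Rightarrow>\<^sub>0 complex) set \<Rightarrow> ('v list \<Rightarrow>\<^sub>0 complex) set" where
  "\<sigma> = (SOME g. algebra_hom Q Q g \<and> (\<forall>v\<in>V. g (\<iota> v) = (- 1) \<odot>\<^bsub>Q\<^esub> \<iota> v))"

lemma \<sigma>_hom: "algebra_hom Q Q \<sigma>"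
  and \<sigma>_\<iota>: "v \<in> V \<Longrightarrow> \<sigma> (\<iota> v) = (- 1) \<odot>\<^bsub>Q\<^esub> \<iota> v"
  using someI_ex[OF parity_involution_exists] by (auto simp: \<sigma>_def)

lemmas \<sigma>_linear = algebra_hom_linear[OF \<sigma>_hom]
lemmas \<sigma>_simps [simp] = linear_map_closed[OF \<sigma>_linear] linear_map_add[OF \<sigma>_linear]
  linear_map_smult[OF \<sigma>_linear] algebra_hom_mult[OF \<sigma>_hom] algebra_hom_one[OF \<sigma>_hom]
  linear_map_zero[OF Q.complex_algebra_axioms Q.complex_algebra_axioms \<sigma>_linear]

lemma \<sigma>_word: "w \<in> lists V \<Longrightarrow> \<sigma> (word w) = (- 1) ^ length w \<odot>\<^bsub>Q\<^esub> word w"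
  by (induction w)
    (auto simp: word_Nil word_Cons \<sigma>_\<iota> Q.smult_mult_l Q.smult_mult_r Q.smult_assoc)

lemma \<sigma>_involution: "a \<in> carrier Q \<Longrightarrow> \<sigma> (\<sigma> a) = a"
  by (induction a rule: quotient_induct)
    (simp_all add: \<sigma>_\<iota> Q.smult_mult_l Q.smult_assoc)

abbreviation "parity_words p \<equiv> {w \<in> lists V. length w mod 2 = p mod 2}"

lemma exterior_parity_eq:
  "exterior_parity sc V p = \<pi> ` {q. Poly_Mapping.keys q \<subseteq> parity_words p}"
  by (simp add: exterior_parity_def)

lemma minus_one_power_cong: "m mod 2 = n mod 2 \<Longrightarrow> (- 1 :: complex) ^ m = (- 1) ^ n"
  by (metis even_iff_mod_2_eq_zero neg_one_even_power neg_one_odd_power)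

lemma minus_one_power_cancel: "(- 1) ^ p * (c * (- 1) ^ p) = (c :: complex)"
  by (cases "even p") auto

lemma exterior_parity_add:
  assumes "a \<in> exterior_parity sc V p" "b \<in> exterior_parity sc V p"
  shows "a \<oplus>\<^bsub>Q\<^esub> b \<in> exterior_parity sc V p"
proof -
  obtain x y where x: "Poly_Mapping.keys x \<subseteq> parity_words p" "a = \<pi> x"
    and y: "Poly_Mapping.keys y \<subseteq> parity_words p" "b = \<pi> y"
    using assms by (auto simp: exterior_parity_eq)
  have "\<pi> (x + y) = a \<oplus>\<^bsub>Q\<^esub> b"
    using x y quotient_map_add[of x y] by (auto simp: free_algebra_simps)
  then show ?thesis
    using keys_add_subset[OF x(1) y(1)] unfolding exterior_parity_eq
    by (intro image_eqI[of _ _ "x + y"]) simp_all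
qed

lemma exterior_parity_\<sigma>:
  assumes "a \<in> exterior_parity sc V p"
  shows "a \<in> carrier Q \<and> \<sigma> a = (- 1) ^ p \<odot>\<^bsub>Q\<^esub> a"
proof -
  obtain q where q: "Poly_Mapping.keys q \<subseteq> parity_words p" "a = \<pi> q"
    using assms by (auto simp: exterior_parity_eq)
  have "parity_words p \<subseteq> lists V" by auto
  with q(1) have "\<pi> q \<in> carrier Q \<and> \<sigma> (\<pi> q) = (- 1) ^ p \<odot>\<^bsub>Q\<^esub> \<pi> q"
  proof (induction q rule: quotient_map_keys_induct)
    case (add w c q)
    then have "\<sigma> (word w) = (- 1) ^ p \<odot>\<^bsub>Q\<^esub> word w"
      using minus_one_power_cong[of "length w" p] by (simp add: \<sigma>_word)
    then show ?case
      using add by (simp add: Q.smult_r_distr Q.smult_assoc mult.commute)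
  qed simp
  then show ?thesis using q by simp
qed

text \<open>The operator (1 + (-1)^p \<sigma>)/2 fixes the words whose length has the parity of p
  and kills the others, so its values are homogeneous. It is what later shows that every eigenvector
  of the parity involution is homogeneous.\<close>

lemma exterior_parity_projection:
  assumes "a \<in> carrier Q"
  shows "(1 / 2) \<odot>\<^bsub>Q\<^esub> (a \<oplus>\<^bsub>Q\<^esub> (- 1) ^ p \<odot>\<^bsub>Q\<^esub> \<sigma> a) \<in> exterior_parity sc V p"
    (is "?pr a \<in> ?G")
proof -
  have zero: "\<zero>\<^bsub>Q\<^esub> \<in> ?G"
  proof -
    have "\<pi> 0 = \<zero>\<^bsub>Q\<^esub>"
      using linear_map_zero[OF complex_algebra_axioms Q.complex_algebra_axioms
          algebra_hom_linear[OF quotient_map_hom]] by (simp add: free_algebra_simps)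
    then show ?thesis
      unfolding exterior_parity_eq by (intro image_eqI[of _ _ 0]) simp_all
  qed
  obtain q where q: "q \<in> carrier (free_algebra V)" "a = \<pi> q"
    using quotient_map_surj[OF assms] .
  then have "Poly_Mapping.keys q \<subseteq> lists V" by (simp add: free_algebra_simps)
  then have "?pr (\<pi> q) \<in> ?G"
    using subset_refl[of "lists V"]
  proof (induction q rule: quotient_map_keys_induct)
    case (add w c q)
    have [simp]: "\<pi> q \<in> carrier Q" "word w \<in> carrier Q" "\<sigma> (word w) \<in> carrier Q"
      using add by (auto simp: free_algebra_simps)
    have "?pr (c \<odot>\<^bsub>Q\<^esub> word w) \<in> ?G"
    proof (cases "length w mod 2 = p mod 2")
      case True
      have "(- 1) ^ p \<odot>\<^bsub>Q\<^esub> \<sigma> (c \<odot>\<^bsub>Q\<^esub> word w) = c \<odot>\<^bsub>Q\<^esub> word w"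
        using add minus_one_power_cong[OF True]
        by (simp add: \<sigma>_word Q.smult_assoc minus_one_power_cancel)
      then have "?pr (c \<odot>\<^bsub>Q\<^esub> word w) = c \<odot>\<^bsub>Q\<^esub> word w"
        by (simp add: Q.smult_assoc flip: Q.smult_l_distr)
      moreover have "c \<odot>\<^bsub>Q\<^esub> word w \<in> ?G"
        using add True unfolding exterior_parity_eq
        by (intro image_eqI[of _ _ "Poly_Mapping.single w c"]) (auto simp: quotient_map_single[of w c])
      ultimately show ?thesis by simp
    next
      case False
      \<comment> \<open>With opposite parities the two signs multiply to -1, and the two summands of
        the projector cancel.\<close>
      then have "(length w + p) mod 2 = 1" by presburger
      then have "(- 1) ^ p \<odot>\<^bsub>Q\<^esub> \<sigma> (c \<odot>\<^bsub>Q\<^esub> word w) = (- c) \<odot>\<^bsub>Q\<^esub> word w"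
        using add minus_one_power_cong[of "length w + p" 1]
        by (simp add: \<sigma>_word Q.smult_assoc power_add mult.commute mult.left_commute)
      then show ?thesis
        using zero by (simp flip: Q.smult_l_distr)
    qed
    moreover have "?pr (c \<odot>\<^bsub>Q\<^esub> word w \<oplus>\<^bsub>Q\<^esub> \<pi> q) = ?pr (c \<odot>\<^bsub>Q\<^esub> word w) \<oplus>\<^bsub>Q\<^esub> ?pr (\<pi> q)"
      by (simp add: Q.smult_r_distr Q.a_ac)
    ultimately show ?case
      using exterior_parity_add add by simp
  qed (simp add: zero)
  then show ?thesis using q by simp
qed

text \<open>Moving one letter u through w' costs one sign per letter of w' (the inner induction);
  the outer induction moves the letters of w one after the other.\<close>

lemma word_supercommute:
  assumes w': "w' \<in> lists V" and w: "w \<in> lists V"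
  shows "word w \<otimes>\<^bsub>Q\<^esub> word w' = (- 1) ^ (length w * length w') \<odot>\<^bsub>Q\<^esub> (word w' \<otimes>\<^bsub>Q\<^esub> word w)"
  using w
proof (induction w)
  case Nil
  then show ?case using w' by (simp add: word_Nil)
next
  case (Cons u w)
  have u: "\<iota> u \<otimes>\<^bsub>Q\<^esub> word w' = (- 1) ^ length w' \<odot>\<^bsub>Q\<^esub> (word w' \<otimes>\<^bsub>Q\<^esub> \<iota> u)"
    using w'
  proof (induction w')
    case Nil
    then show ?case using Cons by (simp add: word_Nil)
  next
    case (Cons v w')
    have [simp]: "u \<in> V" "v \<in> V" "w' \<in> lists V"
      using Cons \<open>u \<in> V\<close> by auto
    have "\<iota> u \<otimes>\<^bsub>Q\<^esub> (\<iota> v \<otimes>\<^bsub>Q\<^esub> word w') = (- 1) \<odot>\<^bsub>Q\<^esub> (\<iota> v \<otimes>\<^bsub>Q\<^esub> (\<iota> u \<otimes>\<^bsub>Q\<^esub> word w'))"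
      using \<iota>_anticommute[of u v] by (simp add: Q.smult_mult_l flip: Q.m_assoc)
    also have "\<dots> = (- 1) ^ length (v # w') \<odot>\<^bsub>Q\<^esub> ((\<iota> v \<otimes>\<^bsub>Q\<^esub> word w') \<otimes>\<^bsub>Q\<^esub> \<iota> u)"
      using Cons by (simp add: Q.smult_mult_r Q.smult_assoc Q.m_assoc)
    finally show ?case by (simp add: word_Cons)
  qed
  have [simp]: "u \<in> V" "w \<in> lists V" using Cons by auto
  have "word (u # w) \<otimes>\<^bsub>Q\<^esub> word w' = \<iota> u \<otimes>\<^bsub>Q\<^esub> (word w \<otimes>\<^bsub>Q\<^esub> word w')"
    using w' by (simp add: word_Cons Q.m_assoc)
  also have "\<dots> = (- 1) ^ (length w * length w') \<odot>\<^bsub>Q\<^esub> ((\<iota> u \<otimes>\<^bsub>Q\<^esub> word w') \<otimes>\<^bsub>Q\<^esub> word w)"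
    using w' Cons by (simp add: Q.smult_mult_r Q.m_assoc)
  also have "\<dots> = (- 1) ^ (length (u # w) * length w') \<odot>\<^bsub>Q\<^esub> (word w' \<otimes>\<^bsub>Q\<^esub> word (u # w))"
    using w' unfolding u by (simp add: Q.smult_mult_l Q.smult_assoc Q.m_assoc word_Cons power_add mult.commute)
  finally show ?case .
qed

lemma exterior_supercommute:
  assumes "a \<in> exterior_parity sc V p" "b \<in> exterior_parity sc V q"
  shows "a \<otimes>\<^bsub>Q\<^esub> b = (- 1) ^ (p * q) \<odot>\<^bsub>Q\<^esub> (b \<otimes>\<^bsub>Q\<^esub> a)"
proof -
  obtain x y where x: "Poly_Mapping.keys x \<subseteq> parity_words p" "a = \<pi> x"
    and y: "Poly_Mapping.keys y \<subseteq> parity_words q" "b = \<pi> y"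
    using assms by (auto simp: exterior_parity_eq)
  have sub: "parity_words m \<subseteq> lists V" for m by auto
  have [simp]: "b \<in> carrier Q" using assms(2) exterior_parity_\<sigma> by blast
  have 1: "word w \<otimes>\<^bsub>Q\<^esub> \<pi> y = (- 1) ^ (p * q) \<odot>\<^bsub>Q\<^esub> (\<pi> y \<otimes>\<^bsub>Q\<^esub> word w)"
    if w: "w \<in> parity_words p" for w
    using y(1) sub
  proof (induction y rule: quotient_map_keys_induct)
    case (add w' c y)
    have [simp]: "w \<in> lists V" "w' \<in> lists V" "\<pi> y \<in> carrier Q"
      using w add exterior_parity_\<sigma>[of "\<pi> y" q] by (auto simp: exterior_parity_eq)
    \<comment> \<open>The lengths agree with p and q only modulo 2, but the sign sees no more than
      the parity of their product.\<close>
    have "length w * length w' mod 2 = p * q mod 2"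
      using w add by (intro mod_mult_cong) auto
    then have "word w \<otimes>\<^bsub>Q\<^esub> word w' = (- 1) ^ (p * q) \<odot>\<^bsub>Q\<^esub> (word w' \<otimes>\<^bsub>Q\<^esub> word w)"
      using word_supercommute[of w' w] minus_one_power_cong[of "length w * length w'" "p * q"] by simp
    then show ?case
      using add by (simp add: Q.l_distr Q.r_distr Q.smult_mult_l Q.smult_mult_r Q.smult_assoc
          Q.smult_r_distr mult.commute)
  qed (use w in simp)
  have "\<pi> x \<otimes>\<^bsub>Q\<^esub> b = (- 1) ^ (p * q) \<odot>\<^bsub>Q\<^esub> (b \<otimes>\<^bsub>Q\<^esub> \<pi> x)"
    using x(1) sub
  proof (induction x rule: quotient_map_keys_induct)
    case (add w c x)
    have [simp]: "w \<in> lists V" "\<pi> x \<in> carrier Q"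
      using add exterior_parity_\<sigma>[of "\<pi> x" p] by (auto simp: exterior_parity_eq)
    show ?case
      using add 1[OF add(1), folded y(2)] by (simp add: Q.l_distr Q.r_distr Q.smult_mult_l Q.smult_mult_r
          Q.smult_assoc Q.smult_r_distr mult.commute)
  qed simp
  then show ?thesis using x by simp
qed

text \<open>Interior multiplication by the functional \<epsilon>. The twist by
  \<open>\<sigma>\<close> is what makes it well defined: on \<open>[v, v]\<close> the Leibniz rule
  gives \<epsilon>(v) v - \<epsilon>(v) v = 0.\<close>

lemma contraction_exists:
  assumes add: "\<And>u v. \<lbrakk>u \<in> V; v \<in> V\<rbrakk> \<Longrightarrow> \<epsilon> (u + v) = \<epsilon> u + \<epsilon> v"
    and scale: "\<And>c v. v \<in> V \<Longrightarrow> \<epsilon> (sc c v) = c * \<epsilon> v"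
  obtains D where "twisted_derivation Q Q \<sigma> (\<lambda>x. x) D"
    and "\<And>v. v \<in> V \<Longrightarrow> D (\<iota> v) = \<epsilon> v \<odot>\<^bsub>Q\<^esub> \<one>\<^bsub>Q\<^esub>"
proof (rule twisted_derivation_exists[OF Q.complex_algebra_axioms, of "\<lambda>v. \<epsilon> v \<odot>\<^bsub>Q\<^esub> \<one>\<^bsub>Q\<^esub>" \<sigma> "\<lambda>x. x"])
  fix g r
  assume g: "twisted_derivation (free_algebra V) Q (\<lambda>x. \<sigma> (\<pi> x)) (\<lambda>x. \<pi> x) g"
    and d: "\<And>v. v \<in> V \<Longrightarrow> g (Poly_Mapping.single [v] 1) = \<epsilon> v \<odot>\<^bsub>Q\<^esub> \<one>\<^bsub>Q\<^esub>"
    and "r \<in> exterior_relations sc V"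
  then consider "r \<in> linear_relations sc V" | v where "v \<in> V" "r = Poly_Mapping.single [v, v] 1"
    by (auto simp: exterior_relations_def)
  then show "g r = \<zero>\<^bsub>Q\<^esub>"
  proof cases
    case 1
    show ?thesis
      by (rule linear_relations_vanish[OF Q.complex_algebra_axioms twisted_derivation_linear[OF g] d _ _ 1])
        (auto simp: add scale Q.smult_l_distr Q.smult_assoc)
  next
    case 2
    then have "\<sigma> (word [v]) = (- 1) \<odot>\<^bsub>Q\<^esub> word [v]"
      using \<sigma>_\<iota> by (simp add: \<iota>_def)
    then show ?thesis
      using 2 twisted_derivation_mult[OF g, of "Poly_Mapping.single [v] 1" "Poly_Mapping.single [v] 1"]
      by (simp add: free_algebra_simps d Q.smult_mult_l Q.smult_mult_r Q.smult_assoc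
          flip: Q.smult_l_distr)
  qed
qed (use \<sigma>_hom Q.linear_map_id in \<open>auto simp: algebra_hom_def\<close>)

text \<open>A contraction lowers the degree by one, hence anticommutes with the parity involution.
  In the induction the sign arises because the value on a generator is a scalar, fixed by
  \<open>\<sigma>\<close>, while the generator itself changes sign.\<close>

lemma contraction_parity:
  assumes D: "twisted_derivation Q Q \<sigma> (\<lambda>x. x) D"
    and d: "\<And>v. v \<in> V \<Longrightarrow> D (\<iota> v) = \<epsilon> v \<odot>\<^bsub>Q\<^esub> \<one>\<^bsub>Q\<^esub>"
    and "a \<in> carrier Q"
  shows "\<sigma> (D a) = (- 1) \<odot>\<^bsub>Q\<^esub> D (\<sigma> a)"
proof -
  note D_linear = twisted_derivation_linear[OF D]
  note D_simps [simp] = linear_map_closed[OF D_linear] linear_map_add[OF D_linear]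
    linear_map_smult[OF D_linear] twisted_derivation_mult[OF D]
    linear_map_zero[OF Q.complex_algebra_axioms Q.complex_algebra_axioms D_linear]
  have one: "D \<one>\<^bsub>Q\<^esub> = \<zero>\<^bsub>Q\<^esub>"
    using D_simps(4)[of "\<one>\<^bsub>Q\<^esub>" "\<one>\<^bsub>Q\<^esub>"] by (simp del: D_simps(4))
  show ?thesis
    using assms(3)
  proof (induction a rule: quotient_induct)
    case (mult v a)
    then show ?case
      by (simp add: d \<sigma>_\<iota> Q.smult_mult_l Q.smult_mult_r Q.smult_assoc Q.smult_r_distr mult.commute)
  qed (simp_all add: one Q.smult_r_distr Q.smult_assoc)
qed

end

locale symmetric_space = vector_subspace sc V
  for sc :: "complex \<Rightarrow> 'v::ab_group_add \<Rightarrow> 'v" and V :: "'v set"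

sublocale symmetric_space \<subseteq> presented_algebra sc V "symmetric_relations sc V"
  by (intro presented_algebra.intro free_algebra_quotient.intro algebra_quotient.intro
      complex_algebra_free_algebra algebra_quotient_axioms.intro presented_algebra_axioms.intro
      vector_space_axioms subspace)
    (use symmetric_relations_closed in \<open>auto simp: symmetric_relations_def\<close>)

section \<open>Symmetric algebra: commutativity and directional derivatives\<close>

context symmetric_space
begin

lemma \<iota>_commute:
  assumes "u \<in> V" "v \<in> V"
  shows "\<iota> u \<otimes>\<^bsub>Q\<^esub> \<iota> v = \<iota> v \<otimes>\<^bsub>Q\<^esub> \<iota> u"
proof -
  have "\<pi> (Poly_Mapping.single [u, v] 1 - Poly_Mapping.single [v, u] 1) = \<zero>\<^bsub>Q\<^esub>"
    using assms by (intro quotient_map_relation) (auto simp: symmetric_relations_def)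
  then have "word [u, v] = word [v, u]"
    using assms by (simp add: linear_map_free_algebra_diff[OF Q.complex_algebra_axioms
          algebra_hom_linear[OF quotient_map_hom]])
  then show ?thesis
    using assms word_Cons[of u "[v]"] word_Cons[of v "[u]"] by (simp add: \<iota>_def)
qed

text \<open>Commutation spreads from pairs of generators first to one generator and an arbitrary b,
  by induction on b, and then to arbitrary a.\<close>

lemma symmetric_commute:
  assumes "a \<in> carrier Q" and b: "b \<in> carrier Q"
  shows "a \<otimes>\<^bsub>Q\<^esub> b = b \<otimes>\<^bsub>Q\<^esub> a"
  using assms(1)
proof (induction a rule: quotient_induct)
  case (mult u a)
  have [simp]: "u \<in> V" using mult by simp
  have "\<iota> u \<otimes>\<^bsub>Q\<^esub> b = b \<otimes>\<^bsub>Q\<^esub> \<iota> u"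
    using b
  proof (induction b rule: quotient_induct)
    case (mult v b)
    have "\<iota> u \<otimes>\<^bsub>Q\<^esub> (\<iota> v \<otimes>\<^bsub>Q\<^esub> b) = \<iota> v \<otimes>\<^bsub>Q\<^esub> (\<iota> u \<otimes>\<^bsub>Q\<^esub> b)"
      using mult.hyps \<iota>_commute[of u v] by (simp flip: Q.m_assoc)
    then show ?case
      using mult by (simp add: Q.m_assoc)
  qed (auto simp: Q.l_distr Q.r_distr Q.smult_mult_l Q.smult_mult_r)
  then have "b \<otimes>\<^bsub>Q\<^esub> (\<iota> u \<otimes>\<^bsub>Q\<^esub> a) = \<iota> u \<otimes>\<^bsub>Q\<^esub> (b \<otimes>\<^bsub>Q\<^esub> a)"
    using mult b by (simp flip: Q.m_assoc)
  then show ?case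
    using mult b by (simp add: Q.m_assoc)
qed (use b in \<open>auto simp: Q.l_distr Q.r_distr Q.smult_mult_l Q.smult_mult_r\<close>)

text \<open>The value on a word of two letters x, y is \<epsilon>(x) y + \<epsilon>(y) x, which is
  symmetric in x and y, so the commutator relations are killed.\<close>

lemma derivation_exists:
  assumes add: "\<And>u v. \<lbrakk>u \<in> V; v \<in> V\<rbrakk> \<Longrightarrow> \<epsilon> (u + v) = \<epsilon> u + \<epsilon> v"
    and scale: "\<And>c v. v \<in> V \<Longrightarrow> \<epsilon> (sc c v) = c * \<epsilon> v"
  obtains D where "twisted_derivation Q Q (\<lambda>x. x) (\<lambda>x. x) D"
    and "\<And>v. v \<in> V \<Longrightarrow> D (\<iota> v) = \<epsilon> v \<odot>\<^bsub>Q\<^esub> \<one>\<^bsub>Q\<^esub>"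
proof (rule twisted_derivation_exists[OF Q.complex_algebra_axioms, of "\<lambda>v. \<epsilon> v \<odot>\<^bsub>Q\<^esub> \<one>\<^bsub>Q\<^esub>" "\<lambda>x. x" "\<lambda>x. x"])
  fix g r
  assume g: "twisted_derivation (free_algebra V) Q (\<lambda>x. \<pi> x) (\<lambda>x. \<pi> x) g"
    and d: "\<And>v. v \<in> V \<Longrightarrow> g (Poly_Mapping.single [v] 1) = \<epsilon> v \<odot>\<^bsub>Q\<^esub> \<one>\<^bsub>Q\<^esub>"
    and "r \<in> symmetric_relations sc V"
  then consider "r \<in> linear_relations sc V"
    | u v where "u \<in> V" "v \<in> V" "r = Poly_Mapping.single [u, v] 1 - Poly_Mapping.single [v, u] 1"
    by (auto simp: symmetric_relations_def)
  then show "g r = \<zero>\<^bsub>Q\<^esub>"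
  proof cases
    case 1
    show ?thesis
      by (rule linear_relations_vanish[OF Q.complex_algebra_axioms twisted_derivation_linear[OF g] d _ _ 1])
        (auto simp: add scale Q.smult_l_distr Q.smult_assoc)
  next
    case 2
    have "g (Poly_Mapping.single [x, y] 1) = \<epsilon> x \<odot>\<^bsub>Q\<^esub> \<iota> y \<oplus>\<^bsub>Q\<^esub> \<epsilon> y \<odot>\<^bsub>Q\<^esub> \<iota> x"
      if "x \<in> V" "y \<in> V" for x y
      using that twisted_derivation_mult[OF g, of "Poly_Mapping.single [x] 1" "Poly_Mapping.single [y] 1"]
      by (simp add: free_algebra_simps d Q.smult_mult_l Q.smult_mult_r \<iota>_def)
    with 2 show ?thesis
      by (simp add: linear_map_free_algebra_diff[OF Q.complex_algebra_axioms twisted_derivation_linear[OF g]]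
          Q.a_comm)
  qed
qed (use Q.linear_map_id in \<open>auto simp: algebra_hom_def\<close>)

end


section \<open>Tensor products of algebras\<close>

locale tensor_product = A: complex_algebra A + B: complex_algebra B
  for A :: "(complex, 'm) module" and B :: "(complex, 'k) module"
begin

abbreviation "P \<equiv> monoid_algebra (A \<times>\<times> B)"

lemma monoid_DirProd: "monoid (A \<times>\<times> B)"
  by (rule DirProd_monoid[OF A.monoid_axioms B.monoid_axioms])

lemma single_pair_closed [simp]:
  "\<lbrakk>a \<in> carrier A; b \<in> carrier B\<rbrakk> \<Longrightarrow> Poly_Mapping.single (a, b) c \<in> carrier P"
  by (simp add: monoid_algebra_simps)

lemma bilinear_relations_cases:
  assumes "r \<in> bilinear_relations A B"
  obtains
    (add_l) a a' b where "a \<in> carrier A" "a' \<in> carrier A" "b \<in> carrier B"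
      "r = Poly_Mapping.single (a \<oplus>\<^bsub>A\<^esub> a', b) 1 - Poly_Mapping.single (a, b) 1 - Poly_Mapping.single (a', b) 1"
  | (add_r) a b b' where "a \<in> carrier A" "b \<in> carrier B" "b' \<in> carrier B"
      "r = Poly_Mapping.single (a, b \<oplus>\<^bsub>B\<^esub> b') 1 - Poly_Mapping.single (a, b) 1 - Poly_Mapping.single (a, b') 1"
  | (smult_l) c a b where "a \<in> carrier A" "b \<in> carrier B"
      "r = Poly_Mapping.single (c \<odot>\<^bsub>A\<^esub> a, b) 1 - Poly_Mapping.single (a, b) c"
  | (smult_r) c a b where "a \<in> carrier A" "b \<in> carrier B"
      "r = Poly_Mapping.single (a, c \<odot>\<^bsub>B\<^esub> b) 1 - Poly_Mapping.single (a, b) c"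
  using assms unfolding bilinear_relations_def
  by (elim UnE CollectE exE conjE) (rule that; assumption)+

lemma bilinear_relations_intros:
  shows bilinear_relations_add_l: "\<lbrakk>a \<in> carrier A; a' \<in> carrier A; b \<in> carrier B\<rbrakk> \<Longrightarrow>
      Poly_Mapping.single (a \<oplus>\<^bsub>A\<^esub> a', b) 1 - Poly_Mapping.single (a, b) 1 - Poly_Mapping.single (a', b) 1
        \<in> bilinear_relations A B"
    and bilinear_relations_add_r: "\<lbrakk>a \<in> carrier A; b \<in> carrier B; b' \<in> carrier B\<rbrakk> \<Longrightarrow>
      Poly_Mapping.single (a, b \<oplus>\<^bsub>B\<^esub> b') 1 - Poly_Mapping.single (a, b) 1 - Poly_Mapping.single (a, b') 1
        \<in> bilinear_relations A B"
    and bilinear_relations_smult_l: "\<lbrakk>a \<in> carrier A; b \<in> carrier B\<rbrakk> \<Longrightarrow>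
      Poly_Mapping.single (c \<odot>\<^bsub>A\<^esub> a, b) 1 - Poly_Mapping.single (a, b) c \<in> bilinear_relations A B"
    and bilinear_relations_smult_r: "\<lbrakk>a \<in> carrier A; b \<in> carrier B\<rbrakk> \<Longrightarrow>
      Poly_Mapping.single (a, c \<odot>\<^bsub>B\<^esub> b) 1 - Poly_Mapping.single (a, b) c \<in> bilinear_relations A B"
  unfolding bilinear_relations_def by blast+

lemma bilinear_relations_closed: "bilinear_relations A B \<subseteq> carrier P"
proof
  fix r assume "r \<in> bilinear_relations A B"
  then show "r \<in> carrier P"
    by (cases rule: bilinear_relations_cases)
      (simp_all add: monoid_algebra_diff_closed)
qed

sublocale T: algebra_quotient P "bilinear_relations A B"
  by (intro algebra_quotient.intro algebra_quotient_axioms.intro bilinear_relations_closed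
      monoid.complex_algebra_monoid_algebra monoid_DirProd)

text \<open>Multiplication by a fixed pair acts linearly on each entry, so it turns a relation into
  a relation of the same kind with other entries.\<close>

lemma bilinear_relations_mult_single:
  assumes "r \<in> bilinear_relations A B" and [simp]: "a0 \<in> carrier A" "b0 \<in> carrier B"
  shows "r \<otimes>\<^bsub>P\<^esub> Poly_Mapping.single (a0, b0) 1 \<in> bilinear_relations A B"
    and "Poly_Mapping.single (a0, b0) 1 \<otimes>\<^bsub>P\<^esub> r \<in> bilinear_relations A B"
  using assms(1)
  by (cases rule: bilinear_relations_cases;
      simp add: monoid_algebra_mult_diff A.l_distr A.r_distr B.l_distr B.r_distr A.smult_mult_l
        A.smult_mult_r B.smult_mult_l B.smult_mult_r bilinear_relations_intros)+

text \<open>The relations being stable under multiplication by pairs, the elements killed by every linear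
  map that kills the relations form an ideal.\<close>

lemma linear_map_bilinear_ideal:
  assumes C: "complex_algebra C" and "linear_map P C f"
    and "\<And>r. r \<in> bilinear_relations A B \<Longrightarrow> f r = \<zero>\<^bsub>C\<^esub>"
    and "t \<in> genideal P (bilinear_relations A B)"
  shows "f t = \<zero>\<^bsub>C\<^esub>"
proof -
  interpret C: complex_algebra C by fact
  define Z where "Z f \<longleftrightarrow> linear_map P C f \<and> (\<forall>r\<in>bilinear_relations A B. f r = \<zero>\<^bsub>C\<^esub>)" for f
  \<comment> \<open>The kernel of a single linear map need not be an ideal. Quantifying over all of
    \<open>Z\<close> repairs this, because \<open>Z\<close> is stable under composition with
    multiplication by a monomial from either side.\<close>
  define K where "K = {t \<in> carrier P. \<forall>f. Z f \<longrightarrow> f t = \<zero>\<^bsub>C\<^esub>}"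
  have lin: "linear_map P C f" if "Z f" for f
    using that by (simp add: Z_def)
  have Z_mult: "Z (\<lambda>t. f (t \<otimes>\<^bsub>P\<^esub> Poly_Mapping.single x 1))" "Z (\<lambda>t. f (Poly_Mapping.single x 1 \<otimes>\<^bsub>P\<^esub> t))"
    if "Z f" and x: "x \<in> carrier (A \<times>\<times> B)" for f x
  proof -
    obtain a b where [simp]: "x = (a, b)" "a \<in> carrier A" "b \<in> carrier B"
      using x by auto
    show "Z (\<lambda>t. f (t \<otimes>\<^bsub>P\<^esub> Poly_Mapping.single x 1))" "Z (\<lambda>t. f (Poly_Mapping.single x 1 \<otimes>\<^bsub>P\<^esub> t))"
      using \<open>Z f\<close> bilinear_relations_mult_single
        linear_map_compose[OF T.linear_map_mult_l[OF T.linear_map_id], of "Poly_Mapping.single x 1" C f]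
        linear_map_compose[OF T.linear_map_mult_r[OF T.linear_map_id], of "Poly_Mapping.single x 1" C f]
      by (simp_all add: Z_def)
  qed
  have mult: "f (t \<otimes>\<^bsub>P\<^esub> u) = \<zero>\<^bsub>C\<^esub>" "f (u \<otimes>\<^bsub>P\<^esub> t) = \<zero>\<^bsub>C\<^esub>" if t: "t \<in> K" and u: "u \<in> carrier P" and f: "Z f" for t u f
  proof -
    have "t \<in> carrier P" using t by (simp add: K_def)
    show "f (t \<otimes>\<^bsub>P\<^esub> u) = \<zero>\<^bsub>C\<^esub>"
      using u
    proof (rule C.linear_map_monoid_algebra_eqI[OF monoid_DirProd, rotated -1])
      show "linear_map P C (\<lambda>u. f (t \<otimes>\<^bsub>P\<^esub> u))"
        by (rule linear_map_compose[OF T.linear_map_mult_r[OF T.linear_map_id \<open>t \<in> carrier P\<close>] lin[OF f]])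
      show "f (t \<otimes>\<^bsub>P\<^esub> Poly_Mapping.single x 1) = \<zero>\<^bsub>C\<^esub>" if "x \<in> carrier (A \<times>\<times> B)" for x
        using t Z_mult(1)[OF f that] unfolding K_def by blast
    qed (rule C.linear_map_const_zero)
    show "f (u \<otimes>\<^bsub>P\<^esub> t) = \<zero>\<^bsub>C\<^esub>"
      using u
    proof (rule C.linear_map_monoid_algebra_eqI[OF monoid_DirProd, rotated -1])
      show "linear_map P C (\<lambda>u. f (u \<otimes>\<^bsub>P\<^esub> t))"
        by (rule linear_map_compose[OF T.linear_map_mult_l[OF T.linear_map_id \<open>t \<in> carrier P\<close>] lin[OF f]])
      show "f (Poly_Mapping.single x 1 \<otimes>\<^bsub>P\<^esub> t) = \<zero>\<^bsub>C\<^esub>" if "x \<in> carrier (A \<times>\<times> B)" for x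
        using t Z_mult(2)[OF f that] unfolding K_def by blast
    qed (rule C.linear_map_const_zero)
  qed
  have "ideal K P"
  proof (rule T.idealI_linear)
    show "\<zero>\<^bsub>P\<^esub> \<in> K"
      unfolding K_def
      using linear_map_zero[OF T.complex_algebra_axioms C lin] by simp
  next
    fix x y assume xy: "x \<in> K" "y \<in> K"
    then have closed: "x \<in> carrier P" "y \<in> carrier P" by (simp_all add: K_def)
    have "f (x \<oplus>\<^bsub>P\<^esub> y) = \<zero>\<^bsub>C\<^esub>" if f: "Z f" for f
    proof -
      have "f x = \<zero>\<^bsub>C\<^esub>" "f y = \<zero>\<^bsub>C\<^esub>"
        using xy f unfolding K_def by blast+
      then show ?thesis
        using linear_map_add[OF lin[OF f] closed] by simp
    qed
    then show "x \<oplus>\<^bsub>P\<^esub> y \<in> K"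
      using closed by (simp add: K_def)
  next
    fix x y assume xy: "x \<in> K" "y \<in> carrier P"
    then have "x \<in> carrier P" by (simp add: K_def)
    then show "x \<otimes>\<^bsub>P\<^esub> y \<in> K" "y \<otimes>\<^bsub>P\<^esub> x \<in> K"
      unfolding K_def using mult[OF xy] xy(2) by simp_all
  qed (auto simp: K_def linear_map_smult[OF lin])
  moreover have "bilinear_relations A B \<subseteq> K"
    using bilinear_relations_closed by (auto simp: K_def Z_def)
  ultimately have "genideal P (bilinear_relations A B) \<subseteq> K"
    by (rule T.genideal_minimal)
  moreover have "Z f"
    using assms by (simp add: Z_def)
  ultimately show ?thesis
    using assms(4) by (auto simp: K_def)
qed

section \<open>Pure tensors and maps of tensor products\<close>

definition tensor :: "'m \<Rightarrow> 'k \<Rightarrow> ('m \<times> 'k \<Rightarrow>\<^sub>0 complex) set" (infixl \<open>\<otimes>\<^sub>t\<close> 70) where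
  "a \<otimes>\<^sub>t b = T.\<pi> (Poly_Mapping.single (a, b) 1)"

lemma tensor_closed [simp]: "\<lbrakk>a \<in> carrier A; b \<in> carrier B\<rbrakk> \<Longrightarrow> a \<otimes>\<^sub>t b \<in> carrier T.Q"
  by (simp add: tensor_def)

lemma quotient_map_single_pair:
  "\<lbrakk>a \<in> carrier A; b \<in> carrier B\<rbrakk> \<Longrightarrow> T.\<pi> (Poly_Mapping.single (a, b) c) = c \<odot>\<^bsub>T.Q\<^esub> (a \<otimes>\<^sub>t b)"
  using T.quotient_map_smult[of "Poly_Mapping.single (a, b) 1" c]
  by (simp add: tensor_def monoid_algebra_simps)

lemma tensor_bilinear:
  shows tensor_add_l: "\<lbrakk>a \<in> carrier A; a' \<in> carrier A; b \<in> carrier B\<rbrakk> \<Longrightarrow>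
      (a \<oplus>\<^bsub>A\<^esub> a') \<otimes>\<^sub>t b = (a \<otimes>\<^sub>t b) \<oplus>\<^bsub>T.Q\<^esub> (a' \<otimes>\<^sub>t b)"
    and tensor_add_r: "\<lbrakk>a \<in> carrier A; b \<in> carrier B; b' \<in> carrier B\<rbrakk> \<Longrightarrow>
      a \<otimes>\<^sub>t (b \<oplus>\<^bsub>B\<^esub> b') = (a \<otimes>\<^sub>t b) \<oplus>\<^bsub>T.Q\<^esub> (a \<otimes>\<^sub>t b')"
    and tensor_smult_l: "\<lbrakk>a \<in> carrier A; b \<in> carrier B\<rbrakk> \<Longrightarrow> (c \<odot>\<^bsub>A\<^esub> a) \<otimes>\<^sub>t b = c \<odot>\<^bsub>T.Q\<^esub> (a \<otimes>\<^sub>t b)"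
    and tensor_smult_r: "\<lbrakk>a \<in> carrier A; b \<in> carrier B\<rbrakk> \<Longrightarrow> a \<otimes>\<^sub>t (c \<odot>\<^bsub>B\<^esub> b) = c \<odot>\<^bsub>T.Q\<^esub> (a \<otimes>\<^sub>t b)"
proof -
  note diff = linear_map_monoid_algebra_diff[OF monoid_DirProd T.Q.complex_algebra_axioms
      algebra_hom_linear[OF T.quotient_map_hom]]
  have three: "x = y \<oplus>\<^bsub>T.Q\<^esub> z" if "x \<ominus>\<^bsub>T.Q\<^esub> y \<ominus>\<^bsub>T.Q\<^esub> z = \<zero>\<^bsub>T.Q\<^esub>"
    "x \<in> carrier T.Q" "y \<in> carrier T.Q" "z \<in> carrier T.Q" for x y z
  proof -
    have "x \<ominus>\<^bsub>T.Q\<^esub> (y \<oplus>\<^bsub>T.Q\<^esub> z) = \<zero>\<^bsub>T.Q\<^esub>"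
      using that by (simp add: T.Q.a_minus_eq_smult T.Q.smult_r_distr T.Q.a_assoc)
    then show ?thesis using that by simp
  qed
  note rel = bilinear_relations_intros[THEN T.quotient_map_relation]
  show "(a \<oplus>\<^bsub>A\<^esub> a') \<otimes>\<^sub>t b = (a \<otimes>\<^sub>t b) \<oplus>\<^bsub>T.Q\<^esub> (a' \<otimes>\<^sub>t b)"
    if "a \<in> carrier A" "a' \<in> carrier A" "b \<in> carrier B"
    using rel(1)[OF that] that by (intro three) (simp_all add: tensor_def diff monoid_algebra_diff_closed)
  show "a \<otimes>\<^sub>t (b \<oplus>\<^bsub>B\<^esub> b') = (a \<otimes>\<^sub>t b) \<oplus>\<^bsub>T.Q\<^esub> (a \<otimes>\<^sub>t b')"
    if "a \<in> carrier A" "b \<in> carrier B" "b' \<in> carrier B"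
    using rel(2)[OF that] that by (intro three) (simp_all add: tensor_def diff monoid_algebra_diff_closed)
  show "(c \<odot>\<^bsub>A\<^esub> a) \<otimes>\<^sub>t b = c \<odot>\<^bsub>T.Q\<^esub> (a \<otimes>\<^sub>t b)" if "a \<in> carrier A" "b \<in> carrier B"
    using rel(3)[OF that, of c] that quotient_map_single_pair[OF that, of c]
    by (simp add: diff) (simp add: tensor_def)
  show "a \<otimes>\<^sub>t (c \<odot>\<^bsub>B\<^esub> b) = c \<odot>\<^bsub>T.Q\<^esub> (a \<otimes>\<^sub>t b)" if "a \<in> carrier A" "b \<in> carrier B"
    using rel(4)[OF that, of c] that quotient_map_single_pair[OF that, of c]
    by (simp add: diff) (simp add: tensor_def)
qed

lemma tensor_mult:
  "\<lbrakk>a \<in> carrier A; b \<in> carrier B; a' \<in> carrier A; b' \<in> carrier B\<rbrakk> \<Longrightarrow>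
     (a \<otimes>\<^sub>t b) \<otimes>\<^bsub>T.Q\<^esub> (a' \<otimes>\<^sub>t b') = (a \<otimes>\<^bsub>A\<^esub> a') \<otimes>\<^sub>t (b \<otimes>\<^bsub>B\<^esub> b')"
  by (simp add: tensor_def flip: T.quotient_map_mult)

lemma tensor_one: "\<one>\<^bsub>A\<^esub> \<otimes>\<^sub>t \<one>\<^bsub>B\<^esub> = \<one>\<^bsub>T.Q\<^esub>"
  using T.quotient_map_one by (simp add: tensor_def monoid_algebra_simps)

lemma tensor_keys_induct [consumes 2, case_names zero tensor add]:
  assumes "Poly_Mapping.keys t \<subseteq> S \<times> carrier B" "S \<subseteq> carrier A"
    and "R \<zero>\<^bsub>T.Q\<^esub>"
    and "\<And>a b. \<lbrakk>a \<in> S; b \<in> carrier B\<rbrakk> \<Longrightarrow> R (a \<otimes>\<^sub>t b)"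
    and "\<And>x y. \<lbrakk>x \<in> carrier T.Q; y \<in> carrier T.Q; R x; R y\<rbrakk> \<Longrightarrow> R (x \<oplus>\<^bsub>T.Q\<^esub> y)"
  shows "R (T.\<pi> t)"
  using assms(1)
proof (induction t rule: poly_mapping_keys_induct)
  case zero
  have "T.\<pi> \<zero>\<^bsub>P\<^esub> = \<zero>\<^bsub>T.Q\<^esub>"
    by (rule linear_map_zero[OF T.complex_algebra_axioms T.Q.complex_algebra_axioms
          algebra_hom_linear[OF T.quotient_map_hom]])
  then show ?case
    using assms(3) by (simp add: monoid_algebra_simps)
next
  case (add x c t)
  obtain a b where x: "x = (a, b)" "a \<in> S" "b \<in> carrier B" "a \<in> carrier A"
    using add(1) assms(2) by auto
  have t: "t \<in> carrier P"
    using add(2) assms(2) by (auto simp: monoid_algebra_simps)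
  \<comment> \<open>The coefficient is moved into the right factor, which ranges over all of B; the
    set S for the left factor need not be closed under scalars. Thus the induction needs no scalar
    case.\<close>
  have "T.\<pi> (Poly_Mapping.single x c + t) = (a \<otimes>\<^sub>t (c \<odot>\<^bsub>B\<^esub> b)) \<oplus>\<^bsub>T.Q\<^esub> T.\<pi> t"
    using x t T.quotient_map_add[of "Poly_Mapping.single x c" t] quotient_map_single_pair[of a b c]
    by (simp add: monoid_algebra_simps(2) tensor_smult_r)
  then show ?case
    using x t add(3) assms(4,5) by simp
qed

lemma tensor_induct [consumes 1, case_names zero tensor add]:
  assumes "x \<in> carrier T.Q"
    and "R \<zero>\<^bsub>T.Q\<^esub>"
    and "\<And>a b. \<lbrakk>a \<in> carrier A; b \<in> carrier B\<rbrakk> \<Longrightarrow> R (a \<otimes>\<^sub>t b)"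
    and "\<And>x y. \<lbrakk>x \<in> carrier T.Q; y \<in> carrier T.Q; R x; R y\<rbrakk> \<Longrightarrow> R (x \<oplus>\<^bsub>T.Q\<^esub> y)"
  shows "R x"
proof -
  obtain t where t: "t \<in> carrier P" "x = T.\<pi> t"
    using T.quotient_map_surj[OF assms(1)] .
  then have "Poly_Mapping.keys t \<subseteq> carrier A \<times> carrier B"
    by (simp add: monoid_algebra_simps)
  then have "R (T.\<pi> t)"
    using subset_refl[of "carrier A"]
    by (induction t rule: tensor_keys_induct) (use assms in auto)
  then show ?thesis using t by simp
qed

text \<open>The factors are only assumed linear, since a contraction or a derivation of one factor
  will be paired with the identity of the other. Criteria for homomorphisms do not cover this, so
  the descent rests on \<open>linear_map_bilinear_ideal\<close>.\<close>

lemma tensor_map_exists: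
  assumes f: "linear_map A A f" and g: "linear_map B B g"
  obtains h where "linear_map T.Q T.Q h"
    and "\<And>a b. \<lbrakk>a \<in> carrier A; b \<in> carrier B\<rbrakk> \<Longrightarrow> h (a \<otimes>\<^sub>t b) = f a \<otimes>\<^sub>t g b"
proof -
  let ?F = "lin_ext T.Q (\<lambda>(a, b). f a \<otimes>\<^sub>t g b)"
  note [simp] = linear_map_closed[OF f] linear_map_closed[OF g]
  have F: "linear_map P T.Q ?F"
    by (rule T.Q.lin_ext_linear) auto
  have F_single: "?F (Poly_Mapping.single (a, b) c) = c \<odot>\<^bsub>T.Q\<^esub> (f a \<otimes>\<^sub>t g b)"
    if "a \<in> carrier A" "b \<in> carrier B" for a b c
    using that by simp
  note diff = linear_map_monoid_algebra_diff[OF monoid_DirProd T.Q.complex_algebra_axioms F]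
  have three: "(x \<oplus>\<^bsub>T.Q\<^esub> y) \<ominus>\<^bsub>T.Q\<^esub> x \<ominus>\<^bsub>T.Q\<^esub> y = \<zero>\<^bsub>T.Q\<^esub>"
    if "x \<in> carrier T.Q" "y \<in> carrier T.Q" for x y
  proof -
    have "(x \<oplus>\<^bsub>T.Q\<^esub> y) \<ominus>\<^bsub>T.Q\<^esub> x \<ominus>\<^bsub>T.Q\<^esub> y = (x \<oplus>\<^bsub>T.Q\<^esub> y) \<ominus>\<^bsub>T.Q\<^esub> (x \<oplus>\<^bsub>T.Q\<^esub> y)"
      using that by (simp add: T.Q.a_minus_eq_smult T.Q.smult_r_distr T.Q.a_assoc)
    then show ?thesis using that by simp
  qed
  have "?F r = \<zero>\<^bsub>T.Q\<^esub>" if "r \<in> bilinear_relations A B" for r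
    using that
    by (cases rule: bilinear_relations_cases)
      (simp_all add: diff monoid_algebra_diff_closed linear_map_add[OF f] linear_map_add[OF g]
        linear_map_smult[OF f] linear_map_smult[OF g] tensor_bilinear three)
  then have "?F t = \<zero>\<^bsub>T.Q\<^esub>" if "t \<in> genideal P (bilinear_relations A B)" for t
    using linear_map_bilinear_ideal[OF T.Q.complex_algebra_axioms F _ that] by blast
  then obtain h where h: "linear_map T.Q T.Q h" "\<And>t. t \<in> carrier P \<Longrightarrow> h (T.\<pi> t) = ?F t"
    using T.linear_map_descends[OF T.Q.complex_algebra_axioms F] by blast
  have "h (a \<otimes>\<^sub>t b) = f a \<otimes>\<^sub>t g b" if "a \<in> carrier A" "b \<in> carrier B" for a b
    using that by (simp add: tensor_def[of a b] h)
  with h(1) show ?thesis using that by blast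
qed

lemma linear_map_tensor_eqI:
  assumes C: "complex_algebra C" and f: "linear_map T.Q C f" and g: "linear_map T.Q C g"
    and "\<And>a b. \<lbrakk>a \<in> carrier A; b \<in> carrier B\<rbrakk> \<Longrightarrow> f (a \<otimes>\<^sub>t b) = g (a \<otimes>\<^sub>t b)"
    and "x \<in> carrier T.Q"
  shows "f x = g x"
  using assms(5)
  by (induction x rule: tensor_induct)
    (simp_all add: linear_map_zero[OF T.Q.complex_algebra_axioms C f]
      linear_map_zero[OF T.Q.complex_algebra_axioms C g] linear_map_add[OF f] linear_map_add[OF g]
      assms(4))

lemma twisted_derivation_tensorI:
  assumes lin: "linear_map T.Q T.Q \<phi>" "linear_map T.Q T.Q \<psi>" "linear_map T.Q T.Q f"
    and eq: "\<And>a b a' b'. \<lbrakk>a \<in> carrier A; b \<in> carrier B; a' \<in> carrier A; b' \<in> carrier B\<rbrakk> \<Longrightarrow>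
      f ((a \<otimes>\<^bsub>A\<^esub> a') \<otimes>\<^sub>t (b \<otimes>\<^bsub>B\<^esub> b')) =
        f (a \<otimes>\<^sub>t b) \<otimes>\<^bsub>T.Q\<^esub> \<psi> (a' \<otimes>\<^sub>t b') \<oplus>\<^bsub>T.Q\<^esub> \<phi> (a \<otimes>\<^sub>t b) \<otimes>\<^bsub>T.Q\<^esub> f (a' \<otimes>\<^sub>t b')"
  shows "twisted_derivation T.Q T.Q \<phi> \<psi> f"
  unfolding twisted_derivation_def
proof (intro conjI ballI lin)
  note [simp] = linear_map_closed[OF lin(1)] linear_map_closed[OF lin(2)] linear_map_closed[OF lin(3)]
  note Q = T.Q.complex_algebra_axioms
  fix x y assume x: "x \<in> carrier T.Q" and y: "y \<in> carrier T.Q"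
  \<comment> \<open>As for monoid algebras, bilinearity allows one factor at a time to be replaced
    by a pure tensor.\<close>
  have 1: "f ((a \<otimes>\<^sub>t b) \<otimes>\<^bsub>T.Q\<^esub> y) = f (a \<otimes>\<^sub>t b) \<otimes>\<^bsub>T.Q\<^esub> \<psi> y \<oplus>\<^bsub>T.Q\<^esub> \<phi> (a \<otimes>\<^sub>t b) \<otimes>\<^bsub>T.Q\<^esub> f y"
    if [simp]: "a \<in> carrier A" "b \<in> carrier B" for a b
    by (rule linear_map_tensor_eqI[OF Q _ _ _ y])
      (auto intro!: T.Q.linear_map_intros linear_map_compose[OF _ lin(3)] lin simp: tensor_mult eq)
  show "f (x \<otimes>\<^bsub>T.Q\<^esub> y) = f x \<otimes>\<^bsub>T.Q\<^esub> \<psi> y \<oplus>\<^bsub>T.Q\<^esub> \<phi> x \<otimes>\<^bsub>T.Q\<^esub> f y"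
    by (rule linear_map_tensor_eqI[OF Q _ _ _ x])
      (use y in \<open>auto intro!: T.Q.linear_map_intros linear_map_compose[OF _ lin(3)] lin simp: 1\<close>)
qed

end


section \<open>Superalgebras and second-order operators\<close>

context complex_algebra
begin

text \<open>The operators (1 + \<sigma>)/2 and (1 - \<sigma>)/2 are complementary projectors, which
  gives existence and uniqueness of the even and odd components. Parities add because \<sigma> is
  multiplicative.\<close>

lemma superalgebra_eigenspacesI:
  assumes \<sigma>: "algebra_hom A A \<sigma>"
    and involution: "\<And>a. a \<in> carrier A \<Longrightarrow> \<sigma> (\<sigma> a) = a"
    and G: "\<And>p. G p = {a \<in> carrier A. \<sigma> a = (- 1) ^ p \<odot> a}"
  shows "superalgebra A G"
proof -
  note lin = algebra_hom_linear[OF \<sigma>]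
  note [simp] = linear_map_closed[OF lin] linear_map_add[OF lin] linear_map_smult[OF lin]
    linear_map_zero[OF complex_algebra_axioms complex_algebra_axioms lin]
    algebra_hom_mult[OF \<sigma>] algebra_hom_one[OF \<sigma>] involution
  have sub: "submodule (G p) complex_ring A" for p
    by (rule module.submoduleI[OF module_complex_ring])
      (auto simp: G a_inv_eq_smult smult_r_distr smult_assoc mult.commute)
  have "G p = G (p mod 2)" for p
    by (cases "even p") (simp_all add: G even_iff_mod_2_eq_zero odd_iff_mod_2_eq_one)
  moreover have "\<exists>!u. u \<in> G 0 \<times> G 1 \<and> a = fst u \<oplus> snd u" if [simp]: "a \<in> carrier A" for a
  proof (rule ex_ex1I)
    define b where "b = (1 / 2) \<odot> (a \<oplus> \<sigma> a)"
    define c where "c = (1 / 2) \<odot> (a \<oplus> (- 1) \<odot> \<sigma> a)"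
    have "b \<oplus> c = (1 / 2 + 1 / 2) \<odot> a \<oplus> (1 / 2 + - 1 / 2) \<odot> \<sigma> a"
      unfolding smult_l_distr[OF \<open>a \<in> carrier A\<close>] smult_l_distr[OF linear_map_closed[OF lin \<open>a \<in> carrier A\<close>]]
      by (simp add: b_def c_def smult_r_distr smult_assoc a_ac)
    then have "a = b \<oplus> c" by simp
    moreover have "b \<in> G 0" "c \<in> G 1"
      by (simp_all add: b_def c_def G smult_r_distr smult_assoc a_ac)
    ultimately show "\<exists>u. u \<in> G 0 \<times> G 1 \<and> a = fst u \<oplus> snd u"
      by (intro exI[of _ "(b, c)"]) simp
  next
    fix u v
    assume u: "u \<in> G 0 \<times> G 1 \<and> a = fst u \<oplus> snd u" and v: "v \<in> G 0 \<times> G 1 \<and> a = fst v \<oplus> snd v"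
    have *: "fst w = (1 / 2) \<odot> (a \<oplus> \<sigma> a) \<and> snd w = (1 / 2) \<odot> (a \<oplus> (- 1) \<odot> \<sigma> a)"
      if w: "w \<in> G 0 \<times> G 1 \<and> a = fst w \<oplus> snd w" for w
    proof -
      obtain b c where [simp]: "w = (b, c)" "b \<in> carrier A" "c \<in> carrier A"
        "\<sigma> b = b" "\<sigma> c = (- 1) \<odot> c" "a = b \<oplus> c"
        using w by (cases w) (auto simp: G)
      have "a \<oplus> \<sigma> a = (1 + 1) \<odot> b \<oplus> (1 + - 1) \<odot> c"
        unfolding smult_l_distr[OF \<open>b \<in> carrier A\<close>] smult_l_distr[OF \<open>c \<in> carrier A\<close>]
        by (simp add: a_ac)
      moreover have "a \<oplus> (- 1) \<odot> \<sigma> a = (1 + - 1) \<odot> b \<oplus> (1 + 1) \<odot> c"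
        unfolding smult_l_distr[OF \<open>b \<in> carrier A\<close>] smult_l_distr[OF \<open>c \<in> carrier A\<close>]
        by (simp add: a_ac smult_r_distr smult_assoc)
      ultimately show ?thesis
        by (simp add: smult_assoc)
    qed
    show "u = v"
      using *[OF u] *[OF v] by (simp add: prod_eq_iff)
  qed
  moreover have "\<one> \<in> G 0"
    by (simp add: G)
  moreover have "a \<otimes> b \<in> G (p + q)" if "a \<in> G p" "b \<in> G q" for a b p q
    using that by (simp add: G smult_mult_l smult_mult_r smult_assoc power_add mult.commute)
  ultimately show ?thesis
    unfolding superalgebra_def
    using sub ring_axioms module_complex_ring by (auto simp: smult_mult_l smult_mult_r)
qed

text \<open>The twist is kept as a parameter because it will be the identity for p = 0 and the
  parity involution for p = 1; on \<open>G q\<close> either one is the Koszul sign (-1)^(p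
  q).\<close>

lemma superderivation_eigenspacesI:
  assumes G: "\<And>p. G p = {a \<in> carrier A. \<sigma> a = (- 1) ^ p \<odot> a}"
    and \<phi>: "\<And>a q. a \<in> G q \<Longrightarrow> \<phi> a = (- 1) ^ (p * q) \<odot> a"
    and D: "twisted_derivation A A \<phi> (\<lambda>x. x) D"
    and parity: "\<And>a. a \<in> carrier A \<Longrightarrow> \<sigma> (D a) = (- 1) ^ p \<odot> D (\<sigma> a)"
  shows "superderivation A G p D"
proof -
  note lin = twisted_derivation_linear[OF D]
  have "D a \<in> G (p + q)" if "a \<in> G q" for a q
    using that parity[of a] linear_map_closed[OF lin] linear_map_smult[OF lin]
    by (simp add: G smult_assoc power_add)
  moreover have "G q \<subseteq> carrier A" for q
    by (auto simp: G)
  ultimately show ?thesis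
    using lin twisted_derivation_mult[OF D] linear_map_closed[OF lin] \<phi>
    by (auto simp: superderivation_def homogeneous_operator_def linear_map_def smult_mult_l subset_iff)
qed

end

lemma superderivation_linear: "superderivation A G p D \<Longrightarrow> linear_map A A D"
  by (simp add: superderivation_def homogeneous_operator_def linear_map_def)

lemma superderivation_parity: "\<lbrakk>superderivation A G p D; a \<in> G q\<rbrakk> \<Longrightarrow> D a \<in> G (p + q)"
  by (simp add: superderivation_def homogeneous_operator_def)

lemma superderivation_mult:
  "\<lbrakk>superderivation A G p D; a \<in> G q; b \<in> carrier A\<rbrakk> \<Longrightarrow>
     D (a \<otimes>\<^bsub>A\<^esub> b) = D a \<otimes>\<^bsub>A\<^esub> b \<oplus>\<^bsub>A\<^esub> (- 1) ^ (p * q) \<odot>\<^bsub>A\<^esub> (a \<otimes>\<^bsub>A\<^esub> D b)"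
  by (simp add: superderivation_def)

section \<open>Supercommutative algebras and the second-order condition\<close>

locale supercommutative_algebra = complex_algebra A
  for A :: "(complex, 'm) module" (structure) +
  fixes G :: "nat \<Rightarrow> 'm set"
  assumes superalgebra: "superalgebra A G"
    and supercommutative: "supercommutative A G"
begin

lemma submodule_G: "submodule (G p) complex_ring A"
  using superalgebra by (simp add: superalgebra_def)

lemma G_closed: "a \<in> G p \<Longrightarrow> a \<in> carrier A"
  and G_zero: "\<zero> \<in> G p"
  and G_add: "\<lbrakk>a \<in> G p; b \<in> G p\<rbrakk> \<Longrightarrow> a \<oplus> b \<in> G p"
  and G_smult: "a \<in> G p \<Longrightarrow> c \<odot> a \<in> G p"
  using submodule_G[of p] subgroup.subset subgroup.m_closed subgroup.one_closed
    submodule.smult_closed[of "G p" complex_ring A c a]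
  by (fastforce simp: submodule_def complex_ring_def)+

lemma one_G: "\<one> \<in> G 0"
  using superalgebra by (simp add: superalgebra_def)

lemma supercommute: "\<lbrakk>a \<in> G p; b \<in> G q\<rbrakk> \<Longrightarrow> a \<otimes> b = (- 1) ^ (p * q) \<odot> (b \<otimes> a)"
  using supercommutative unfolding supercommutative_def by blast

lemma superderivation_one:
  assumes "superderivation A G p D"
  shows "D \<one> = \<zero>"
  using superderivation_mult[OF assms one_G one_closed] linear_map_closed[OF superderivation_linear[OF assms]]
  by simp

text \<open>The part of the BV axioms that is linear in the operator, so that it can be verified
  summand by summand. The vanishing of the square is quadratic and treated separately.\<close>

definition second_order :: "('m \<Rightarrow> 'm) \<Rightarrow> bool" where
  "second_order \<Delta> \<longleftrightarrow> homogeneous_operator A G 1 \<Delta> \<and>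
     (\<forall>p q. \<forall>a\<in>G p. \<forall>b\<in>G q. \<forall>c\<in>carrier A.
        bv_bracket A \<Delta> p a (b \<otimes> c) =
          bv_bracket A \<Delta> p a b \<otimes> c \<oplus> (- 1) ^ ((p + 1) * q) \<odot> (b \<otimes> bv_bracket A \<Delta> p a c))"

lemma second_order_linear: "second_order \<Delta> \<Longrightarrow> linear_map A A \<Delta>"
  by (simp add: second_order_def homogeneous_operator_def linear_map_def)

text \<open>A finite sum over \<open>insert\<close> splits only if the summands lie in the carrier,
  so the inductive step for sums gives an equality of operators on the carrier only.\<close>

lemma second_order_cong:
  assumes "second_order f" "\<And>x. x \<in> carrier A \<Longrightarrow> f x = g x"
  shows "second_order g"
proof -
  have "bv_bracket A g p a b = bv_bracket A f p a b" if "a \<in> carrier A" "b \<in> carrier A" for p a b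
    using that assms(2) by (simp add: bv_bracket_def)
  moreover have "homogeneous_operator A G 1 g"
    using assms G_closed by (simp add: second_order_def homogeneous_operator_def Pi_iff)
  ultimately show ?thesis
    using assms(1) G_closed by (simp add: second_order_def)
qed

text \<open>Subtraction is rewritten as addition with scalar coefficients; then distributivity and
  associative-commutative rewriting suffice for the linearity of the bracket in the
  operator.\<close>

lemma bv_bracket_smult_form:
  "\<lbrakk>linear_map A A f; a \<in> carrier A; b \<in> carrier A\<rbrakk> \<Longrightarrow>
     bv_bracket A f p a b = f (a \<otimes> b) \<oplus> (- 1) \<odot> (f a \<otimes> b) \<oplus> (- ((- 1) ^ p)) \<odot> (a \<otimes> f b)"
  by (simp add: bv_bracket_def a_minus_eq_smult smult_assoc linear_map_closed)

lemma bv_bracket_closed: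
  "\<lbrakk>linear_map A A f; a \<in> carrier A; b \<in> carrier A\<rbrakk> \<Longrightarrow> bv_bracket A f p a b \<in> carrier A"
  by (simp add: bv_bracket_smult_form linear_map_closed)

lemma second_order_zero: "second_order (\<lambda>x. \<zero>)"
  unfolding second_order_def
  using G_closed
  by (auto simp: homogeneous_operator_def G_zero bv_bracket_smult_form[OF linear_map_const_zero])

lemma second_order_smult:
  assumes f: "second_order f"
  shows "second_order (\<lambda>x. c \<odot> f x)"
proof -
  note lin = second_order_linear[OF f]
  note lin' = linear_map_scale[OF lin]
  have br: "bv_bracket A (\<lambda>x. c \<odot> f x) p a b = c \<odot> bv_bracket A f p a b"
    if "a \<in> carrier A" "b \<in> carrier A" for p a b
    using that linear_map_closed[OF lin]
    by (simp add: bv_bracket_smult_form[OF lin] bv_bracket_smult_form[OF lin'] smult_r_distr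
        smult_mult_l smult_mult_r smult_assoc mult.commute)
  have "homogeneous_operator A G 1 (\<lambda>x. c \<odot> f x)"
    using f lin' G_smult by (simp add: second_order_def homogeneous_operator_def linear_map_def)
  then show ?thesis
    using f G_closed
    by (simp add: second_order_def br bv_bracket_closed[OF lin] smult_r_distr
        smult_mult_l smult_mult_r smult_assoc mult.commute)
qed

lemma second_order_add:
  assumes f: "second_order f" and g: "second_order g"
  shows "second_order (\<lambda>x. f x \<oplus> g x)"
proof -
  note lin = second_order_linear[OF f] second_order_linear[OF g]
  note lin' = linear_map_plus[OF lin]
  have br: "bv_bracket A (\<lambda>x. f x \<oplus> g x) p a b = bv_bracket A f p a b \<oplus> bv_bracket A g p a b"
    if "a \<in> carrier A" "b \<in> carrier A" for p a b
    using that linear_map_closed[OF lin(1)] linear_map_closed[OF lin(2)]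
    by (simp add: bv_bracket_smult_form[OF lin(1)] bv_bracket_smult_form[OF lin(2)]
        bv_bracket_smult_form[OF lin'] smult_r_distr l_distr r_distr a_ac)
  have "homogeneous_operator A G 1 (\<lambda>x. f x \<oplus> g x)"
    using f g lin' G_add by (simp add: second_order_def homogeneous_operator_def linear_map_def)
  then show ?thesis
    using f g G_closed
    by (simp add: second_order_def br bv_bracket_closed[OF lin(1)] bv_bracket_closed[OF lin(2)]
        smult_r_distr l_distr r_distr a_ac)
qed

lemma second_order_finsum:
  assumes "finite S" "\<And>i. i \<in> S \<Longrightarrow> second_order (f i)"
  shows "second_order (\<lambda>x. \<Oplus>i\<in>S. f i x)"
  using assms
proof (induction S rule: finite_induct)
  case empty
  then show ?case by (simp add: second_order_zero)
next
  case (insert k S)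
  have "second_order (\<lambda>x. f k x \<oplus> (\<Oplus>i\<in>S. f i x))"
    using insert by (intro second_order_add) auto
  then show ?case
  proof (rule second_order_cong)
    fix x assume "x \<in> carrier A"
    then have "(\<lambda>i. f i x) \<in> S \<rightarrow> carrier A" "f k x \<in> carrier A"
      using linear_map_closed[OF second_order_linear[OF insert.prems]] by auto
    then show "f k x \<oplus> (\<Oplus>i\<in>S. f i x) = (\<Oplus>i\<in>insert k S. f i x)"
      using insert by simp
  qed
qed

lemma bv_bracket_compose:
  assumes D: "superderivation A G 1 D" and E: "superderivation A G 0 E"
    and a: "a \<in> G p" and b: "b \<in> carrier A"
  shows "bv_bracket A (\<lambda>x. D (E x)) p a b = D a \<otimes> E b \<oplus> (- 1) ^ p \<odot> (E a \<otimes> D b)"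
proof -
  note lin = superderivation_linear[OF D] superderivation_linear[OF E]
  note [simp] = linear_map_closed[OF lin(1)] linear_map_closed[OF lin(2)] G_closed[OF a]
  have Ea: "E a \<in> G p"
    using superderivation_parity[OF E a] by simp
  \<comment> \<open>Here t and w stand for the outer terms D(E a) b and (-1)^p a D(E b), exactly
    those that the bracket subtracts.\<close>
  have cancel: "(t \<oplus> u \<oplus> (v \<oplus> w)) \<ominus> t \<ominus> w = v \<oplus> u"
    if [simp]: "t \<in> carrier A" "u \<in> carrier A" "v \<in> carrier A" "w \<in> carrier A" for t u v w
  proof -
    have "(t \<oplus> u \<oplus> (v \<oplus> w)) \<ominus> t \<ominus> w = (v \<oplus> u) \<oplus> ((t \<ominus> t) \<oplus> (w \<ominus> w))"
      by (simp only: a_minus_def a_ac that a_inv_closed a_closed)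
    then show ?thesis by (simp add: a_minus_def r_neg)
  qed
  \<comment> \<open>E is even, so E a has the parity of a, and D picks up the same sign (-1)^p in
    passing either of them.\<close>
  have "D (E (a \<otimes> b)) = D (E a) \<otimes> b \<oplus> (- 1) ^ p \<odot> (E a \<otimes> D b) \<oplus>
      (D a \<otimes> E b \<oplus> (- 1) ^ p \<odot> (a \<otimes> D (E b)))"
    using b by (simp add: superderivation_mult[OF E a] superderivation_mult[OF D a]
        superderivation_mult[OF D Ea] linear_map_add[OF lin(1)])
  then show ?thesis
    using b by (simp add: bv_bracket_def cancel)
qed

lemma second_order_compose:
  assumes D: "superderivation A G 1 D" and E: "superderivation A G 0 E"
  shows "second_order (\<lambda>x. D (E x))"
  unfolding second_order_def
proof (intro conjI allI ballI)
  note lin = superderivation_linear[OF D] superderivation_linear[OF E]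
  note [simp] = linear_map_closed[OF lin(1)] linear_map_closed[OF lin(2)]
  have "D (E a) \<in> G (1 + q)" if "a \<in> G q" for a q
    using superderivation_parity[OF D, of "E a" q] superderivation_parity[OF E that] by simp
  then show "homogeneous_operator A G 1 (\<lambda>x. D (E x))"
    using linear_map_compose[OF lin(2) lin(1)] by (simp add: homogeneous_operator_def linear_map_def)
  fix p q a b c
  assume a: "a \<in> G p" and b: "b \<in> G q" and c [simp]: "c \<in> carrier A"
  have [simp]: "a \<in> carrier A" "b \<in> carrier A"
    using a b G_closed by auto
  have Da: "D a \<otimes> b = (- 1) ^ ((p + 1) * q) \<odot> (b \<otimes> D a)"
    using supercommute[OF superderivation_parity[OF D a] b] by simp
  have Ea: "E a \<otimes> b = (- 1) ^ (p * q) \<odot> (b \<otimes> E a)"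
    using supercommute[OF superderivation_parity[OF E a] b] by simp
  \<comment> \<open>In the bracket of a with b c the factor b must be moved to the left of D a, of
    parity p + 1, and of E a, of parity p. The sign (-1)^q that is missing in the second case is
    supplied by D passing b in D(b c).\<close>
  have 1: "D a \<otimes> (b \<otimes> E c) = (- 1) ^ ((p + 1) * q) \<odot> (b \<otimes> (D a \<otimes> E c))"
    using Da by (simp add: smult_mult_l m_assoc[symmetric])
  have 2: "E a \<otimes> (b \<otimes> D c) = (- 1) ^ (p * q) \<odot> (b \<otimes> (E a \<otimes> D c))"
    using Ea by (simp add: smult_mult_l m_assoc[symmetric])
  show "bv_bracket A (\<lambda>x. D (E x)) p a (b \<otimes> c) =
      bv_bracket A (\<lambda>x. D (E x)) p a b \<otimes> c \<oplus>
      (- 1) ^ ((p + 1) * q) \<odot> (b \<otimes> bv_bracket A (\<lambda>x. D (E x)) p a c)"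
    by (simp add: bv_bracket_compose[OF D E a] superderivation_mult[OF D b] superderivation_mult[OF E b]
        l_distr r_distr smult_mult_l smult_mult_r smult_r_distr smult_assoc 1 2 m_assoc a_ac
        power_add mult_ac)
qed

end

text \<open>Generation by the odd \<open>x k\<close> and the even \<open>y k\<close> is stated as an
  induction principle with left multiplication by one generator at a time, the form in which
  identities between derivations are proved. Zero needs no case, being the scalar 0 times the
  unit.\<close>

locale bv_generators = supercommutative_algebra A G
  for A :: "(complex, 'm) module" (structure) and G +
  fixes n :: nat and x y :: "nat \<Rightarrow> 'm"
  assumes x_odd: "k \<in> {1..n} \<Longrightarrow> x k \<in> G 1"
    and y_even: "k \<in> {1..n} \<Longrightarrow> y k \<in> G 0"
    and generated [consumes 1, case_names one add smult x y]:
      "\<lbrakk>a \<in> carrier A; P \<one>;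
        \<And>a b. \<lbrakk>a \<in> carrier A; b \<in> carrier A; P a; P b\<rbrakk> \<Longrightarrow> P (a \<oplus> b);
        \<And>c a. \<lbrakk>a \<in> carrier A; P a\<rbrakk> \<Longrightarrow> P (c \<odot> a);
        \<And>k a. \<lbrakk>k \<in> {1..n}; a \<in> carrier A; P a\<rbrakk> \<Longrightarrow> P (x k \<otimes> a);
        \<And>k a. \<lbrakk>k \<in> {1..n}; a \<in> carrier A; P a\<rbrakk> \<Longrightarrow> P (y k \<otimes> a)\<rbrakk> \<Longrightarrow> P a"
begin

lemma x_closed [simp]: "k \<in> {1..n} \<Longrightarrow> x k \<in> carrier A"
  and y_closed [simp]: "k \<in> {1..n} \<Longrightarrow> y k \<in> carrier A"
  using x_odd y_even G_closed by blast+

lemma superderivation_eqI: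
  assumes D: "superderivation A G p D" and D': "superderivation A G p D'"
    and x: "\<And>k. k \<in> {1..n} \<Longrightarrow> D (x k) = D' (x k)"
    and y: "\<And>k. k \<in> {1..n} \<Longrightarrow> D (y k) = D' (y k)"
    and "a \<in> carrier A"
  shows "D a = D' a"
  using assms(5)
proof (induction a rule: generated)
  case one
  then show ?case using superderivation_one[OF D] superderivation_one[OF D'] by simp
next
  case (add a b)
  then show ?case
    by (simp add: linear_map_add[OF superderivation_linear[OF D]] linear_map_add[OF superderivation_linear[OF D']])
next
  case (smult c a)
  then show ?case
    by (simp add: linear_map_smult[OF superderivation_linear[OF D]] linear_map_smult[OF superderivation_linear[OF D']])
next
  case (x k a)
  then show ?case
    by (simp only: superderivation_mult[OF D x_odd] superderivation_mult[OF D' x_odd] assms(3))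
next
  case (y k a)
  then show ?case
    by (simp only: superderivation_mult[OF D y_even] superderivation_mult[OF D' y_even] assms(4))
qed

text \<open>Passes from any superderivation with the given values to the one picked by the
  description. Restriction to the carrier makes the witness extensional, and two candidates agree on
  the carrier by \<open>superderivation_eqI\<close>.\<close>

lemma the_superderivation:
  assumes D: "superderivation A G p D"
    and x: "\<And>k. k \<in> {1..n} \<Longrightarrow> D (x k) = u k"
    and y: "\<And>k. k \<in> {1..n} \<Longrightarrow> D (y k) = v k"
  defines "D' \<equiv> (THE D. D \<in> extensional (carrier A) \<and> superderivation A G p D \<and>
      (\<forall>k\<in>{1..n}. D (x k) = u k) \<and> (\<forall>k\<in>{1..n}. D (y k) = v k))"
  shows "superderivation A G p D'"
    and "\<And>k. k \<in> {1..n} \<Longrightarrow> D' (x k) = u k"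
    and "\<And>k. k \<in> {1..n} \<Longrightarrow> D' (y k) = v k"
proof -
  let ?R = "\<lambda>D. D \<in> extensional (carrier A) \<and> superderivation A G p D \<and>
      (\<forall>k\<in>{1..n}. D (x k) = u k) \<and> (\<forall>k\<in>{1..n}. D (y k) = v k)"
  have "superderivation A G p (restrict D (carrier A))"
    using D G_closed by (auto simp: superderivation_def homogeneous_operator_def)
  then have R: "?R (restrict D (carrier A))"
    using x y by simp
  have unique: "D1 = D2" if "?R D1" "?R D2" for D1 D2
  proof (rule extensionalityI)
    show "D1 a = D2 a" if "a \<in> carrier A" for a
      by (rule superderivation_eqI[of p D1 D2]) (use \<open>?R D1\<close> \<open>?R D2\<close> that in simp_all)
  qed (use that in simp_all)
  have "?R D'"
    unfolding D'_def by (rule theI[of ?R, OF R unique[OF _ R]])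
  then show "superderivation A G p D'" "\<And>k. k \<in> {1..n} \<Longrightarrow> D' (x k) = u k"
    "\<And>k. k \<in> {1..n} \<Longrightarrow> D' (y k) = v k"
    by auto
qed

end

section \<open>Derivations with respect to the generators, and the square of the operator\<close>

locale bv_derivations = bv_generators A G n x y
  for A :: "(complex, 'm) module" (structure) and G n x y +
  fixes D E :: "nat \<Rightarrow> 'm \<Rightarrow> 'm"
  assumes D: "i \<in> {1..n} \<Longrightarrow> superderivation A G 1 (D i)"
    and D_x: "\<lbrakk>i \<in> {1..n}; k \<in> {1..n}\<rbrakk> \<Longrightarrow> D i (x k) = (if k = i then \<one> else \<zero>)"
    and D_y: "\<lbrakk>i \<in> {1..n}; k \<in> {1..n}\<rbrakk> \<Longrightarrow> D i (y k) = \<zero>"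
    and E: "i \<in> {1..n} \<Longrightarrow> superderivation A G 0 (E i)"
    and E_x: "\<lbrakk>i \<in> {1..n}; k \<in> {1..n}\<rbrakk> \<Longrightarrow> E i (x k) = \<zero>"
    and E_y: "\<lbrakk>i \<in> {1..n}; k \<in> {1..n}\<rbrakk> \<Longrightarrow> E i (y k) = (if k = i then \<one> else \<zero>)"
begin

lemmas D_linear = superderivation_linear[OF D]
lemmas E_linear = superderivation_linear[OF E]

lemmas DE_simps = linear_map_closed[OF D_linear] linear_map_closed[OF E_linear]
  linear_map_add[OF D_linear] linear_map_add[OF E_linear]
  linear_map_smult[OF D_linear] linear_map_smult[OF E_linear]
  linear_map_zero[OF complex_algebra_axioms complex_algebra_axioms D_linear]
  linear_map_zero[OF complex_algebra_axioms complex_algebra_axioms E_linear]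
  superderivation_one[OF D] superderivation_one[OF E]

lemma derivations_mult:
  assumes "i \<in> {1..n}" "k \<in> {1..n}" "a \<in> carrier A"
  shows "D i (x k \<otimes> a) = of_bool (k = i) \<odot> a \<oplus> (- 1) \<odot> (x k \<otimes> D i a)"
    and "D i (y k \<otimes> a) = y k \<otimes> D i a"
    and "E i (x k \<otimes> a) = x k \<otimes> E i a"
    and "E i (y k \<otimes> a) = of_bool (k = i) \<odot> a \<oplus> y k \<otimes> E i a"
  using superderivation_mult[OF D[OF assms(1)] x_odd[OF assms(2)] assms(3)]
    superderivation_mult[OF D[OF assms(1)] y_even[OF assms(2)] assms(3)]
    superderivation_mult[OF E[OF assms(1)] x_odd[OF assms(2)] assms(3)]
    superderivation_mult[OF E[OF assms(1)] y_even[OF assms(2)] assms(3)]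
  using assms by (simp_all add: D_x D_y E_x E_y DE_simps)

text \<open>Writing d_kl for the Kronecker delta, splitting off \<open>x k\<close> produces d_kj D_i
  a - d_ki D_j a on both sides, and what remains is the induction hypothesis multiplied by
  \<open>x k\<close>. The case i = j, which says that D_i squares to zero, needs no separate
  treatment.\<close>

lemma D_D:
  assumes "i \<in> {1..n}" "j \<in> {1..n}" "a \<in> carrier A"
  shows "D i (D j a) = (- 1) \<odot> D j (D i a)"
  using assms(3)
  by (induction a rule: generated)
    (use assms in \<open>simp_all add: DE_simps derivations_mult smult_r_distr smult_mult_r smult_assoc a_ac
      del: atLeastAtMost_iff\<close>)

lemma E_E:
  assumes "i \<in> {1..n}" "j \<in> {1..n}" "a \<in> carrier A"
  shows "E i (E j a) = E j (E i a)"
  using assms(3)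
  by (induction a rule: generated)
    (use assms in \<open>simp_all add: DE_simps derivations_mult smult_r_distr smult_mult_r smult_assoc a_ac
      del: atLeastAtMost_iff\<close>)

lemma E_D:
  assumes "i \<in> {1..n}" "j \<in> {1..n}" "a \<in> carrier A"
  shows "E i (D j a) = D j (E i a)"
  using assms(3)
  by (induction a rule: generated)
    (use assms in \<open>simp_all add: DE_simps derivations_mult smult_r_distr smult_mult_r smult_assoc a_ac
      del: atLeastAtMost_iff\<close>)

context
  fixes I :: "nat \<Rightarrow> nat \<Rightarrow> complex"
begin

definition \<Delta> :: "'m \<Rightarrow> 'm" where
  "\<Delta> a = (\<Oplus>i\<in>{1..n}. \<Oplus>j\<in>{1..n}. I i j \<odot> D i (E j a))"

lemma second_order_\<Delta>: "second_order \<Delta>"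
  unfolding \<Delta>_def
  by (intro second_order_finsum second_order_smult second_order_compose D E) auto

text \<open>Stated for a general T because it is applied twice: to T = D_i E_j, and then to T =
  \<open>\<Delta>\<close>, whose hypothesis is the outcome of the first application.\<close>

lemma anticommute_\<Delta>:
  assumes T: "linear_map A A T"
    and anti: "\<And>i j a. \<lbrakk>i \<in> {1..n}; j \<in> {1..n}; a \<in> carrier A\<rbrakk> \<Longrightarrow> T (D i (E j a)) = (- 1) \<odot> D i (E j (T a))"
    and a: "a \<in> carrier A"
  shows "T (\<Delta> a) = (- 1) \<odot> \<Delta> (T a)"
proof -
  note [simp] = linear_map_closed[OF T] a DE_simps(1,2)
  note fs = linear_map_finsum[OF complex_algebra_axioms complex_algebra_axioms T]
  have "T (\<Delta> a) = (\<Oplus>i\<in>{1..n}. T (\<Oplus>j\<in>{1..n}. I i j \<odot> D i (E j a)))"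
    unfolding \<Delta>_def by (rule fs) (simp add: Pi_iff del: atLeastAtMost_iff)
  also have "\<dots> = (\<Oplus>i\<in>{1..n}. (- 1) \<odot> (\<Oplus>j\<in>{1..n}. I i j \<odot> D i (E j (T a))))"
  proof (rule finsum_cong')
    fix i assume i: "i \<in> {1..n}"
    have "T (\<Oplus>j\<in>{1..n}. I i j \<odot> D i (E j a)) = (\<Oplus>j\<in>{1..n}. T (I i j \<odot> D i (E j a)))"
      using i by (intro fs) (simp add: Pi_iff del: atLeastAtMost_iff)
    also have "\<dots> = (\<Oplus>j\<in>{1..n}. (- 1) \<odot> (I i j \<odot> D i (E j (T a))))"
      using i by (intro finsum_cong')
        (simp_all add: Pi_iff linear_map_smult[OF T] anti smult_assoc del: atLeastAtMost_iff)
    also have "\<dots> = (- 1) \<odot> (\<Oplus>j\<in>{1..n}. I i j \<odot> D i (E j (T a)))"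
      using i by (intro finsum_smult[symmetric]) (simp add: Pi_iff del: atLeastAtMost_iff)
    finally show "T (\<Oplus>j\<in>{1..n}. I i j \<odot> D i (E j a)) = (- 1) \<odot> (\<Oplus>j\<in>{1..n}. I i j \<odot> D i (E j (T a)))" .
  qed (simp_all add: Pi_iff del: atLeastAtMost_iff)
  also have "\<dots> = (- 1) \<odot> \<Delta> (T a)"
    unfolding \<Delta>_def by (intro finsum_smult[symmetric]) (simp add: Pi_iff del: atLeastAtMost_iff)
  finally show ?thesis .
qed

lemma \<Delta>_\<Delta>:
  assumes a: "a \<in> carrier A"
  shows "\<Delta> (\<Delta> a) = \<zero>"
proof -
  note lin = second_order_linear[OF second_order_\<Delta>]
  note [simp] = linear_map_closed[OF lin] DE_simps(1,2)
  have "D i (E j (\<Delta> b)) = (- 1) \<odot> \<Delta> (D i (E j b))"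
    if ij: "i \<in> {1..n}" "j \<in> {1..n}" and b: "b \<in> carrier A" for i j b
  proof (rule anticommute_\<Delta>[OF linear_map_compose[OF E_linear D_linear] _ b])
    fix k l c assume "k \<in> {1..n}" "l \<in> {1..n}" "c \<in> carrier A"
    \<comment> \<open>The even derivations move past everything without sign; only the exchange of
      D_i and D_k contributes the -1.\<close>
    then show "D i (E j (D k (E l c))) = (- 1) \<odot> D k (E l (D i (E j c)))"
      using ij by (simp add: E_D E_E D_D[of i k] del: atLeastAtMost_iff)
  qed (use ij in auto)
  \<comment> \<open>The same identity solved for the other side, -1 being its own inverse; this is
    the hypothesis needed for T = \<open>\<Delta>\<close>.\<close>
  then have "\<Delta> (D i (E j b)) = (- 1) \<odot> D i (E j (\<Delta> b))"
    if "i \<in> {1..n}" "j \<in> {1..n}" "b \<in> carrier A" for i j b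
    using that by (simp add: smult_assoc del: atLeastAtMost_iff)
  then have "\<Delta> (\<Delta> a) = (- 1) \<odot> \<Delta> (\<Delta> a)"
    by (intro anticommute_\<Delta>[OF lin _ a]) auto
  then show ?thesis
    using a by (intro eq_smult_minus_one_imp_zero) simp_all
qed

lemma bv_superalgebra_\<Delta>: "bv_superalgebra A G \<Delta>"
  using superalgebra supercommutative second_order_\<Delta> \<Delta>_\<Delta>
  by (simp add: bv_superalgebra_def second_order_def)

end

end


section \<open>The algebra of functions on the harmonic forms\<close>

locale bv_forms =
  fixes H0 H1 :: "('x, 'a, 'r) form set" and n :: nat and e0 e1 :: "nat \<Rightarrow> ('x, 'a, 'r) form"
  assumes basis0: "is_basis n H0 e0" and basis1: "is_basis n H1 e1"
begin

sublocale Ext: exterior_space form_scale H0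
  by (intro exterior_space.intro vector_subspace.intro vector_subspace_axioms.intro form.vector_space_axioms)
    (use basis0 form.subspace_span in \<open>auto simp: is_basis_def\<close>)

sublocale Sym: symmetric_space form_scale H1
  by (intro symmetric_space.intro vector_subspace.intro vector_subspace_axioms.intro form.vector_space_axioms)
    (use basis1 form.subspace_span in \<open>auto simp: is_basis_def\<close>)

sublocale Ten: tensor_product Ext.Q Sym.Q
  by (intro tensor_product.intro Ext.Q.complex_algebra_axioms Sym.Q.complex_algebra_axioms)

abbreviation "\<O> \<equiv> Ten.T.Q"
abbreviation "G \<equiv> O_BV_parity H0 H1"

notation Ten.tensor (infixl \<open>\<otimes>\<^sub>t\<close> 70)

lemma O_BV_eq: "O_BV H0 H1 = \<O>"
  by (simp add: O_BV_def tensor_algebra_def exterior_algebra_def symmetric_algebra_def)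

lemma odd_gen_eq: "odd_gen H0 H1 v = Ext.\<iota> v \<otimes>\<^sub>t \<one>\<^bsub>Sym.Q\<^esub>"
  by (simp add: odd_gen_def Let_def pure_tensor_def Ten.tensor_def Ext.\<iota>_def exterior_algebra_def
      symmetric_algebra_def)

lemma even_gen_eq: "even_gen H0 H1 v = \<one>\<^bsub>Ext.Q\<^esub> \<otimes>\<^sub>t Sym.\<iota> v"
  by (simp add: even_gen_def Let_def pure_tensor_def Ten.tensor_def Sym.\<iota>_def exterior_algebra_def
      symmetric_algebra_def)

lemma G_eq: "G p = Ten.T.\<pi> `
    {t. Poly_Mapping.keys t \<subseteq> exterior_parity form_scale H0 p \<times> carrier Sym.Q}"
  by (simp add: O_BV_parity_def Let_def exterior_algebra_def symmetric_algebra_def)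

lemma exterior_parity_subset: "exterior_parity form_scale H0 p \<subseteq> carrier Ext.Q"
  using Ext.exterior_parity_\<sigma> by blast

lemma tensor_zero_l: "b \<in> carrier Sym.Q \<Longrightarrow> \<zero>\<^bsub>Ext.Q\<^esub> \<otimes>\<^sub>t b = \<zero>\<^bsub>\<O>\<^esub>"
  using Ten.tensor_smult_l[of "\<zero>\<^bsub>Ext.Q\<^esub>" b 0] by simp

lemma tensor_zero_r: "a \<in> carrier Ext.Q \<Longrightarrow> a \<otimes>\<^sub>t \<zero>\<^bsub>Sym.Q\<^esub> = \<zero>\<^bsub>\<O>\<^esub>"
  using Ten.tensor_smult_r[of a "\<zero>\<^bsub>Sym.Q\<^esub>" 0] by simp

text \<open>The symmetric algebra is purely even, so the parity involution of the tensor product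
  acts on the exterior factor alone.\<close>

definition \<Sigma> where
  "\<Sigma> = (SOME h. linear_map \<O> \<O> h \<and>
     (\<forall>a\<in>carrier Ext.Q. \<forall>b\<in>carrier Sym.Q. h (a \<otimes>\<^sub>t b) = Ext.\<sigma> a \<otimes>\<^sub>t b))"

lemma \<Sigma>_linear: "linear_map \<O> \<O> \<Sigma>"
  and \<Sigma>_tensor: "\<lbrakk>a \<in> carrier Ext.Q; b \<in> carrier Sym.Q\<rbrakk> \<Longrightarrow> \<Sigma> (a \<otimes>\<^sub>t b) = Ext.\<sigma> a \<otimes>\<^sub>t b"
proof -
  obtain h where "linear_map \<O> \<O> h"
    "\<And>a b. \<lbrakk>a \<in> carrier Ext.Q; b \<in> carrier Sym.Q\<rbrakk> \<Longrightarrow> h (a \<otimes>\<^sub>t b) = Ext.\<sigma> a \<otimes>\<^sub>t b"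
    using Ten.tensor_map_exists[OF Ext.\<sigma>_linear Sym.Q.linear_map_id] by blast
  then have "\<exists>h. linear_map \<O> \<O> h \<and>
     (\<forall>a\<in>carrier Ext.Q. \<forall>b\<in>carrier Sym.Q. h (a \<otimes>\<^sub>t b) = Ext.\<sigma> a \<otimes>\<^sub>t b)"
    by blast
  from someI_ex[OF this]
  show "linear_map \<O> \<O> \<Sigma>"
    "\<lbrakk>a \<in> carrier Ext.Q; b \<in> carrier Sym.Q\<rbrakk> \<Longrightarrow> \<Sigma> (a \<otimes>\<^sub>t b) = Ext.\<sigma> a \<otimes>\<^sub>t b"
    by (auto simp: \<Sigma>_def)
qed

lemmas \<Sigma>_simps [simp] = linear_map_closed[OF \<Sigma>_linear] linear_map_add[OF \<Sigma>_linear]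
  linear_map_smult[OF \<Sigma>_linear] linear_map_zero[OF Ten.T.Q.complex_algebra_axioms Ten.T.Q.complex_algebra_axioms \<Sigma>_linear]

lemma \<Sigma>_hom: "algebra_hom \<O> \<O> \<Sigma>"
proof -
  have "twisted_derivation \<O> \<O> (\<lambda>_. \<zero>\<^bsub>\<O>\<^esub>) \<Sigma> \<Sigma>"
    by (intro Ten.twisted_derivation_tensorI Ten.T.Q.linear_map_const_zero \<Sigma>_linear)
      (simp add: \<Sigma>_tensor Ten.tensor_mult)
  moreover have "\<Sigma> \<one>\<^bsub>\<O>\<^esub> = \<one>\<^bsub>\<O>\<^esub>"
    using \<Sigma>_tensor[of "\<one>\<^bsub>Ext.Q\<^esub>" "\<one>\<^bsub>Sym.Q\<^esub>"] by (simp add: Ten.tensor_one)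
  ultimately show ?thesis
    using \<Sigma>_linear by (auto simp: algebra_hom_def twisted_derivation_def)
qed

lemma \<Sigma>_involution: "x \<in> carrier \<O> \<Longrightarrow> \<Sigma> (\<Sigma> x) = x"
  by (rule Ten.linear_map_tensor_eqI[OF Ten.T.Q.complex_algebra_axioms linear_map_compose[OF \<Sigma>_linear \<Sigma>_linear]
        Ten.T.Q.linear_map_id]) (simp_all add: \<Sigma>_tensor Ext.\<sigma>_involution)

lemma G_induct [consumes 1, case_names zero tensor add]:
  assumes "x \<in> G p"
    and "R \<zero>\<^bsub>\<O>\<^esub>"
    and "\<And>a b. \<lbrakk>a \<in> exterior_parity form_scale H0 p; b \<in> carrier Sym.Q\<rbrakk> \<Longrightarrow> R (a \<otimes>\<^sub>t b)"
    and "\<And>x y. \<lbrakk>x \<in> carrier \<O>; y \<in> carrier \<O>; R x; R y\<rbrakk> \<Longrightarrow> R (x \<oplus>\<^bsub>\<O>\<^esub> y)"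
  shows "R x"
proof -
  obtain t where t: "Poly_Mapping.keys t \<subseteq> exterior_parity form_scale H0 p \<times> carrier Sym.Q" "x = Ten.T.\<pi> t"
    using assms(1) by (auto simp: G_eq)
  have "R (Ten.T.\<pi> t)"
    using t(1) exterior_parity_subset
    by (induction t rule: Ten.tensor_keys_induct) (use assms in auto)
  then show ?thesis using t by simp
qed

lemma G_intros:
  shows G_tensor: "\<lbrakk>a \<in> exterior_parity form_scale H0 p; b \<in> carrier Sym.Q\<rbrakk> \<Longrightarrow> a \<otimes>\<^sub>t b \<in> G p"
    and G_zero: "\<zero>\<^bsub>\<O>\<^esub> \<in> G p"
    and G_add: "\<lbrakk>x \<in> G p; y \<in> G p\<rbrakk> \<Longrightarrow> x \<oplus>\<^bsub>\<O>\<^esub> y \<in> G p"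
proof -
  show "a \<otimes>\<^sub>t b \<in> G p" if "a \<in> exterior_parity form_scale H0 p" "b \<in> carrier Sym.Q"
    using that unfolding G_eq Ten.tensor_def by (intro imageI) simp
  have "Ten.T.\<pi> 0 = \<zero>\<^bsub>\<O>\<^esub>"
    using linear_map_zero[OF Ten.T.complex_algebra_axioms Ten.T.Q.complex_algebra_axioms
        algebra_hom_linear[OF Ten.T.quotient_map_hom]] by (simp add: monoid_algebra_simps)
  then show "\<zero>\<^bsub>\<O>\<^esub> \<in> G p"
    unfolding G_eq by (intro image_eqI[of _ _ 0]) simp_all
  assume "x \<in> G p" "y \<in> G p"
  then obtain s t where s: "Poly_Mapping.keys s \<subseteq> exterior_parity form_scale H0 p \<times> carrier Sym.Q" "x = Ten.T.\<pi> s"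
    and t: "Poly_Mapping.keys t \<subseteq> exterior_parity form_scale H0 p \<times> carrier Sym.Q" "y = Ten.T.\<pi> t"
    unfolding G_eq by blast
  have "s \<in> carrier Ten.P" "t \<in> carrier Ten.P"
    using s(1) t(1) exterior_parity_subset by (fastforce simp: monoid_algebra_simps)+
  then have "Ten.T.\<pi> (s + t) = x \<oplus>\<^bsub>\<O>\<^esub> y"
    using s t Ten.T.quotient_map_add by (simp add: monoid_algebra_simps(2))
  then show "x \<oplus>\<^bsub>\<O>\<^esub> y \<in> G p"
    using keys_add_subset[OF s(1) t(1)] unfolding G_eq by (intro image_eqI[of _ _ "s + t"]) simp_all
qed

text \<open>The eigenvalue is checked on pure tensors with homogeneous left factor. Conversely,
  \<open>?pr\<close> maps every element into \<open>G p\<close> and fixes those with eigenvalue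
  (-1)^p.\<close>

lemma G_eigenspace: "G p = {x \<in> carrier \<O>. \<Sigma> x = (- 1) ^ p \<odot>\<^bsub>\<O>\<^esub> x}"
proof (intro equalityI subsetI)
  fix x assume "x \<in> G p"
  then have "x \<in> carrier \<O> \<and> \<Sigma> x = (- 1) ^ p \<odot>\<^bsub>\<O>\<^esub> x"
  proof (induction x rule: G_induct)
    case (tensor a b)
    then show ?case
      using Ext.exterior_parity_\<sigma>[of a p] by (simp add: \<Sigma>_tensor Ten.tensor_smult_l)
  qed (auto simp: Ten.T.Q.smult_r_distr)
  then show "x \<in> {x \<in> carrier \<O>. \<Sigma> x = (- 1) ^ p \<odot>\<^bsub>\<O>\<^esub> x}" by simp
next
  let ?pr = "\<lambda>x. (1 / 2) \<odot>\<^bsub>\<O>\<^esub> (x \<oplus>\<^bsub>\<O>\<^esub> (- 1) ^ p \<odot>\<^bsub>\<O>\<^esub> \<Sigma> x)"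
  fix x assume x: "x \<in> {x \<in> carrier \<O>. \<Sigma> x = (- 1) ^ p \<odot>\<^bsub>\<O>\<^esub> x}"
  then have "x \<in> carrier \<O>" by simp
  then have "?pr x \<in> G p"
  proof (induction x rule: Ten.tensor_induct)
    case zero
    then show ?case by (simp add: G_zero)
  next
    case (tensor a b)
    \<comment> \<open>On a pure tensor the projector acts through the left factor, where its values
      are known to be homogeneous.\<close>
    then have "?pr (a \<otimes>\<^sub>t b) = ((1 / 2) \<odot>\<^bsub>Ext.Q\<^esub> (a \<oplus>\<^bsub>Ext.Q\<^esub> (- 1) ^ p \<odot>\<^bsub>Ext.Q\<^esub> Ext.\<sigma> a)) \<otimes>\<^sub>t b"
      by (simp add: Ten.tensor_smult_l Ten.tensor_add_l \<Sigma>_tensor)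
    then show ?case
      using G_tensor[OF Ext.exterior_parity_projection] tensor by simp
  next
    case (add x y)
    then have "?pr (x \<oplus>\<^bsub>\<O>\<^esub> y) = ?pr x \<oplus>\<^bsub>\<O>\<^esub> ?pr y"
      by (simp add: Ten.T.Q.smult_r_distr Ten.T.Q.a_ac)
    then show ?case
      using add G_add by simp
  qed
  moreover have "?pr x = x"
  proof -
    have "(- 1) ^ p \<odot>\<^bsub>\<O>\<^esub> \<Sigma> x = x"
      using x by (simp add: Ten.T.Q.smult_assoc flip: power_add)
    moreover have "x \<oplus>\<^bsub>\<O>\<^esub> x = 2 \<odot>\<^bsub>\<O>\<^esub> x"
      using x Ten.T.Q.smult_l_distr[of x 1 1] by simp
    ultimately show ?thesis
      using x by (simp add: Ten.T.Q.smult_assoc)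
  qed
  ultimately show "x \<in> G p" by simp
qed

lemma superalgebra_O: "superalgebra \<O> G"
  by (rule Ten.T.Q.superalgebra_eigenspacesI[OF \<Sigma>_hom \<Sigma>_involution G_eigenspace])

text \<open>By bilinearity it suffices to compare pure tensors; the sign comes from the exterior
  factors, and the symmetric factors commute without one.\<close>

lemma supercommutative_O: "supercommutative \<O> G"
  unfolding supercommutative_def
proof (intro allI ballI)
  fix p q x y assume x: "x \<in> G p" and y: "y \<in> G q"
  have [simp]: "y \<in> carrier \<O>" using y by (simp add: G_eigenspace)
  show "x \<otimes>\<^bsub>\<O>\<^esub> y = (- 1) ^ (p * q) \<odot>\<^bsub>\<O>\<^esub> (y \<otimes>\<^bsub>\<O>\<^esub> x)"
    using x
  proof (induction x rule: G_induct)
    case (tensor a b)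
    then have [simp]: "a \<in> carrier Ext.Q" "b \<in> carrier Sym.Q"
      using exterior_parity_subset by auto
    show ?case
      using y
    proof (induction y rule: G_induct)
      case (tensor a' b')
      then have "a' \<in> carrier Ext.Q"
        using exterior_parity_subset by auto
      then show ?case
        using tensor Ext.exterior_supercommute[OF \<open>a \<in> exterior_parity form_scale H0 p\<close> tensor(1)]
          Sym.symmetric_commute[of b b']
        by (simp add: Ten.tensor_mult Ten.tensor_smult_l)
    qed (simp_all add: Ten.T.Q.l_distr Ten.T.Q.r_distr Ten.T.Q.smult_r_distr)
  qed (simp_all add: Ten.T.Q.l_distr Ten.T.Q.r_distr Ten.T.Q.smult_r_distr)
qed

text \<open>The basis of functionals dual to e. These are the functionals \<epsilon> for the
  contractions and derivations.\<close>

definition coord :: "(nat \<Rightarrow> ('x, 'a, 'r) form) \<Rightarrow> nat \<Rightarrow> ('x, 'a, 'r) form \<Rightarrow> complex" where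
  "coord e i v = form.representation (e ` {1..n}) v (e i)"

lemma coord_add:
  "\<lbrakk>is_basis n H e; u \<in> H; v \<in> H\<rbrakk> \<Longrightarrow> coord e i (u + v) = coord e i u + coord e i v"
  by (auto simp: is_basis_def coord_def form.representation_add)

lemma coord_scale:
  "\<lbrakk>is_basis n H e; v \<in> H\<rbrakk> \<Longrightarrow> coord e i (form_scale c v) = c * coord e i v"
  by (auto simp: is_basis_def coord_def form.representation_scale)

text \<open>\<open>form.representation\<close> is indexed by vectors, so injectivity of e is what
  turns equality of basis vectors into equality of indices.\<close>

lemma coord_basis:
  assumes "is_basis n H e" "i \<in> {1..n}" "k \<in> {1..n}"
  shows "coord e i (e k) = of_bool (k = i)"
proof -
  have ind: "form.independent (e ` {1..n})" and inj: "inj_on e {1..n}"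
    using assms(1) unfolding is_basis_def by blast+
  have "e i = e k \<longleftrightarrow> k = i"
    using inj_on_eq_iff[OF inj assms(2,3)] by auto
  then show ?thesis
    unfolding coord_def form.representation_basis[OF ind imageI[OF assms(3)]] by simp
qed

lemma basis_in:
  assumes "is_basis n H e" "k \<in> {1..n}"
  shows "e k \<in> H"
proof -
  have "e k \<in> form.span (e ` {1..n})"
    using assms(2) by (intro form.span_base imageI)
  then show ?thesis
    using assms(1) unfolding is_basis_def by blast
qed

text \<open>The witness is the contraction with the i-th dual basis vector, tensored with the
  identity of the symmetric algebra. Its twist is \<open>Ext.\<sigma>\<close> on the left factor,
  that is, \<open>\<Sigma>\<close>.\<close>

lemma d_odd_exists:
  assumes "i \<in> {1..n}"
  obtains D where "superderivation \<O> G 1 D"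
    and "\<And>k. k \<in> {1..n} \<Longrightarrow> D (odd_gen H0 H1 (e0 k)) = (if k = i then \<one>\<^bsub>\<O>\<^esub> else \<zero>\<^bsub>\<O>\<^esub>)"
    and "\<And>k. k \<in> {1..n} \<Longrightarrow> D (even_gen H0 H1 (e1 k)) = \<zero>\<^bsub>\<O>\<^esub>"
proof -
  obtain f where f: "twisted_derivation Ext.Q Ext.Q Ext.\<sigma> (\<lambda>x. x) f"
    and f_\<iota>: "\<And>v. v \<in> H0 \<Longrightarrow> f (Ext.\<iota> v) = coord e0 i v \<odot>\<^bsub>Ext.Q\<^esub> \<one>\<^bsub>Ext.Q\<^esub>"
    by (rule Ext.contraction_exists[of "coord e0 i"];
        (rule coord_add[OF basis0] coord_scale[OF basis0] that; assumption))
  note f_linear = twisted_derivation_linear[OF f]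
  note [simp] = linear_map_closed[OF f_linear]
  have f_one: "f \<one>\<^bsub>Ext.Q\<^esub> = \<zero>\<^bsub>Ext.Q\<^esub>"
    using twisted_derivation_mult[OF f, of "\<one>\<^bsub>Ext.Q\<^esub>" "\<one>\<^bsub>Ext.Q\<^esub>"] by simp
  obtain D where D: "linear_map \<O> \<O> D"
    and D_tensor: "\<And>a b. \<lbrakk>a \<in> carrier Ext.Q; b \<in> carrier Sym.Q\<rbrakk> \<Longrightarrow> D (a \<otimes>\<^sub>t b) = f a \<otimes>\<^sub>t b"
    using Ten.tensor_map_exists[OF f_linear Sym.Q.linear_map_id] by blast
  have "twisted_derivation \<O> \<O> \<Sigma> (\<lambda>x. x) D"
    by (intro Ten.twisted_derivation_tensorI D \<Sigma>_linear Ten.T.Q.linear_map_id)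
      (simp add: D_tensor \<Sigma>_tensor Ten.tensor_mult Ten.tensor_add_l twisted_derivation_mult[OF f])
  moreover have "\<Sigma> (D x) = (- 1) ^ 1 \<odot>\<^bsub>\<O>\<^esub> D (\<Sigma> x)" if "x \<in> carrier \<O>" for x
    by (rule Ten.linear_map_tensor_eqI[OF Ten.T.Q.complex_algebra_axioms linear_map_compose[OF D \<Sigma>_linear]
          Ten.T.Q.linear_map_scale[OF linear_map_compose[OF \<Sigma>_linear D]] _ that])
      (simp add: D_tensor \<Sigma>_tensor Ext.contraction_parity[OF f f_\<iota>] Ten.tensor_smult_l)
  \<comment> \<open>\<open>\<Sigma>\<close> occurs in two roles, as the operator that defines parity
    and as the twist, since on \<open>G q\<close> it is the sign (-1)^q of an odd
    derivation.\<close>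
  ultimately have "superderivation \<O> G 1 D"
    by (intro Ten.T.Q.superderivation_eigenspacesI[of G \<Sigma> \<Sigma>] G_eigenspace)
      (simp_all add: G_eigenspace)
  moreover have "D (odd_gen H0 H1 (e0 k)) = (if k = i then \<one>\<^bsub>\<O>\<^esub> else \<zero>\<^bsub>\<O>\<^esub>)" if "k \<in> {1..n}" for k
    using that \<open>i \<in> {1..n}\<close> basis_in[OF basis0 that]
    by (simp add: odd_gen_eq D_tensor f_\<iota> coord_basis[OF basis0] Ten.tensor_one tensor_zero_l
        del: atLeastAtMost_iff)
  moreover have "D (even_gen H0 H1 (e1 k)) = \<zero>\<^bsub>\<O>\<^esub>" if "k \<in> {1..n}" for k
    using basis_in[OF basis1 that] by (simp add: even_gen_eq D_tensor f_one tensor_zero_l)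
  ultimately show ?thesis using that by blast
qed

text \<open>The derivative along the j-th coordinate of the symmetric algebra, with the identity on
  the exterior factor. Being even, it passes that factor without sign, and the twist is the
  identity.\<close>

lemma d_even_exists:
  assumes "j \<in> {1..n}"
  obtains D where "superderivation \<O> G 0 D"
    and "\<And>k. k \<in> {1..n} \<Longrightarrow> D (odd_gen H0 H1 (e0 k)) = \<zero>\<^bsub>\<O>\<^esub>"
    and "\<And>k. k \<in> {1..n} \<Longrightarrow> D (even_gen H0 H1 (e1 k)) = (if k = j then \<one>\<^bsub>\<O>\<^esub> else \<zero>\<^bsub>\<O>\<^esub>)"
proof -
  obtain f where f: "twisted_derivation Sym.Q Sym.Q (\<lambda>x. x) (\<lambda>x. x) f"
    and f_\<iota>: "\<And>v. v \<in> H1 \<Longrightarrow> f (Sym.\<iota> v) = coord e1 j v \<odot>\<^bsub>Sym.Q\<^esub> \<one>\<^bsub>Sym.Q\<^esub>"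
    by (rule Sym.derivation_exists[of "coord e1 j"];
        (rule coord_add[OF basis1] coord_scale[OF basis1] that; assumption))
  note f_linear = twisted_derivation_linear[OF f]
  note [simp] = linear_map_closed[OF f_linear]
  have f_one: "f \<one>\<^bsub>Sym.Q\<^esub> = \<zero>\<^bsub>Sym.Q\<^esub>"
    using twisted_derivation_mult[OF f, of "\<one>\<^bsub>Sym.Q\<^esub>" "\<one>\<^bsub>Sym.Q\<^esub>"] by simp
  obtain D where D: "linear_map \<O> \<O> D"
    and D_tensor: "\<And>a b. \<lbrakk>a \<in> carrier Ext.Q; b \<in> carrier Sym.Q\<rbrakk> \<Longrightarrow> D (a \<otimes>\<^sub>t b) = a \<otimes>\<^sub>t f b"
    using Ten.tensor_map_exists[OF Ext.Q.linear_map_id f_linear] by blast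
  have "twisted_derivation \<O> \<O> (\<lambda>x. x) (\<lambda>x. x) D"
    by (intro Ten.twisted_derivation_tensorI D Ten.T.Q.linear_map_id)
      (simp add: D_tensor Ten.tensor_mult Ten.tensor_add_r twisted_derivation_mult[OF f])
  moreover have "\<Sigma> (D x) = (- 1) ^ 0 \<odot>\<^bsub>\<O>\<^esub> D (\<Sigma> x)" if "x \<in> carrier \<O>" for x
    by (rule Ten.linear_map_tensor_eqI[OF Ten.T.Q.complex_algebra_axioms linear_map_compose[OF D \<Sigma>_linear]
          Ten.T.Q.linear_map_scale[OF linear_map_compose[OF \<Sigma>_linear D]] _ that])
      (simp add: D_tensor \<Sigma>_tensor)
  ultimately have "superderivation \<O> G 0 D"
    by (intro Ten.T.Q.superderivation_eigenspacesI[of G \<Sigma> "\<lambda>x. x"] G_eigenspace)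
      (simp_all add: G_eigenspace)
  moreover have "D (even_gen H0 H1 (e1 k)) = (if k = j then \<one>\<^bsub>\<O>\<^esub> else \<zero>\<^bsub>\<O>\<^esub>)" if "k \<in> {1..n}" for k
    using that \<open>j \<in> {1..n}\<close> basis_in[OF basis1 that]
    by (simp add: even_gen_eq D_tensor f_\<iota> coord_basis[OF basis1] Ten.tensor_one tensor_zero_r
        del: atLeastAtMost_iff)
  moreover have "D (odd_gen H0 H1 (e0 k)) = \<zero>\<^bsub>\<O>\<^esub>" if "k \<in> {1..n}" for k
    using basis_in[OF basis0 that] by (simp add: odd_gen_eq D_tensor f_one tensor_zero_r)
  ultimately show ?thesis using that by blast
qed

text \<open>R is shown to be preserved by left multiplication with ever larger classes: basis
  vectors, all vectors of H0 and H1, all of both factors. Keeping the argument z arbitrary in each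
  stage lets the stages be chained, and a pure tensor is then a product of two such multiplications
  applied to the unit.\<close>

lemma generated_O:
  assumes a: "a \<in> carrier \<O>"
    and one: "R \<one>\<^bsub>\<O>\<^esub>"
    and add: "\<And>a b. \<lbrakk>a \<in> carrier \<O>; b \<in> carrier \<O>; R a; R b\<rbrakk> \<Longrightarrow> R (a \<oplus>\<^bsub>\<O>\<^esub> b)"
    and smult: "\<And>c a. \<lbrakk>a \<in> carrier \<O>; R a\<rbrakk> \<Longrightarrow> R (c \<odot>\<^bsub>\<O>\<^esub> a)"
    and x: "\<And>k a. \<lbrakk>k \<in> {1..n}; a \<in> carrier \<O>; R a\<rbrakk> \<Longrightarrow> R (odd_gen H0 H1 (e0 k) \<otimes>\<^bsub>\<O>\<^esub> a)"
    and y: "\<And>k a. \<lbrakk>k \<in> {1..n}; a \<in> carrier \<O>; R a\<rbrakk> \<Longrightarrow> R (even_gen H0 H1 (e1 k) \<otimes>\<^bsub>\<O>\<^esub> a)"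
  shows "R a"
proof -
  have zero: "R \<zero>\<^bsub>\<O>\<^esub>"
    using smult[of "\<one>\<^bsub>\<O>\<^esub>" 0] one by simp
  have H0: "form.span (e0 ` {1..n}) = H0" and H1: "form.span (e1 ` {1..n}) = H1"
    using basis0 basis1 by (auto simp: is_basis_def)
  have odd_zero: "Ext.\<iota> 0 = \<zero>\<^bsub>Ext.Q\<^esub>"
    using Ext.\<iota>_scale[of 0 0] form.subspace_0[OF Ext.subspace] by (simp add: form_scale_def zero_fun_def)
  have even_zero: "Sym.\<iota> 0 = \<zero>\<^bsub>Sym.Q\<^esub>"
    using Sym.\<iota>_scale[of 0 0] form.subspace_0[OF Sym.subspace] by (simp add: form_scale_def zero_fun_def)
  have odd: "R ((Ext.\<iota> v \<otimes>\<^sub>t \<one>\<^bsub>Sym.Q\<^esub>) \<otimes>\<^bsub>\<O>\<^esub> z)" if v: "v \<in> H0" and z: "z \<in> carrier \<O>" "R z" for v z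
  proof -
    \<comment> \<open>Membership in H0 is carried through the span induction because
      \<open>\<iota>\<close> is known to be linear only there.\<close>
    have "v \<in> H0 \<and> R ((Ext.\<iota> v \<otimes>\<^sub>t \<one>\<^bsub>Sym.Q\<^esub>) \<otimes>\<^bsub>\<O>\<^esub> z)"
      using v unfolding H0[symmetric]
    proof (rule form.span_induct, unfold H0)
      show "form.subspace {v. v \<in> H0 \<and> R ((Ext.\<iota> v \<otimes>\<^sub>t \<one>\<^bsub>Sym.Q\<^esub>) \<otimes>\<^bsub>\<O>\<^esub> z)}"
        unfolding form.subspace_def
        using z zero form.subspace_0[OF Ext.subspace] form.subspace_add[OF Ext.subspace]
          form.subspace_scale[OF Ext.subspace]
        by (auto simp: odd_zero tensor_zero_l Ext.\<iota>_add Ext.\<iota>_scale Ten.tensor_add_l Ten.tensor_smult_l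
            Ten.T.Q.l_distr Ten.T.Q.smult_mult_l intro!: add smult)
      show "v \<in> H0 \<and> R ((Ext.\<iota> v \<otimes>\<^sub>t \<one>\<^bsub>Sym.Q\<^esub>) \<otimes>\<^bsub>\<O>\<^esub> z)" if "v \<in> e0 ` {1..n}" for v
        using that x z basis_in[OF basis0] unfolding odd_gen_eq by blast
    qed
    then show ?thesis ..
  qed
  have even: "R ((\<one>\<^bsub>Ext.Q\<^esub> \<otimes>\<^sub>t Sym.\<iota> v) \<otimes>\<^bsub>\<O>\<^esub> z)" if v: "v \<in> H1" and z: "z \<in> carrier \<O>" "R z" for v z
  proof -
    have "v \<in> H1 \<and> R ((\<one>\<^bsub>Ext.Q\<^esub> \<otimes>\<^sub>t Sym.\<iota> v) \<otimes>\<^bsub>\<O>\<^esub> z)"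
      using v unfolding H1[symmetric]
    proof (rule form.span_induct, unfold H1)
      show "form.subspace {v. v \<in> H1 \<and> R ((\<one>\<^bsub>Ext.Q\<^esub> \<otimes>\<^sub>t Sym.\<iota> v) \<otimes>\<^bsub>\<O>\<^esub> z)}"
        unfolding form.subspace_def
        using z zero form.subspace_0[OF Sym.subspace] form.subspace_add[OF Sym.subspace]
          form.subspace_scale[OF Sym.subspace]
        by (auto simp: even_zero tensor_zero_r Sym.\<iota>_add Sym.\<iota>_scale Ten.tensor_add_r Ten.tensor_smult_r
            Ten.T.Q.l_distr Ten.T.Q.smult_mult_l intro!: add smult)
      show "v \<in> H1 \<and> R ((\<one>\<^bsub>Ext.Q\<^esub> \<otimes>\<^sub>t Sym.\<iota> v) \<otimes>\<^bsub>\<O>\<^esub> z)" if "v \<in> e1 ` {1..n}" for v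
        using that y z basis_in[OF basis1] unfolding even_gen_eq by blast
    qed
    then show ?thesis ..
  qed
  have ext: "R ((a \<otimes>\<^sub>t \<one>\<^bsub>Sym.Q\<^esub>) \<otimes>\<^bsub>\<O>\<^esub> z)" if "a \<in> carrier Ext.Q" and z: "z \<in> carrier \<O>" "R z" for a z
    using that(1)
  proof (induction a rule: Ext.quotient_induct)
    case (mult v a)
    have "(Ext.\<iota> v \<otimes>\<^bsub>Ext.Q\<^esub> a) \<otimes>\<^sub>t \<one>\<^bsub>Sym.Q\<^esub> = (Ext.\<iota> v \<otimes>\<^sub>t \<one>\<^bsub>Sym.Q\<^esub>) \<otimes>\<^bsub>\<O>\<^esub> (a \<otimes>\<^sub>t \<one>\<^bsub>Sym.Q\<^esub>)"
      using mult by (simp add: Ten.tensor_mult)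
    then show ?case
      using odd[OF mult(1) _ mult(3)] mult(1,2) z by (simp add: Ten.T.Q.m_assoc)
  qed (use z in \<open>simp_all add: zero tensor_zero_l Ten.tensor_one Ten.tensor_add_l Ten.tensor_smult_l
      Ten.T.Q.l_distr Ten.T.Q.smult_mult_l add smult\<close>)
  have sym: "R ((\<one>\<^bsub>Ext.Q\<^esub> \<otimes>\<^sub>t b) \<otimes>\<^bsub>\<O>\<^esub> z)" if "b \<in> carrier Sym.Q" and z: "z \<in> carrier \<O>" "R z" for b z
    using that(1)
  proof (induction b rule: Sym.quotient_induct)
    case (mult v b)
    have "\<one>\<^bsub>Ext.Q\<^esub> \<otimes>\<^sub>t (Sym.\<iota> v \<otimes>\<^bsub>Sym.Q\<^esub> b) = (\<one>\<^bsub>Ext.Q\<^esub> \<otimes>\<^sub>t Sym.\<iota> v) \<otimes>\<^bsub>\<O>\<^esub> (\<one>\<^bsub>Ext.Q\<^esub> \<otimes>\<^sub>t b)"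
      using mult by (simp add: Ten.tensor_mult)
    then show ?case
      using even[OF mult(1) _ mult(3)] mult(1,2) z by (simp add: Ten.T.Q.m_assoc)
  qed (use z in \<open>simp_all add: zero tensor_zero_r Ten.tensor_one Ten.tensor_add_r Ten.tensor_smult_r
      Ten.T.Q.l_distr Ten.T.Q.smult_mult_l add smult\<close>)
  show "R a"
    using a
  proof (induction a rule: Ten.tensor_induct)
    case (tensor a b)
    \<comment> \<open>The trailing unit is the starting point, where R holds by assumption; first b
      and then a is multiplied on.\<close>
    then have "a \<otimes>\<^sub>t b = (a \<otimes>\<^sub>t \<one>\<^bsub>Sym.Q\<^esub>) \<otimes>\<^bsub>\<O>\<^esub> ((\<one>\<^bsub>Ext.Q\<^esub> \<otimes>\<^sub>t b) \<otimes>\<^bsub>\<O>\<^esub> \<one>\<^bsub>\<O>\<^esub>)"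
      by (simp add: Ten.tensor_mult)
    then show ?case
      using ext[OF tensor(1) _ sym[OF tensor(2) _ one]] tensor by simp
  qed (use zero add in auto)
qed

section \<open>From the abstract generators and derivations to the BV algebra of forms\<close>

interpretation gens: bv_generators \<O> G n "\<lambda>k. odd_gen H0 H1 (e0 k)" "\<lambda>k. even_gen H0 H1 (e1 k)"
proof (intro bv_generators.intro supercommutative_algebra.intro supercommutative_algebra_axioms.intro
    bv_generators_axioms.intro Ten.T.Q.complex_algebra_axioms superalgebra_O supercommutative_O)
  show "odd_gen H0 H1 (e0 k) \<in> G 1" if "k \<in> {1..n}" for k
    using basis_in[OF basis0 that]
    by (simp add: G_eigenspace odd_gen_eq \<Sigma>_tensor Ext.\<sigma>_\<iota> Ten.tensor_smult_l)
  show "even_gen H0 H1 (e1 k) \<in> G 0" if "k \<in> {1..n}" for k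
    using basis_in[OF basis1 that] by (simp add: G_eigenspace even_gen_eq \<Sigma>_tensor)
qed (rule generated_O)

interpretation ders: bv_derivations \<O> G n "\<lambda>k. odd_gen H0 H1 (e0 k)" "\<lambda>k. even_gen H0 H1 (e1 k)"
  "d_odd H0 H1 n e0 e1" "d_even H0 H1 n e0 e1"
proof (intro bv_derivations.intro gens.bv_generators_axioms bv_derivations_axioms.intro)
  fix i assume i: "i \<in> {1..n}"
  obtain D where D: "superderivation \<O> G 1 D"
    "\<And>k. k \<in> {1..n} \<Longrightarrow> D (odd_gen H0 H1 (e0 k)) = (if k = i then \<one>\<^bsub>\<O>\<^esub> else \<zero>\<^bsub>\<O>\<^esub>)"
    "\<And>k. k \<in> {1..n} \<Longrightarrow> D (even_gen H0 H1 (e1 k)) = \<zero>\<^bsub>\<O>\<^esub>"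
    using d_odd_exists[OF i] by blast
  \<comment> \<open>The description in \<open>d_odd\<close> is written with
    \<open>O_BV H0 H1\<close>, so \<open>O_BV_eq\<close> is used backwards until
    \<open>d_odd_def\<close> can be folded, and forwards again afterwards.\<close>
  note gens.the_superderivation[OF D, folded O_BV_eq, folded d_odd_def[unfolded Let_def]]
  then show "superderivation \<O> G 1 (d_odd H0 H1 n e0 e1 i)"
    "\<And>k. k \<in> {1..n} \<Longrightarrow> d_odd H0 H1 n e0 e1 i (odd_gen H0 H1 (e0 k)) = (if k = i then \<one>\<^bsub>\<O>\<^esub> else \<zero>\<^bsub>\<O>\<^esub>)"
    "\<And>k. k \<in> {1..n} \<Longrightarrow> d_odd H0 H1 n e0 e1 i (even_gen H0 H1 (e1 k)) = \<zero>\<^bsub>\<O>\<^esub>"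
    unfolding O_BV_eq by blast+
  obtain E where E: "superderivation \<O> G 0 E"
    "\<And>k. k \<in> {1..n} \<Longrightarrow> E (odd_gen H0 H1 (e0 k)) = \<zero>\<^bsub>\<O>\<^esub>"
    "\<And>k. k \<in> {1..n} \<Longrightarrow> E (even_gen H0 H1 (e1 k)) = (if k = i then \<one>\<^bsub>\<O>\<^esub> else \<zero>\<^bsub>\<O>\<^esub>)"
    using d_even_exists[OF i] by blast
  note gens.the_superderivation[OF E, folded O_BV_eq, folded d_even_def[unfolded Let_def]]
  then show "superderivation \<O> G 0 (d_even H0 H1 n e0 e1 i)"
    "\<And>k. k \<in> {1..n} \<Longrightarrow> d_even H0 H1 n e0 e1 i (odd_gen H0 H1 (e0 k)) = \<zero>\<^bsub>\<O>\<^esub>"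
    "\<And>k. k \<in> {1..n} \<Longrightarrow> d_even H0 H1 n e0 e1 i (even_gen H0 H1 (e1 k)) = (if k = i then \<one>\<^bsub>\<O>\<^esub> else \<zero>\<^bsub>\<O>\<^esub>)"
    unfolding O_BV_eq by blast+
qed

theorem bv_superalgebra_O_BV: "bv_superalgebra (O_BV H0 H1) G (Delta_BV H0 H1 n e0 e1 I)"
proof -
  have "Delta_BV H0 H1 n e0 e1 I = ders.\<Delta> I"
    by (simp add: fun_eq_iff Delta_BV_def ders.\<Delta>_def O_BV_eq Let_def)
  then show ?thesis
    using ders.bv_superalgebra_\<Delta>[of I] by (simp add: O_BV_eq)
qed

end

theorem proposition5p5:
  fixes X :: "('x::t2_space, 'a) surface"
    and \<rho> :: "'a \<Rightarrow> 'x \<Rightarrow> real"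
    and F :: "('x, 'a, 'r) vbundle"
    and h :: "'a \<Rightarrow> 'x \<Rightarrow> 'r \<Rightarrow> 'r \<Rightarrow> complex"
    and n :: nat
    and e0 e1 :: "nat \<Rightarrow> ('x, 'a, 'r + 'r \<times> unit) form"
    and H0 H1 :: "('x, 'a, 'r + 'r \<times> unit) form set"
    and M I :: "nat \<Rightarrow> nat \<Rightarrow> complex"
  assumes "compact_riemann_surface X"
    and "surface_metric X \<rho>"
    and "holomorphic_bundle X F"
    and "hermitian_metric X F h"
  defines "H0 \<equiv> harmonic_E X \<rho> F h 0"
    and "H1 \<equiv> harmonic_E X \<rho> F h 1"
  assumes "is_basis n H0 e0"
    and "is_basis n H1 e1"
  defines "M \<equiv> serre_matrix X F e0 e1"
    and "I \<equiv> inverse_on {1..n} M"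
  shows "bv_superalgebra (O_BV H0 H1) (O_BV_parity H0 H1) (Delta_BV H0 H1 n e0 e1 I)"
  \<comment> \<open>The defining equations of H0 and H1 count as assumptions 5 and 6, so 7 and 8 are
    the statements that e0 and e1 are bases.\<close>
  using bv_forms.bv_superalgebra_O_BV[OF bv_forms.intro[OF assms(7,8)]] .

end
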